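(* Let $N\ge4$ be an integer, $\tau\in\mathbf C$ with $\operatorname{Im}\tau>0$, $\Lambda_\tau=\mathbf Z+\mathbf Z\tau$, $E_\tau=\mathbf C/\Lambda_\tau$, and write $\theta_k(z)=\theta_k^{(N)}(z,\tau)$. (1) The map $z\mapsto(\theta_0(z),\theta_1(z),\dots,\theta_{N-1}(z))\in\mathbf C^N$ induces an immersion $$\Theta_\tau:E_\tau\to\mathbf P^{N-1},\qquad z\mapsto(\theta_0(z):\theta_1(z):\dots:\theta_{N-1}(z))$$ of the elliptic curve $E_\tau$ into projective space. (2) The image $E_{\Theta_\tau}=\Theta_\tau(E_\tau)$ is a curve of degree $N$ defined as the intersection of $N(N-3)/2$ quadrics in $\mathbf P^{N-1}$. (3) Let $S=\frac{\tau}{N}\bmod\Lambda_\tau$ and $T=\frac1N\bmod\Lambda_\tau$. The translations of $E_{\Theta_\tau}$ by $\Theta_\tau(S)$ and $\Theta_\tau(T)$ extend to automorphisms of $\mathbf P^{N-1}$ and are expressed by the matrices $M_S$ and $M_T$, and the map $[-1]$ on $E_{\Theta_\tau}$ extends to an automorphism of $\mathbf P^{N-1}$ expressed by the matrix $M_{[-1]}$; that is, for all $z$, as points of $\mathbf P^{N-1}$ (indices in $\mathbf Z/N\mathbf Z$), $$\bigl(\theta_k(z-\tfrac\tau N)\bigr)_k=\bigl(\theta_{k+1}(z)\bigr)_k,\quad \bigl(\theta_k(z-\tfrac1N)\bigr)_k=\bigl(\zeta_N^k\theta_k(z)\bigr)_k,\quad \bigl(\theta_k(-z)\bigr)_k=\bigl(\theta_{-k}(z)\bigr)_k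 .$$
   Context: With $\mathbf e(x)=e^{2\pi i x}$ and $\zeta_N=\mathbf e(1/N)$, for an integer $k$, $$\theta^{(N)}_k(z,\tau)=\sum_{n\in\mathbf Z}\mathbf e\Bigl(\tfrac12N\bigl(n-\tfrac kN+\tfrac12\bigr)^2\tau+N\bigl(n-\tfrac kN+\tfrac12\bigr)\bigl(z+\tfrac12\bigr)\Bigr),$$ which depends only on $k\bmod N$. Matrices (rows and columns indexed by $0,\dots,N-1$), as classes in $PGL_N(\mathbf C)$: $M_S$ has $(i,j)$ entry $1$ if $i\equiv j+1\bmod N$ and $0$ otherwise; $M_T=\operatorname{diag}(1,\zeta_N,\dots,\zeta_N^{N-1})$; $M_{[-1]}$ has $(i,j)$ entry $1$ if $i\equiv-j\bmod N$ and $0$ otherwise. They are understood as the matrices, with respect to the basis of coordinate functions $X_0,\dots,X_{N-1}$, of the operators induced on coordinate functions by $h(P)\mapsto h(P-S)$, $h(P)\mapsto h(P-T)$, $h(P)\mapsto h(-P)$ (up to a common factor). *)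

theory Defs
  imports
    "HOL-Analysis.Analysis"
    "HOL-Computational_Algebra.Polynomial"
    "HOL-Library.Poly_Mapping"
    "HOL-Library.Extended_Nat"
    "Jordan_Normal_Form.Matrix"
begin

unbundle no vec_syntax

section \<open>Theta functions\<close>

definition ee :: "complex \<Rightarrow> complex" where
  "ee x = exp (2 * of_real pi * \<i> * x)"

definition zeta :: "nat \<Rightarrow> complex" where
  "zeta N = ee (1 / of_nat N)"

definition theta :: "nat \<Rightarrow> int \<Rightarrow> complex \<Rightarrow> complex \<Rightarrow> complex" where
  "theta N k z \<tau> =
     (\<Sum>\<^sub>\<infinity>n\<in>(UNIV :: int set).
        ee (1/2 * of_nat N * (of_int n - of_int k / of_nat N + 1/2)^2 * \<tau>
            + of_nat N * (of_int n - of_int k / of_nat N + 1/2) * (z + 1/2)))"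

definition theta_vec :: "nat \<Rightarrow> complex \<Rightarrow> complex \<Rightarrow> complex Matrix.vec" where
  "theta_vec N \<tau> z = Matrix.vec N (\<lambda>k. theta N (int k) z \<tau>)"


section \<open>The complex torus\<close>

definition lattice :: "complex \<Rightarrow> complex set" where
  "lattice \<tau> = {of_int m + of_int n * \<tau> | m n. True}"

definition lattice_rel :: "complex \<Rightarrow> (complex \<times> complex) set" where
  "lattice_rel \<tau> = {(z, w). z - w \<in> lattice \<tau>}"

text \<open>Points of \<open>E\<^sub>\<tau>\<close> are the cosets of the lattice.\<close>

definition torus :: "complex \<Rightarrow> complex set set" where
  "torus \<tau> = UNIV // lattice_rel \<tau>"

definition torus_pt :: "complex \<Rightarrow> complex \<Rightarrow> complex set" where
  "torus_pt \<tau> z = lattice_rel \<tau> `` {z}"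

definition torus_add :: "complex set \<Rightarrow> complex set \<Rightarrow> complex set" where
  "torus_add P Q = {p + q | p q. p \<in> P \<and> q \<in> Q}"

definition torus_neg :: "complex set \<Rightarrow> complex set" where
  "torus_neg P = uminus ` P"


section \<open>Projective space\<close>

text \<open>
  A point of \<open>\<P>\<^sup>N\<^sup>-\<^sup>1\<close> is the set of all its vectors of homogeneous coordinates
  (a line without its origin).
\<close>

definition proj_pt :: "complex Matrix.vec \<Rightarrow> complex Matrix.vec set" where
  "proj_pt v = {c \<cdot>\<^sub>v v | c. c \<noteq> 0}"

definition proj_space :: "nat \<Rightarrow> complex Matrix.vec set set" where
  "proj_space N = proj_pt ` (carrier_vec N - {0\<^sub>v N})"

definition affine_chart :: "nat \<Rightarrow> nat \<Rightarrow> complex Matrix.vec set set" where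
  "affine_chart N i = {P \<in> proj_space N. \<forall>v\<in>P. v $ i \<noteq> 0}"

text \<open>On the chart \<open>X\<^sub>i \<noteq> 0\<close> this is the quotient \<open>X\<^sub>j / X\<^sub>i\<close>, whichever representative is chosen.\<close>

definition affine_coord :: "nat \<Rightarrow> nat \<Rightarrow> complex Matrix.vec set \<Rightarrow> complex" where
  "affine_coord i j P = (let v = (SOME v. v \<in> P) in v $ j / v $ i)"

text \<open>
  Immersions of \<open>E\<^sub>\<tau>\<close> into \<open>\<P>\<^sup>N\<^sup>-\<^sup>1\<close> in the sense of algebraic geometry: injective holomorphic
  maps with nowhere vanishing differential. Since \<open>E\<^sub>\<tau>\<close> is compact, these are the closed
  embeddings. Holomorphy and the differential are tested on the universal cover of \<open>E\<^sub>\<tau>\<close> and in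
  affine charts of \<open>\<P>\<^sup>N\<^sup>-\<^sup>1\<close>.
\<close>

definition torus_immersion ::
  "complex \<Rightarrow> nat \<Rightarrow> (complex set \<Rightarrow> complex Matrix.vec set) \<Rightarrow> bool" where
  "torus_immersion \<tau> N f \<longleftrightarrow>
     f \<in> torus \<tau> \<rightarrow> proj_space N \<and>
     inj_on f (torus \<tau>) \<and>
     (\<forall>z\<^sub>0. \<exists>i<N. \<exists>W. open W \<and> z\<^sub>0 \<in> W \<and>
        (\<forall>z\<in>W. f (torus_pt \<tau> z) \<in> affine_chart N i) \<and>
        (\<forall>j<N. (\<lambda>z. affine_coord i j (f (torus_pt \<tau> z))) holomorphic_on W) \<and>
        (\<exists>j<N. deriv (\<lambda>z. affine_coord i j (f (torus_pt \<tau> z))) z\<^sub>0 \<noteq> 0))"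


section \<open>Polynomials in \<open>X\<^sub>0, \<dots>, X\<^sub>N\<^sub>-\<^sub>1\<close>\<close>

text \<open>
  Monomials are finitely supported exponent functions; polynomials are finitely supported
  functions from monomials to coefficients, with the convolution product of
  \<open>HOL-Library.Poly_Mapping\<close>.
\<close>

type_synonym mpoly = "(nat \<Rightarrow>\<^sub>0 nat) \<Rightarrow>\<^sub>0 complex"

definition mpoly_ring :: "nat \<Rightarrow> mpoly set" where
  "mpoly_ring N = {f. \<forall>m\<in>Poly_Mapping.keys f. Poly_Mapping.keys m \<subseteq> {..<N}}"

definition mpoly_var :: "nat \<Rightarrow> mpoly" where
  "mpoly_var i = Poly_Mapping.single (Poly_Mapping.single i 1) 1"

definition mpoly_scale :: "complex \<Rightarrow> mpoly \<Rightarrow> mpoly" where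
  "mpoly_scale c f = Poly_Mapping.single 0 c * f"

definition forms :: "nat \<Rightarrow> nat \<Rightarrow> mpoly set" where
  "forms N d = {f \<in> mpoly_ring N. \<forall>m\<in>Poly_Mapping.keys f.
      (\<Sum>i\<in>Poly_Mapping.keys m. Poly_Mapping.lookup m i) = d}"

definition mpoly_eval :: "mpoly \<Rightarrow> complex Matrix.vec \<Rightarrow> complex" where
  "mpoly_eval f v = (\<Sum>m\<in>Poly_Mapping.keys f. Poly_Mapping.lookup f m *
      (\<Prod>i\<in>Poly_Mapping.keys m. (v $ i) ^ Poly_Mapping.lookup m i))"

interpretation mpoly: vector_space mpoly_scale
proof
  show "mpoly_scale a (x + y) = mpoly_scale a x + mpoly_scale a y" for a x y
    by (simp add: mpoly_scale_def algebra_simps)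
  show "mpoly_scale (a + b) x = mpoly_scale a x + mpoly_scale b x" for a b x
    by (simp add: mpoly_scale_def single_add algebra_simps)
  show "mpoly_scale a (mpoly_scale b x) = mpoly_scale (a * b) x" for a b x
    by (simp add: mpoly_scale_def mult_single flip: mult.assoc)
  show "mpoly_scale 1 x = x" for x
    by (simp add: mpoly_scale_def)
qed

definition ideal_gen :: "nat \<Rightarrow> mpoly set \<Rightarrow> mpoly set" where
  "ideal_gen N Q = {(\<Sum>q\<in>F. a q * q) | F a. finite F \<and> F \<subseteq> Q \<and> (\<forall>q\<in>F. a q \<in> mpoly_ring N)}"


section \<open>Projective algebraic sets, dimension and degree\<close>

definition zero_locus :: "nat \<Rightarrow> mpoly set \<Rightarrow> complex Matrix.vec set set" where
  "zero_locus N F = {P \<in> proj_space N. \<forall>f\<in>F. \<forall>v\<in>P. mpoly_eval f v = 0}"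

definition zariski_closed :: "nat \<Rightarrow> complex Matrix.vec set set \<Rightarrow> bool" where
  "zariski_closed N X \<longleftrightarrow> (\<exists>F \<subseteq> (\<Union>d. forms N d). X = zero_locus N F)"

definition irreducible_closed :: "nat \<Rightarrow> complex Matrix.vec set set \<Rightarrow> bool" where
  "irreducible_closed N X \<longleftrightarrow> zariski_closed N X \<and> X \<noteq> {} \<and>
     (\<forall>A B. zariski_closed N A \<and> zariski_closed N B \<and> X \<subseteq> A \<union> B \<longrightarrow> X \<subseteq> A \<or> X \<subseteq> B)"

text \<open>Krull dimension: the supremum of the lengths of chains of irreducible closed subsets.\<close>

definition krull_dim :: "nat \<Rightarrow> complex Matrix.vec set set \<Rightarrow> enat" where
  "krull_dim N X = Sup {enat n | n. \<exists>Z :: nat \<Rightarrow> complex Matrix.vec set set.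
     (\<forall>i\<le>n. irreducible_closed N (Z i) \<and> Z i \<subseteq> X) \<and> (\<forall>i<n. Z i \<subset> Z (Suc i))}"

definition projective_curve :: "nat \<Rightarrow> complex Matrix.vec set set \<Rightarrow> bool" where
  "projective_curve N X \<longleftrightarrow> irreducible_closed N X \<and> krull_dim N X = 1"

definition vanishing_forms :: "nat \<Rightarrow> complex Matrix.vec set set \<Rightarrow> nat \<Rightarrow> mpoly set" where
  "vanishing_forms N X d = {f \<in> forms N d. \<forall>P\<in>X. \<forall>v\<in>P. mpoly_eval f v = 0}"

text \<open>
  The dimension of the degree \<open>d\<close> part of the homogeneous coordinate ring of \<open>X\<close>. Both spaces
  are finite-dimensional and the second is contained in the first, so the difference on
  \<^typ>\<open>nat\<close> is the dimension of the quotient.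
\<close>

definition hilbert_function :: "nat \<Rightarrow> complex Matrix.vec set set \<Rightarrow> nat \<Rightarrow> nat" where
  "hilbert_function N X d = mpoly.dim (forms N d) - mpoly.dim (vanishing_forms N X d)"

text \<open>
  The degree of \<open>X\<close> is \<open>r!\<close> times the leading coefficient of its Hilbert polynomial, where \<open>r\<close> is
  the degree of that polynomial.
\<close>

definition has_proj_degree :: "nat \<Rightarrow> complex Matrix.vec set set \<Rightarrow> nat \<Rightarrow> bool" where
  "has_proj_degree N X D \<longleftrightarrow> (\<exists>p :: rat poly.
     (\<forall>\<^sub>F d in sequentially. of_nat (hilbert_function N X d) = poly p (of_nat d)) \<and>
     fact (Polynomial.degree p) * lead_coeff p = of_nat D)"

text \<open>
  \<open>X\<close> is the intersection of the hypersurfaces in \<open>Q\<close>, as a set and as a scheme with the reduced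
  structure on \<open>X\<close>. For the latter: in each chart \<open>X\<^sub>i \<noteq> 0\<close> the dehomogenisations of the elements
  of \<open>Q\<close> generate the ideal of \<open>X\<close>. After clearing denominators this means that every form \<open>f\<close>
  vanishing on \<open>X\<close> lies in the ideal generated by \<open>Q\<close> after multiplication by a power of \<open>X\<^sub>i\<close>.
\<close>

definition scheme_intersection :: "nat \<Rightarrow> complex Matrix.vec set set \<Rightarrow> mpoly set \<Rightarrow> bool" where
  "scheme_intersection N X Q \<longleftrightarrow> X = zero_locus N Q \<and>
     (\<forall>d. \<forall>f\<in>vanishing_forms N X d. \<forall>i<N. \<exists>e. mpoly_var i ^ e * f \<in> ideal_gen N Q)"


section \<open>Automorphisms of projective space\<close>

definition proj_automorphism ::
  "nat \<Rightarrow> (complex Matrix.vec set \<Rightarrow> complex Matrix.vec set) \<Rightarrow> bool" where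
  "proj_automorphism N \<phi> \<longleftrightarrow> (\<exists>A \<in> carrier_mat N N. invertible_mat A \<and>
     (\<forall>P\<in>proj_space N. \<phi> P = (\<lambda>v. A *\<^sub>v v) ` P))"

text \<open>
  A matrix \<open>M\<close> expresses the automorphism \<open>\<phi>\<close> if, up to a common factor, it is the matrix with
  respect to the basis \<open>X\<^sub>0, \<dots>, X\<^sub>N\<^sub>-\<^sub>1\<close> of the operator \<open>h \<mapsto> h \<circ> \<phi>\<^sup>-\<^sup>1\<close> on coordinate functions
  (for the translation by \<open>S\<close>, this is \<open>h(P) \<mapsto> h(P - S)\<close>). The columns of \<open>M\<close> are the images of
  the basis, \<open>X\<^sub>j \<circ> \<phi>\<^sup>-\<^sup>1 = (\<Sum>i. M\<^sub>i\<^sub>j X\<^sub>i)\<close>, hence \<open>\<phi>\<^sup>-\<^sup>1\<close> acts on points by the transpose of \<open>M\<close>.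
\<close>

definition expressed_by ::
  "nat \<Rightarrow> (complex Matrix.vec set \<Rightarrow> complex Matrix.vec set) \<Rightarrow> complex mat \<Rightarrow> bool" where
  "expressed_by N \<phi> M \<longleftrightarrow> M \<in> carrier_mat N N \<and> invertible_mat M \<and>
     (\<forall>P\<in>proj_space N. \<phi> ((\<lambda>v. transpose_mat M *\<^sub>v v) ` P) = P)"

definition M_S :: "nat \<Rightarrow> complex mat" where
  "M_S N = mat N N (\<lambda>(i, j). if i mod N = (j + 1) mod N then 1 else 0)"

definition M_T :: "nat \<Rightarrow> complex mat" where
  "M_T N = mat N N (\<lambda>(i, j). if i = j then zeta N ^ i else 0)"

definition M_neg :: "nat \<Rightarrow> complex mat" where
  "M_neg N = mat N N (\<lambda>(i, j). if int i mod int N = (- int j) mod int N then 1 else 0)"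


section \<open>The map \<open>\<Theta>\<^sub>\<tau>\<close> and the group law on its image\<close>

text \<open>
  The usual lifting to equivalence classes; it is meaningful once \<open>z \<mapsto> proj_pt (theta_vec N \<tau> z)\<close>
  is known to respect \<open>lattice_rel \<tau>\<close>.
\<close>

definition Theta :: "nat \<Rightarrow> complex \<Rightarrow> complex set \<Rightarrow> complex Matrix.vec set" where
  "Theta N \<tau> P = (\<Union>z\<in>P. proj_pt (theta_vec N \<tau> z))"

definition Theta_curve :: "nat \<Rightarrow> complex \<Rightarrow> complex Matrix.vec set set" where
  "Theta_curve N \<tau> = Theta N \<tau> ` torus \<tau>"

text \<open>The group structure of \<open>E\<^sub>\<tau>\<close> transported along the injective map \<open>\<Theta>\<^sub>\<tau>\<close>.\<close>

definition curve_add ::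
  "nat \<Rightarrow> complex \<Rightarrow> complex Matrix.vec set \<Rightarrow> complex Matrix.vec set \<Rightarrow> complex Matrix.vec set" where
  "curve_add N \<tau> x y = Theta N \<tau>
     (torus_add (inv_into (torus \<tau>) (Theta N \<tau>) x) (inv_into (torus \<tau>) (Theta N \<tau>) y))"

definition curve_neg ::
  "nat \<Rightarrow> complex \<Rightarrow> complex Matrix.vec set \<Rightarrow> complex Matrix.vec set" where
  "curve_neg N \<tau> x = Theta N \<tau> (torus_neg (inv_into (torus \<tau>) (Theta N \<tau>) x))"

end

theory Submission
  imports Defs "HOL-Complex_Analysis.Complex_Analysis" "HOL-Library.Function_Algebras"
begin

text \<open>
  All statements reduce to the zeros of theta functions, i.e. of entire functions with period \<open>1\<close> and
  \<open>f (z + \<tau>) = c e(-m z) f z\<close>. There is an explicit product of degree \<open>m = 1\<close> with simple zeros exactly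
  at the lattice points; dividing by its translates lowers the degree, and Liouville's theorem settles
  degree \<open>0\<close>. Hence in degree \<open>m\<close> the dimension is \<open>m\<close>, each prescribed zero lowers it by one as long as
  \<open>m \<ge> 2\<close>, and this gives base point freeness and the separation of points and tangent vectors.

  For the quadrics, choose a linear form \<open>l\<close> that vanishes at exactly \<open>N\<close> points of the curve. In linear
  coordinates adapted to these points, the forms of degree \<open>d\<close> are spanned modulo \<open>l\<close> and the quadrics
  through the curve by \<open>N\<close> monomials, which the \<open>N\<close> points separate. So a form that vanishes on the curve
  is \<open>l g\<close> modulo the quadrics, where \<open>g\<close> again vanishes on the curve, and induction on \<open>d\<close> applies.
  If a common zero \<open>v\<close> of the quadrics were not on the curve, two hyperplanes through \<open>v\<close> would have no
  common point on the curve, and by the base-point-free pencil trick all cubic forms would vanish at \<open>v\<close>.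
\<close>

section \<open>The exponential and entire functions\<close>

text \<open>The multiplier \<open>c\<close> of a theta function carries Abel's theorem: a product of
  translates \<open>sig (z - a i)\<close> has as multiplier the product of the
  \<open>- ee (a i)\<close>, so all zeros but one can be chosen and the last is forced. Hence a
  given point can be avoided only from degree 2 on, and the constructions of sections below keep a
  factor of degree at least 2 in reserve. The same rule supplies the hyperplane section: its zeros
  are taken in arithmetic progression with step \<open>1 / N\<close>, where distinctness is evident
  and only the starting point has to be fitted to \<open>c0\<close>. The bound
  \<open>N \<ge> 4\<close> is decisive in \<open>mixed_cubic\<close>, where a third adapted linear
  form must be available besides two given ones; for \<open>N = 3\<close> the image would be a plane
  cubic, which lies on no quadric. The pencil trick wants the degree of the cofactor to exceed that
  of the pencil. This governs both of its uses: restriction of forms to the curve is shown to be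
  surjective after splitting off a base point, and common zeros are tested with cubic forms, whose
  quadratic cofactors have degree \<open>2 * N\<close> against a pencil of degree
  \<open>N\<close>.\<close>

lemma ee_add: "ee (x + y) = ee x * ee y"
  by (simp add: ee_def distrib_left exp_add)

lemma ee_diff: "ee (x - y) = ee x / ee y"
  by (simp add: ee_def right_diff_distrib exp_diff)

lemma ee_minus: "ee (- x) = inverse (ee x)"
  by (simp add: ee_def exp_minus)

lemma ee_0 [simp]: "ee 0 = 1"
  by (simp add: ee_def)

lemma ee_nonzero [simp]: "ee x \<noteq> 0"
  by (simp add: ee_def)

lemma ee_eq_1_iff: "ee x = 1 \<longleftrightarrow> (\<exists>m::int. x = of_int m)"
proof
  assume "ee x = 1"
  then obtain m :: int where m: "Re (2 * of_real pi * \<i> * x) = 0"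
      "Im (2 * of_real pi * \<i> * x) = of_int (2 * m) * pi"
    unfolding ee_def exp_eq_1 by auto
  hence "Im x = 0" "Re x = of_int m" by auto
  hence "x = of_int m" by (intro complex_eqI) auto
  thus "\<exists>m::int. x = of_int m" ..
next
  assume "\<exists>m::int. x = of_int m"
  thus "ee x = 1" by (auto simp: ee_def exp_eq_1)
qed

lemma ee_of_int [simp]: "ee (of_int m) = 1"
  by (auto simp: ee_eq_1_iff)

lemma ee_1 [simp]: "ee 1 = 1"
  using ee_of_int[of 1] by simp

lemma ee_of_nat [simp]: "ee (of_nat m) = 1"
  using ee_of_int[of "int m"] by simp

lemma ee_half: "ee (1/2) = -1"
  using exp_pi_i' by (simp add: ee_def mult.commute)

lemma ee_power: "ee x ^ n = ee (of_nat n * x)"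
  by (simp add: ee_def exp_of_nat_mult [symmetric] mult_ac)

lemma ee_surj: "c \<noteq> 0 \<Longrightarrow> \<exists>s. ee s = c"
proof -
  assume "c \<noteq> 0"
  hence "ee (Ln c / (2 * of_real pi * \<i>)) = c"
    by (simp add: ee_def)
  thus ?thesis ..
qed

lemma norm_ee: "norm (ee x) = exp (- 2 * pi * Im x)"
  by (simp add: ee_def)

lemma holomorphic_ee [holomorphic_intros]:
  "f holomorphic_on A \<Longrightarrow> (\<lambda>z. ee (f z)) holomorphic_on A"
  unfolding ee_def by (intro holomorphic_intros)

lemma continuous_on_ee [continuous_intros]:
  "continuous_on A f \<Longrightarrow> continuous_on A (\<lambda>z. ee (f z))"
  unfolding ee_def by (intro continuous_intros)

lemma DERIV_ee: "(ee has_field_derivative 2 * of_real pi * \<i> * ee z) (at z)"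
  unfolding ee_def by (auto intro!: derivative_eq_intros)

lemma holomorphic_compose_UNIV:
  "f holomorphic_on UNIV \<Longrightarrow> g holomorphic_on A \<Longrightarrow> (\<lambda>z. f (g z)) holomorphic_on A"
  using holomorphic_on_compose_gen[of g A f UNIV] by (simp add: o_def)

text \<open>The factor \<open>f\<close> vanishes on the nonempty open set where \<open>g\<close>
  does not, hence everywhere by the identity theorem. This is how common factors are cancelled
  throughout.\<close>

lemma entire_mult_zeroD:
  assumes f: "f holomorphic_on UNIV" and g: "g holomorphic_on UNIV"
    and fg: "\<And>z. f z * g z = 0" and nz: "g z0 \<noteq> (0::complex)"
  shows "f z = 0"
proof -
  have "continuous_on UNIV g" using g by (rule holomorphic_on_imp_continuous_on)
  hence op: "open {z. g z \<noteq> 0}"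
    by (intro open_Collect_neq) auto
  show ?thesis
    by (rule analytic_continuation_open[OF op, of UNIV f "\<lambda>_. 0"])
       (use fg nz f in auto)
qed

text \<open>All zeros of \<open>g\<close> are simple, so the singularities of \<open>f / g\<close>
  are removable. Near a zero \<open>p\<close> the quotient equals the quotient of the two difference
  quotients at \<open>p\<close>, which are entire, and the denominator takes the value
  \<open>deriv g p\<close> at \<open>p\<close>.\<close>

lemma entire_divide:
  assumes f: "f holomorphic_on UNIV" and g: "g holomorphic_on UNIV"
    and z: "\<And>z. g z = 0 \<Longrightarrow> f z = 0 \<and> deriv g z \<noteq> 0"
  obtains h where "h holomorphic_on UNIV" "\<And>z. f z = g z * h z"
proof
  define h where "h = (\<lambda>z. if g z = 0 then deriv f z / deriv g z else f z / g z)"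
  show "f z = g z * h z" for z
    using z by (simp add: h_def)
  have "h field_differentiable at p" for p
  proof -
    define F where "F = (\<lambda>z. if z = p then deriv f p else (f z - f p) / (z - p))"
    define G where "G = (\<lambda>z. if z = p then deriv g p else (g z - g p) / (z - p))"
    have hF: "F holomorphic_on UNIV" and hG: "G holomorphic_on UNIV"
      unfolding F_def G_def using f g by (auto intro!: pole_lemma)
    have cg: "continuous_on UNIV g" and cG: "continuous_on UNIV G"
      using g hG by (auto intro: holomorphic_on_imp_continuous_on)
    show ?thesis
    proof (cases "g p = 0")
      case False
      define U where "U = {z. g z \<noteq> 0}"
      have "open U" unfolding U_def using cg by (intro open_Collect_neq) auto
      have "(\<lambda>z. f z / g z) holomorphic_on U"
        by (intro holomorphic_intros holomorphic_on_subset[OF f] holomorphic_on_subset[OF g])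
           (auto simp: U_def)
      hence "h holomorphic_on U"
        by (rule holomorphic_transform) (auto simp: h_def U_def)
      thus ?thesis
        using \<open>open U\<close> False by (auto simp: U_def holomorphic_on_open field_differentiable_def)
    next
      case True
      \<comment> \<open>In \<open>U\<close> the point \<open>p\<close> is the only zero of
        \<open>g\<close>, because \<open>g z = (z - p) * G z\<close>.\<close>
      define U where "U = {z. G z \<noteq> 0}"
      have "open U" unfolding U_def using cG by (intro open_Collect_neq) auto
      have "(\<lambda>z. F z / G z) holomorphic_on U"
        by (intro holomorphic_intros holomorphic_on_subset[OF hF] holomorphic_on_subset[OF hG])
           (auto simp: U_def)
      moreover have "h z = F z / G z" if "z \<in> U" for z
      proof (cases "z = p")
        case True
        thus ?thesis using \<open>g p = 0\<close> by (simp add: h_def F_def G_def)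
      next
        case False
        hence "g z \<noteq> 0" using that \<open>g p = 0\<close> by (auto simp: U_def G_def)
        thus ?thesis using False \<open>g p = 0\<close> z[of p] by (simp add: h_def F_def G_def)
      qed
      ultimately have "h holomorphic_on U"
        by (auto intro: holomorphic_transform)
      moreover have "p \<in> U" using z[OF True] by (simp add: U_def G_def)
      ultimately show ?thesis
        using \<open>open U\<close> by (auto simp: holomorphic_on_open field_differentiable_def)
    qed
  qed
  thus "h holomorphic_on UNIV"
    by (auto simp: holomorphic_on_def intro: field_differentiable_at_within)
qed

section \<open>An entire function with simple zeros at the lattice points\<close>

text \<open>The infinite q-Pochhammer symbol \<open>(w; q)\<close>.\<close>

definition qprod :: "complex \<Rightarrow> complex \<Rightarrow> complex" where
  "qprod q w = prodinf (\<lambda>n. 1 - q ^ n * w)"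

context
  fixes q :: complex
  assumes q: "norm q < 1"
begin

lemma summable_norm_qpow: "summable (\<lambda>n. norm (q ^ n * w))"
proof -
  have "summable (\<lambda>n. norm q ^ n)" using q by (simp add: summable_geometric)
  hence "summable (\<lambda>n. norm q ^ n * norm w)" by (rule summable_mult2)
  thus ?thesis by (simp add: norm_mult norm_power)
qed

lemma convergent_qprod: "convergent_prod (\<lambda>n. 1 - q ^ n * w)"
  by (rule abs_convergent_prod_imp_convergent_prod, rule summable_imp_abs_convergent_prod)
     (use summable_norm_qpow[of w] in simp)

lemma qprod_LIMSEQ: "(\<lambda>n. \<Prod>k<n. 1 - q ^ k * w) \<longlonglongrightarrow> qprod q w"
  unfolding qprod_def LIMSEQ_lessThan_iff_atMost
  by (rule convergent_prod_LIMSEQ) (rule convergent_qprod)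

lemma qprod_shift: "qprod q w = (1 - w) * qprod q (q * w)"
proof (rule LIMSEQ_unique)
  show "(\<lambda>n. \<Prod>k<Suc n. 1 - q ^ k * w) \<longlonglongrightarrow> qprod q w"
    using qprod_LIMSEQ by (rule LIMSEQ_Suc)
  have "(\<Prod>k<Suc n. 1 - q ^ k * w) = (1 - w) * (\<Prod>k<n. 1 - q ^ k * (q * w))" for n
    by (subst prod.lessThan_Suc_shift) (simp add: mult_ac)
  thus "(\<lambda>n. \<Prod>k<Suc n. 1 - q ^ k * w) \<longlonglongrightarrow> (1 - w) * qprod q (q * w)"
    using tendsto_mult[OF tendsto_const qprod_LIMSEQ[of "q * w"], of "1 - w"] by simp
qed

text \<open>A product convergent in the sense of \<open>convergent_prod\<close> vanishes only if one
  of its factors does, and in the disc none does.\<close>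

lemma qprod_nonzero_disc: assumes "norm w < 1" shows "qprod q w \<noteq> 0"
  unfolding qprod_def
proof (rule prodinf_nonzero[OF convergent_qprod])
  fix n
  have "norm (q ^ n * w) < 1"
  proof -
    have "norm q ^ n * norm w \<le> 1 * norm w"
      using q by (intro mult_right_mono power_le_one) auto
    thus ?thesis using assms by (simp add: norm_mult norm_power)
  qed
  thus "1 - q ^ n * w \<noteq> 0" by auto
qed

text \<open>After finitely many factors are split off, the argument \<open>q ^ n * w\<close> of the
  remaining product lies in the unit disc, where the product has no zeros; so a zero comes from one
  of the split-off factors.\<close>

lemma qprod_eq_0_iff: "qprod q w = 0 \<longleftrightarrow> (\<exists>n. q ^ n * w = 1)"
proof -
  have split: "qprod q w = (\<Prod>k<n. 1 - q ^ k * w) * qprod q (q ^ n * w)" for n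
  proof (induction n)
    case (Suc n)
    show ?case unfolding Suc.IH by (subst qprod_shift) (simp add: mult_ac)
  qed simp
  have "(\<lambda>n. q ^ n * w) \<longlonglongrightarrow> 0 * w"
    by (intro tendsto_mult tendsto_const LIMSEQ_power_zero q)
  hence "\<forall>\<^sub>F n in sequentially. norm (q ^ n * w) < 1"
    unfolding tendsto_iff by (auto simp: dist_norm)
  then obtain n where n: "norm (q ^ n * w) < 1"
    by (auto simp: eventually_sequentially)
  have "qprod q w = 0 \<Longrightarrow> \<exists>n. q ^ n * w = 1"
    using split[of n] qprod_nonzero_disc[OF n] by auto
  moreover have "qprod q w = 0" if "q ^ m * w = 1" for m
    unfolding split[of "Suc m"] using that by simp
  ultimately show ?thesis by blast
qed

lemma holomorphic_qprod: "qprod q holomorphic_on UNIV"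
proof (rule holomorphic_uniform_sequence)
  show "(\<lambda>w. \<Prod>k<n. 1 - q ^ k * w) holomorphic_on UNIV" for n
    by (intro holomorphic_intros)
  fix x :: complex
  have "uniformly_convergent_on (cball x 1) (\<lambda>n w. \<Prod>k<n. 1 - q ^ k * w)"
  proof (rule uniformly_convergent_on_prod')
    show "uniformly_convergent_on (cball x 1) (\<lambda>N w. \<Sum>n<N. norm ((1 - q ^ n * w) - 1))"
    proof (rule Weierstrass_m_test')
      fix n w assume "w \<in> cball x 1"
      hence "norm w \<le> norm x + 1"
        using norm_triangle_ineq2[of w x] by (simp add: dist_norm norm_minus_commute)
      thus "norm (norm (1 - q ^ n * w - 1)) \<le> norm (q ^ n * of_real (norm x + 1))"
        unfolding norm_mult norm_power by (simp add: mult_left_mono norm_mult norm_power)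
    qed (rule summable_norm_qpow)
  qed (auto intro!: continuous_intros)
  then obtain l where l: "uniform_limit (cball x 1) (\<lambda>n w. \<Prod>k<n. 1 - q ^ k * w) l sequentially"
    unfolding uniformly_convergent_on_def by blast
  have "l w = qprod q w" if "w \<in> cball x 1" for w
    using tendsto_uniform_limitI[OF l that] qprod_LIMSEQ LIMSEQ_unique by blast
  hence "uniform_limit (cball x 1) (\<lambda>n w. \<Prod>k<n. 1 - q ^ k * w) (qprod q) sequentially"
    using l by (subst (asm) uniform_limit_cong'[where g = "\<lambda>n w. \<Prod>k<n. 1 - q ^ k * w" and i = "qprod q"]) auto
  thus "\<exists>d>0. cball x d \<subseteq> UNIV \<and>
      uniform_limit (cball x d) (\<lambda>n w. \<Prod>k<n. 1 - q ^ k * w) (qprod q) sequentially"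
    by (intro exI[of _ 1]) auto
qed auto

end

locale upper_half_plane =
  fixes \<tau> :: complex
  assumes Im_tau: "Im \<tau> > 0"
begin

lemma norm_nome: "norm (ee \<tau>) < 1"
  using Im_tau by (simp add: norm_ee)

text \<open>Jacobi's theta function in product form: \<open>(x; q) (q/x; q)\<close> with
  \<open>x = ee z\<close> and \<open>q = ee \<tau>\<close>, without the constant
  \<open>(q; q)\<close> of the triple product.\<close>

definition sig :: "complex \<Rightarrow> complex" where
  "sig z = qprod (ee \<tau>) (ee z) * qprod (ee \<tau>) (ee (\<tau> - z))"

lemma lattice_0 [simp]: "0 \<in> lattice \<tau>"
proof -
  have "0 = of_int 0 + of_int 0 * \<tau>" by simp
  thus ?thesis unfolding lattice_def by blast
qed

lemma lattice_uminus: "x \<in> lattice \<tau> \<Longrightarrow> - x \<in> lattice \<tau>"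
proof -
  assume "x \<in> lattice \<tau>"
  then obtain m n :: int where "x = of_int m + of_int n * \<tau>" unfolding lattice_def by auto
  hence "- x = of_int (- m) + of_int (- n) * \<tau>" by simp
  thus ?thesis unfolding lattice_def by blast
qed

lemma lattice_add: "x \<in> lattice \<tau> \<Longrightarrow> y \<in> lattice \<tau> \<Longrightarrow> x + y \<in> lattice \<tau>"
proof -
  assume "x \<in> lattice \<tau>" "y \<in> lattice \<tau>"
  then obtain m n k l :: int where "x = of_int m + of_int n * \<tau>" "y = of_int k + of_int l * \<tau>"
    unfolding lattice_def by auto
  hence "x + y = of_int (m + k) + of_int (n + l) * \<tau>" by (simp add: algebra_simps)
  thus ?thesis unfolding lattice_def by blast
qed

lemma lattice_minus_commute: "x - y \<in> lattice \<tau> \<longleftrightarrow> y - x \<in> lattice \<tau>"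
  using lattice_uminus[of "x - y"] lattice_uminus[of "y - x"] by auto

lemma countable_lattice: "countable (lattice \<tau>)"
proof -
  have "lattice \<tau> = (\<lambda>(m, n). of_int m + of_int n * \<tau>) ` (UNIV :: (int \<times> int) set)"
    unfolding lattice_def by auto
  thus ?thesis by simp
qed

lemma real_in_lattice:
  assumes "of_real x \<in> lattice \<tau>" shows "\<exists>m::int. x = of_int m"
proof -
  from assms obtain m n :: int where mn: "of_real x = of_int m + of_int n * \<tau>"
    unfolding lattice_def by auto
  from arg_cong[OF this, of Im] Im_tau have "n = 0" by simp
  hence "complex_of_real x = complex_of_real (of_int m)" using mn by simp
  hence "x = of_int m" unfolding of_real_eq_iff .
  thus ?thesis ..
qed

lemma holomorphic_sig: "sig holomorphic_on UNIV"
  unfolding sig_def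
  by (intro holomorphic_intros holomorphic_compose_UNIV[OF holomorphic_qprod] norm_nome)

lemma sig_plus_1: "sig (z + 1) = sig z"
proof -
  have "\<tau> - (z + 1) = (\<tau> - z) - 1" by simp
  hence "ee (\<tau> - (z + 1)) = ee (\<tau> - z)" by (simp only: ee_diff ee_1) simp
  thus ?thesis by (simp add: sig_def ee_add)
qed

text \<open>With \<open>x = ee z\<close>, the shift removes the factor \<open>1 - x\<close> from the
  first product and adds the factor \<open>1 - 1/x\<close> to the second; their quotient is
  \<open>- 1/x\<close>.\<close>

lemma sig_plus_tau: "sig (z + \<tau>) = - ee (- z) * sig z"
proof -
  let ?A = "qprod (ee \<tau>)"
  have 1: "?A (ee z) = (1 - ee z) * ?A (ee (z + \<tau>))"
    using qprod_shift[OF norm_nome, of "ee z"] by (simp add: ee_add mult.commute)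
  have 2: "?A (ee (- z)) = (1 - ee (- z)) * ?A (ee (\<tau> - z))"
    using qprod_shift[OF norm_nome, of "ee (- z)"] by (simp add: ee_diff ee_minus divide_inverse)
  have "sig (z + \<tau>) = ?A (ee (z + \<tau>)) * ?A (ee (- z))"
    by (simp add: sig_def)
  also have "\<dots> = - ee (- z) * ((1 - ee z) * ?A (ee (z + \<tau>))) * ?A (ee (\<tau> - z))"
    unfolding 2 by (simp add: ee_minus field_simps)
  also have "\<dots> = - ee (- z) * sig z"
    by (simp add: 1[symmetric] sig_def)
  finally show ?thesis .
qed

text \<open>The first product contributes the lattice points whose coefficient of
  \<open>\<tau>\<close> is \<le> 0, the second those whose coefficient is \<ge> 1.\<close>

lemma sig_eq_0_iff: "sig z = 0 \<longleftrightarrow> z \<in> lattice \<tau>"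
proof -
  have *: "(ee \<tau>) ^ n * ee w = 1 \<longleftrightarrow> (\<exists>m::int. w = of_int m - of_nat n * \<tau>)" for n w
  proof -
    have "(ee \<tau>) ^ n * ee w = 1 \<longleftrightarrow> ee (of_nat n * \<tau> + w) = 1"
      by (simp add: ee_add ee_power)
    also have "\<dots> \<longleftrightarrow> (\<exists>m::int. w = of_int m - of_nat n * \<tau>)"
      unfolding ee_eq_1_iff eq_diff_eq by (simp add: add.commute)
    finally show ?thesis .
  qed
  have "sig z = 0 \<longleftrightarrow> (\<exists>n. \<exists>m::int. z = of_int m - of_nat n * \<tau>) \<or>
                      (\<exists>n. \<exists>m::int. \<tau> - z = of_int m - of_nat n * \<tau>)"
    unfolding sig_def mult_eq_0_iff qprod_eq_0_iff[OF norm_nome] * ..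
  also have "\<dots> \<longleftrightarrow> z \<in> lattice \<tau>"
  proof (intro iffI; (elim disjE exE)?)
    fix n and m :: int assume "z = of_int m - of_nat n * \<tau>"
    hence "z = of_int m + of_int (- int n) * \<tau>" by simp
    thus "z \<in> lattice \<tau>" unfolding lattice_def by blast
  next
    fix n and m :: int assume "\<tau> - z = of_int m - of_nat n * \<tau>"
    hence "z = of_int (- m) + of_int (int n + 1) * \<tau>" by (simp add: algebra_simps)
    thus "z \<in> lattice \<tau>" unfolding lattice_def by blast
  next
    assume "z \<in> lattice \<tau>"
    then obtain m n :: int where z: "z = of_int m + of_int n * \<tau>" unfolding lattice_def by auto
    show "(\<exists>n. \<exists>m::int. z = of_int m - of_nat n * \<tau>) \<or>
          (\<exists>n. \<exists>m::int. \<tau> - z = of_int m - of_nat n * \<tau>)"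
    proof (cases "n \<le> 0")
      case True
      hence "z = of_int m - of_nat (nat (- n)) * \<tau>" by (simp add: z)
      thus ?thesis by blast
    next
      case False
      hence "\<tau> - z = of_int (- m) - of_nat (nat (n - 1)) * \<tau>" by (simp add: z algebra_simps)
      thus ?thesis by blast
    qed
  qed
  finally show ?thesis .
qed

section \<open>Theta functions with prescribed automorphy factor\<close>

text \<open>For \<open>c \<noteq> 0\<close> these are the global sections of a line bundle of degree
  \<open>m\<close> on the torus; \<open>c\<close> selects the bundle among those of that degree. The
  degree is an integer so that division can lower it without side conditions.\<close>

definition tf :: "int \<Rightarrow> complex \<Rightarrow> (complex \<Rightarrow> complex) set" where
  "tf m c = {f. f holomorphic_on UNIV \<and> (\<forall>z. f (z + 1) = f z) \<and>
     (\<forall>z. f (z + \<tau>) = c * ee (- (of_int m * z)) * f z)}"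

lemma tfI:
  assumes "f holomorphic_on UNIV" "\<And>z. f (z + 1) = f z"
    "\<And>z. f (z + \<tau>) = c * ee (- (of_int m * z)) * f z"
  shows "f \<in> tf m c"
  using assms by (simp add: tf_def)

lemma tf_holomorphic: "f \<in> tf m c \<Longrightarrow> f holomorphic_on UNIV"
  by (simp add: tf_def)

lemma tf_plus_1: "f \<in> tf m c \<Longrightarrow> f (z + 1) = f z"
  by (simp add: tf_def)

lemma tf_plus_tau: "f \<in> tf m c \<Longrightarrow> f (z + \<tau>) = c * ee (- (of_int m * z)) * f z"
  by (simp add: tf_def)

lemma tf_0: "(\<lambda>z. 0) \<in> tf m c"
  by (simp add: tf_def)

lemma tf_add: "f \<in> tf m c \<Longrightarrow> g \<in> tf m c \<Longrightarrow> (\<lambda>z. f z + g z) \<in> tf m c"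
  by (auto simp: tf_def intro!: holomorphic_intros simp: algebra_simps)

lemma tf_scale: "f \<in> tf m c \<Longrightarrow> (\<lambda>z. t * f z) \<in> tf m c"
  by (auto simp: tf_def intro!: holomorphic_intros)

lemma tf_diff: "f \<in> tf m c \<Longrightarrow> g \<in> tf m c \<Longrightarrow> (\<lambda>z. f z - g z) \<in> tf m c"
  by (auto simp: tf_def intro!: holomorphic_intros simp: algebra_simps)

lemma tf_mult:
  "f \<in> tf m c \<Longrightarrow> g \<in> tf n d \<Longrightarrow> (\<lambda>z. f z * g z) \<in> tf (m + n) (c * d)"
  by (auto simp: tf_def intro!: holomorphic_intros)
     (simp add: ee_add [symmetric] algebra_simps flip: ee_add)

lemma tf_plus_int: "f \<in> tf m c \<Longrightarrow> f (z + of_int n) = f z"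
proof (induction n arbitrary: z rule: int_induct[where k = 0])
  case (step1 i)
  thus ?case using tf_plus_1[of f m c "z + of_int i"] by (simp add: algebra_simps)
next
  case (step2 i)
  thus ?case using tf_plus_1[of f m c "z + of_int (i - 1)"] by (simp add: algebra_simps)
qed simp

text \<open>The exact factor does not matter; only that it has no zeros.\<close>

lemma tf_plus_lattice:
  assumes f: "f \<in> tf m c" and c: "c \<noteq> 0" and l: "l \<in> lattice \<tau>"
  shows "\<exists>a b. a \<noteq> 0 \<and> (\<forall>z. f (z + l) = a * ee (b * z) * f z)"
proof -
  have "\<exists>a b. a \<noteq> 0 \<and> (\<forall>z. f (z + of_int n * \<tau>) = a * ee (b * z) * f z)" for n :: int
  proof (induction n rule: int_induct[where k = 0])
    case base
    show ?case by (intro exI[of _ 1] exI[of _ 0]) simp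
  next
    case (step1 n)
    then obtain a b where ab: "a \<noteq> 0" "\<And>z. f (z + of_int n * \<tau>) = a * ee (b * z) * f z" by blast
    have "f (z + of_int (n + 1) * \<tau>) =
        (c * a * ee (- (of_int m * (of_int n * \<tau>)))) * ee ((b - of_int m) * z) * f z" for z
    proof -
      have "f (z + of_int (n + 1) * \<tau>) = f ((z + of_int n * \<tau>) + \<tau>)" by (simp add: algebra_simps)
      also have "\<dots> = c * ee (- (of_int m * (z + of_int n * \<tau>))) * (a * ee (b * z) * f z)"
        using ab(2) by (simp only: tf_plus_tau[OF f])
      also have "ee (- (of_int m * (z + of_int n * \<tau>))) * ee (b * z) =
          ee (- (of_int m * (of_int n * \<tau>))) * ee ((b - of_int m) * z)"
        unfolding ee_add [symmetric] by (rule arg_cong[of _ _ ee]) (simp add: algebra_simps)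
      hence "c * ee (- (of_int m * (z + of_int n * \<tau>))) * (a * ee (b * z) * f z) =
          (c * a * ee (- (of_int m * (of_int n * \<tau>)))) * ee ((b - of_int m) * z) * f z"
        by (simp add: mult_ac)
      finally show ?thesis .
    qed
    moreover have "c * a * ee (- (of_int m * (of_int n * \<tau>))) \<noteq> 0" using ab c by simp
    ultimately show ?case by blast
  next
    case (step2 n)
    then obtain a b where ab: "a \<noteq> 0" "\<And>z. f (z + of_int n * \<tau>) = a * ee (b * z) * f z" by blast
    have "f (z + of_int (n - 1) * \<tau>) =
        (a / c * ee (of_int m * (of_int (n - 1) * \<tau>))) * ee ((b + of_int m) * z) * f z" for z
    proof -
      let ?w = "z + of_int (n - 1) * \<tau>"
      have "c * ee (- (of_int m * ?w)) * f ?w = f (?w + \<tau>)"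
        using tf_plus_tau[OF f] by simp
      also have "?w + \<tau> = z + of_int n * \<tau>" by (simp add: algebra_simps)
      also have "f \<dots> = a * ee (b * z) * f z" by (rule ab)
      finally have *: "c * inverse (ee (of_int m * ?w)) * f ?w = a * ee (b * z) * f z"
        unfolding ee_minus .
      have "F = a / c * (E * B) * X" if "c * inverse E * F = a * B * X" "E \<noteq> 0" for E F B X :: complex
        using that c by (simp add: field_simps)
      from this[OF *] have "f ?w = a / c * (ee (of_int m * ?w) * ee (b * z)) * f z" by simp
      also have "ee (of_int m * ?w) * ee (b * z) =
          ee (of_int m * (of_int (n - 1) * \<tau>)) * ee ((b + of_int m) * z)"
        unfolding ee_add [symmetric] by (rule arg_cong[of _ _ ee]) (simp add: algebra_simps)
      finally show ?thesis by (simp add: mult_ac)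
    qed
    moreover have "a / c * ee (of_int m * (of_int (n - 1) * \<tau>)) \<noteq> 0" using ab c by simp
    ultimately show ?case by blast
  qed
  moreover obtain k n :: int where "l = of_int k + of_int n * \<tau>"
    using l unfolding lattice_def by auto
  hence "f (z + l) = f (z + of_int n * \<tau>)" for z
    using tf_plus_int[OF f, of "z + of_int n * \<tau>" k] by (simp add: add_ac)
  ultimately show ?thesis by simp
qed

lemma tf_eq_0_lattice:
  assumes "f \<in> tf m c" "c \<noteq> 0" "a - b \<in> lattice \<tau>"
  shows "f a = 0 \<longleftrightarrow> f b = 0"
  using tf_plus_lattice[OF assms] by (metis add.commute diff_add_cancel ee_nonzero mult_eq_0_iff)

text \<open>The multiplier records the position of the zero. For products of such translates it
  therefore fixes the sum of the zeros modulo the integers.\<close>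

lemma sig_tf: "(\<lambda>z. sig (z - a)) \<in> tf 1 (- ee a)"
proof (rule tfI)
  show "(\<lambda>z. sig (z - a)) holomorphic_on UNIV"
    by (intro holomorphic_compose_UNIV[OF holomorphic_sig] holomorphic_intros)
  show "sig (z + 1 - a) = sig (z - a)" for z
    using sig_plus_1[of "z - a"] by (simp add: algebra_simps)
  show "sig (z + \<tau> - a) = - ee a * ee (- (of_int 1 * z)) * sig (z - a)" for z
    using sig_plus_tau[of "z - a"] by (simp add: algebra_simps flip: ee_add)
qed

text \<open>At \<open>0\<close> the zero comes from the single factor \<open>1 - ee z\<close>, and
  the remaining product \<open>H\<close> does not vanish there. Quasi-periodicity carries this to
  the other lattice points: the transformation factor has no zeros, and its own derivative is
  multiplied by \<open>sig 0 = 0\<close>.\<close>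

lemma deriv_sig_nonzero:
  assumes "a \<in> lattice \<tau>" shows "deriv sig a \<noteq> 0"
proof -
  define H where "H = (\<lambda>z. qprod (ee \<tau>) (ee (z + \<tau>)) * qprod (ee \<tau>) (ee (\<tau> - z)))"
  have hH: "H holomorphic_on UNIV"
    unfolding H_def
    by (intro holomorphic_intros holomorphic_compose_UNIV[OF holomorphic_qprod] norm_nome)
  then obtain H' where H': "(H has_field_derivative H') (at 0)"
    by (auto simp: holomorphic_on_open)
  have eq: "sig = (\<lambda>z. (1 - ee z) * H z)"
  proof
    show "sig z = (1 - ee z) * H z" for z
      using qprod_shift[OF norm_nome, of "ee z"]
      by (simp add: sig_def H_def ee_add mult.commute)
  qed
  have "((\<lambda>z. (1 - ee z) * H z) has_field_derivative (- (2 * of_real pi * \<i>)) * H 0) (at 0)"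
    by (rule derivative_eq_intros H' DERIV_ee refl)+ simp
  hence "(sig has_field_derivative (- (2 * of_real pi * \<i>)) * H 0) (at 0)"
    by (simp add: eq)
  moreover have H0: "H 0 \<noteq> 0"
    by (simp add: H_def qprod_nonzero_disc norm_nome)
  ultimately have d0: "\<exists>D. D \<noteq> 0 \<and> (sig has_field_derivative D) (at 0)"
    by (intro exI[of _ "(- (2 * of_real pi * \<i>)) * H 0"]) auto
  then obtain D where D: "D \<noteq> 0" "(sig has_field_derivative D) (at 0)" by blast
  have sig: "sig \<in> tf 1 (- 1)" using sig_tf[of 0] by simp
  obtain c b where cb: "c \<noteq> 0" "\<And>z. sig (z + a) = c * ee (b * z) * sig z"
    using tf_plus_lattice[OF sig _ assms] by auto
  have "sig 0 = 0" by (simp add: sig_eq_0_iff)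
  have eqa: "sig = (\<lambda>z. c * ee (b * (z - a)) * sig (z - a))"
    using cb(2) by (metis diff_add_cancel)
  have D': "((\<lambda>z. sig (z - a)) has_field_derivative D) (at a)"
    using D(2) DERIV_shift[of sig D 0 "-a"] by (simp add: DERIV_shift[of sig D a "- a", simplified])
  obtain E where E: "((\<lambda>z. c * ee (b * (z - a))) has_field_derivative E) (at a)"
  proof -
    have "(\<lambda>z. c * ee (b * (z - a))) holomorphic_on UNIV" by (intro holomorphic_intros)
    thus ?thesis using that by (auto simp: holomorphic_on_open)
  qed
  have "((\<lambda>z. c * ee (b * (z - a)) * sig (z - a)) has_field_derivative c * D) (at a)"
    using DERIV_mult[OF E D'] \<open>sig 0 = 0\<close> by (simp add: mult_ac)
  hence "(sig has_field_derivative c * D) (at a)"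
    using eqa by simp
  thus ?thesis using D cb DERIV_imp_deriv by force
qed

section \<open>Division by a theta function\<close>

lemma tf_cancel:
  assumes f: "(\<lambda>z. g z * h z) \<in> tf m c" and g: "g \<in> tf n d" and h: "h holomorphic_on UNIV"
    and nz: "d \<noteq> 0" "g z0 \<noteq> 0"
  shows "h \<in> tf (m - n) (c / d)"
proof (rule tfI)
  note gh = tf_holomorphic[OF g]
  have g1: "g (z + 1) = g z" for z using g by (rule tf_plus_1)
  show "h (z + 1) = h z" for z
  proof -
    \<comment> \<open>The functional equation for \<open>h\<close> is known only after
      multiplication by \<open>g\<close>, whose zeros could interfere. The defect is entire, so
      \<open>g\<close> can be cancelled by \<open>entire_mult_zeroD\<close>; the same is done for
      \<open>\<tau>\<close> below.\<close>
    have "(\<lambda>z. h (z + 1) - h z) holomorphic_on UNIV"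
      by (intro holomorphic_intros holomorphic_compose_UNIV[OF h] h)
    moreover have "(h (z + 1) - h z) * g z = 0" for z
    proof -
      have "g z * h (z + 1) = g z * h z" using tf_plus_1[OF f, of z] unfolding g1 .
      thus ?thesis by (simp add: left_diff_distrib mult.commute)
    qed
    ultimately have "h (z + 1) - h z = 0"
      using entire_mult_zeroD[of "\<lambda>z. h (z + 1) - h z" g z0] gh nz by blast
    thus ?thesis by simp
  qed
  show "h (z + \<tau>) = c / d * ee (- (of_int (m - n) * z)) * h z" for z
  proof -
    have "(\<lambda>z. h (z + \<tau>) - c / d * ee (- (of_int (m - n) * z)) * h z) holomorphic_on UNIV"
      by (intro holomorphic_intros holomorphic_compose_UNIV[OF h] h)
    moreover have "(h (z + \<tau>) - c / d * ee (- (of_int (m - n) * z)) * h z) * g z = 0" for z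
    proof -
      have 1: "d * ee (- (of_int n * z)) * g z * h (z + \<tau>) = c * ee (- (of_int m * z)) * (g z * h z)"
        using tf_plus_tau[OF f, of z] by (simp add: tf_plus_tau[OF g])
      have "- (of_int (m - n) * z) = - (of_int m * z) - (- (of_int n * z))"
        by (simp add: algebra_simps)
      hence 2: "ee (- (of_int (m - n) * z)) = ee (- (of_int m * z)) / ee (- (of_int n * z))"
        by (simp only: ee_diff)
      from 1 show ?thesis unfolding 2 using nz by (simp add: field_simps)
    qed
    ultimately have "h (z + \<tau>) - c / d * ee (- (of_int (m - n) * z)) * h z = 0"
      using entire_mult_zeroD[of "\<lambda>z. h (z + \<tau>) - c / d * ee (- (of_int (m - n) * z)) * h z" g z0] gh nz by blast
    thus ?thesis by simp
  qed
qed (rule h)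

lemma tf_mult':
  "f \<in> tf m c \<Longrightarrow> g \<in> tf n d \<Longrightarrow> k = m + n \<Longrightarrow> e = c * d \<Longrightarrow> (\<lambda>z. f z * g z) \<in> tf k e"
  using tf_mult by blast

text \<open>With \<open>a\<close> the whole coset \<open>a + lattice \<tau>\<close> consists of
  zeros of \<open>f\<close>, and on this coset \<open>sig (z - a)\<close> has only simple zeros and
  no others elsewhere. This lemma is the engine of all inductions on the degree.\<close>

lemma tf_divide_sig:
  assumes f: "f \<in> tf m c" and c: "c \<noteq> 0" and a: "f a = 0"
  obtains h where "h \<in> tf (m - 1) (c / (- ee a))" "\<And>z. f z = sig (z - a) * h z"
proof -
  have sh: "(\<lambda>z. sig (z - a)) holomorphic_on UNIV" by (rule tf_holomorphic[OF sig_tf])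
  obtain h where h: "h holomorphic_on UNIV" "\<And>z. f z = sig (z - a) * h z"
  proof (rule entire_divide[OF tf_holomorphic[OF f] sh])
    fix z assume "sig (z - a) = 0"
    hence z: "z - a \<in> lattice \<tau>" by (simp add: sig_eq_0_iff)
    hence "f z = 0" using tf_eq_0_lattice[OF f c z] a by simp
    moreover have "deriv (\<lambda>z. sig (z - a)) z = deriv sig (z - a)"
    proof -
      obtain D where D: "(sig has_field_derivative D) (at (z - a))"
        using holomorphic_sig by (auto simp: holomorphic_on_open)
      have "((\<lambda>z. sig (z - a)) has_field_derivative D) (at z)"
        using DERIV_shift[of sig D z "- a"] D by simp
      thus ?thesis using D by (simp add: DERIV_imp_deriv)
    qed
    ultimately show "f z = 0 \<and> deriv (\<lambda>z. sig (z - a)) z \<noteq> 0"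
      using deriv_sig_nonzero[OF z] by simp
  qed auto
  obtain z0 where z0: "z0 \<notin> lattice \<tau>"
    using countable_lattice uncountable_UNIV_complex
    by (metis UNIV_I countable_subset subsetI)
  have "h \<in> tf (m - 1) (c / (- ee a))"
  proof (rule tf_cancel[of "\<lambda>z. sig (z - a)" h m c 1 "- ee a" "z0 + a", OF _ sig_tf h(1)])
    have "f = (\<lambda>z. sig (z - a) * h z)" using h(2) by blast
    thus "(\<lambda>z. sig (z - a) * h z) \<in> tf m c" using f by simp
  qed (use z0 in \<open>auto simp: sig_eq_0_iff\<close>)
  thus ?thesis using that h by blast
qed

section \<open>Sections of degree zero and one\<close>

lemma tf_degree_0:
  assumes f: "f \<in> tf 0 c" and c: "c \<noteq> 0"
  obtains K and k :: int where "\<And>z. f z = K * ee (of_int k * z)" "K \<noteq> 0 \<Longrightarrow> c = ee (of_int k * \<tau>)"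
proof (cases "\<forall>z. f z = 0")
  case True
  thus ?thesis using that[of 0 0] by simp
next
  case False
  then obtain z0 where z0: "f z0 \<noteq> 0" by blast
  have hol: "f holomorphic_on UNIV" using f by (rule tf_holomorphic)
  have ft: "f (z + \<tau>) = c * f z" for z using tf_plus_tau[OF f] by simp
  \<comment> \<open>Chosen such that
    \<open>norm c * exp (- 2 * pi * \<beta> * Im \<tau>) = 1\<close>. As \<open>\<beta>\<close> is
    real, the factor \<open>ee (\<beta> * z)\<close> keeps the modulus periodic under
    \<open>1\<close> and makes it periodic under \<open>\<tau>\<close> as well.\<close>
  define \<beta> where "\<beta> = ln (norm c) / (2 * pi * Im \<tau>)"
  define g where "g = (\<lambda>z. f z * ee (of_real \<beta> * z))"
  have g1: "norm (g (z + of_int n)) = norm (g z)" for z n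
    using tf_plus_int[OF f, of z n] by (simp add: g_def norm_mult norm_ee)
  have gt1: "norm (g (z + \<tau>)) = norm (g z)" for z
  proof -
    have "exp (- (2 * pi * (\<beta> * Im \<tau>))) = inverse (norm c)"
      using Im_tau c by (simp add: \<beta>_def exp_minus)
    moreover have "norm (g (z + \<tau>)) =
        norm (f z) * norm c * (exp (- (2 * pi * (\<beta> * Im z))) * exp (- (2 * pi * (\<beta> * Im \<tau>))))"
    proof -
      have "norm (g (z + \<tau>)) = norm c * norm (f z) * exp (- 2 * pi * (\<beta> * (Im z + Im \<tau>)))"
        by (simp add: g_def ft norm_mult norm_ee)
      also have "- 2 * pi * (\<beta> * (Im z + Im \<tau>)) = - (2 * pi * (\<beta> * Im z)) + - (2 * pi * (\<beta> * Im \<tau>))"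
        by (simp add: algebra_simps)
      finally show ?thesis by (simp only: exp_add mult_ac)
    qed
    ultimately have "norm (g (z + \<tau>)) =
        norm (f z) * norm c * (exp (- (2 * pi * (\<beta> * Im z))) * inverse (norm c))"
      by presburger
    also have "\<dots> = norm (g z)" using c by (simp add: g_def norm_mult norm_ee)
    finally show ?thesis .
  qed
  have gt: "norm (g (z + of_int n * \<tau>)) = norm (g z)" for z n
  proof (induction n rule: int_induct[where k = 0])
    case (step1 i) thus ?case using gt1[of "z + of_int i * \<tau>"] by (simp add: algebra_simps)
  next
    case (step2 i) thus ?case using gt1[of "z + of_int (i - 1) * \<tau>"] by (simp add: algebra_simps)
  qed simp
  have hg: "g holomorphic_on UNIV" unfolding g_def by (intro holomorphic_intros hol)
  \<comment> \<open>A closed fundamental parallelogram: a bound for the doubly periodic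
    \<open>norm (g z)\<close> on it is a global bound, and Liouville's theorem applies.\<close>
  define P where "P = (\<lambda>(x, y). of_real x + of_real y * \<tau>) ` ({0..1::real} \<times> {0..1::real})"
  have "compact P" unfolding P_def
    by (rule compact_continuous_image)
       (auto simp: case_prod_unfold intro!: continuous_intros compact_Times)
  hence "bounded (g ` P)"
    using holomorphic_on_imp_continuous_on[OF hg]
    by (intro compact_imp_bounded compact_continuous_image) (auto intro: continuous_on_subset)
  then obtain B where B: "\<And>z. z \<in> P \<Longrightarrow> norm (g z) \<le> B" unfolding bounded_iff by auto
  have "norm (g z) \<le> B" for z
  proof -
    define y where "y = Im z / Im \<tau>"
    define x where "x = Re z - y * Re \<tau>"
    have z: "z = of_real x + of_real y * \<tau>"
      using Im_tau by (intro complex_eqI) (auto simp: x_def y_def)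
    let ?w = "of_real (frac x) + of_real (frac y) * \<tau>"
    have "?w \<in> P" unfolding P_def
      by (rule image_eqI[of _ _ "(frac x, frac y)"]) (auto simp: frac_lt_1 less_imp_le)
    moreover have "z = ?w + of_int \<lfloor>x\<rfloor> + of_int \<lfloor>y\<rfloor> * \<tau>"
      unfolding z by (simp add: frac_def algebra_simps)
    hence "norm (g z) = norm (g ?w)" using g1 gt by simp
    ultimately show ?thesis using B by simp
  qed
  hence "bounded (range g)" by (auto simp: bounded_iff)
  then obtain K where K: "\<And>z. g z = K"
    using Liouville_theorem[OF hg] by (auto simp: constant_on_def)
  have feq: "f z = K * ee (- of_real \<beta> * z)" for z
    using K[of z] by (simp add: g_def ee_minus field_simps)
  have K0: "K \<noteq> 0" using z0 feq by auto
  \<comment> \<open>By now \<open>f\<close> is a pure exponential. The period \<open>1\<close> turns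
    its real frequency into an integer, and comparison at \<open>\<tau>\<close> identifies
    \<open>c\<close>.\<close>
  have "f (0 + 1) = f 0" by (rule tf_plus_1[OF f])
  hence "ee (- of_real \<beta>) = 1" using K0 by (simp add: feq del: of_real_minus)
  then obtain k :: int where k: "- of_real \<beta> = (of_int k :: complex)"
    unfolding ee_eq_1_iff by blast
  have "f (0 + \<tau>) = c * f 0" by (rule ft)
  hence "c = ee (of_int k * \<tau>)" unfolding feq k using K0 by simp
  thus ?thesis using that[of K k] feq unfolding k by blast
qed

lemma tf_degree_0_nonzero:
  assumes "f \<in> tf 0 c" "c \<noteq> 0" "f z0 \<noteq> 0" shows "f z \<noteq> 0"
  using tf_degree_0[OF assms(1,2)] assms(3) by (metis ee_nonzero mult_eq_0_iff)

text \<open>A nonzero section of degree 0 forces the multiplier \<open>ee (k * \<tau>)\<close> with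
  an integer \<open>k\<close>, that is, \<open>a\<close> in the lattice: a nontrivial bundle of
  degree 0 has no sections.\<close>

lemma tf_degree_0_eq_0:
  assumes "f \<in> tf 0 (ee a)" "a \<notin> lattice \<tau>" shows "f z = 0"
proof (rule ccontr)
  assume "f z \<noteq> 0"
  then obtain k :: int where "ee a = ee (of_int k * \<tau>)"
    using tf_degree_0[OF assms(1)] by (metis ee_nonzero mult_zero_left)
  hence "ee (a - of_int k * \<tau>) = 1" by (simp add: ee_diff)
  then obtain l :: int where "a - of_int k * \<tau> = of_int l" unfolding ee_eq_1_iff by blast
  hence "a = of_int l + of_int k * \<tau>" by (simp add: algebra_simps)
  thus False using assms(2) unfolding lattice_def by blast
qed

text \<open>Subtracting a multiple of \<open>sig (z - s)\<close> creates a zero at a point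
  \<open>a\<close> not equivalent to \<open>s\<close>. Division by \<open>sig (z - a)\<close> leaves
  degree 0 with multiplier \<open>ee (s - a)\<close>, so the difference vanishes identically. In
  particular the zero of a section of degree 1 cannot be moved.\<close>

lemma tf_degree_1:
  assumes f: "f \<in> tf 1 (- ee s)"
  obtains t where "\<And>z. f z = t * sig (z - s)"
proof -
  obtain u where u: "u \<notin> lattice \<tau>"
    using countable_lattice uncountable_UNIV_complex by (metis UNIV_I countable_subset subsetI)
  define a where "a = s + u"
  have sa: "sig (a - s) \<noteq> 0" using u by (simp add: a_def sig_eq_0_iff)
  define t where "t = f a / sig (a - s)"
  define g where "g = (\<lambda>z. f z - t * sig (z - s))"
  have g: "g \<in> tf 1 (- ee s)" unfolding g_def by (intro tf_diff tf_scale sig_tf f)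
  moreover have "g a = 0" using sa by (simp add: g_def t_def)
  ultimately obtain h where h: "h \<in> tf (1 - 1) ((- ee s) / (- ee a))" "\<And>z. g z = sig (z - a) * h z"
    using tf_divide_sig[of g 1 "- ee s" a] by auto
  have "(- ee s) / (- ee a) = ee (s - a)" by (simp add: ee_diff)
  hence h': "h \<in> tf 0 (ee (s - a))" using h(1) by simp
  have "s - a \<notin> lattice \<tau>" using u lattice_uminus[of "- u"] by (auto simp: a_def)
  hence "g z = 0" for z using h(2) tf_degree_0_eq_0[OF h'] by simp
  hence "f z = t * sig (z - s)" for z by (simp add: g_def)
  thus ?thesis using that by blast
qed

section \<open>Sections that do not vanish at given points\<close>

lemma ex_notin_lattice_translates:
  assumes "finite A"
  obtains p where "\<And>a. a \<in> A \<Longrightarrow> p - a \<notin> lattice \<tau>"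
proof -
  have "countable (\<Union>a\<in>A. (\<lambda>l. a + l) ` lattice \<tau>)"
    using assms countable_lattice by (intro countable_UN) (auto intro: countable_finite)
  then obtain p where "p \<notin> (\<Union>a\<in>A. (\<lambda>l. a + l) ` lattice \<tau>)"
    using uncountable_UNIV_complex by (metis UNIV_I countable_subset subsetI)
  hence "p - a \<notin> lattice \<tau>" if "a \<in> A" for a
    using that by (auto simp: image_iff) (metis add.commute diff_add_cancel)
  thus ?thesis using that by blast
qed

lemma minus_ee: "- ee a = ee (a + 1/2)"
  by (simp add: ee_add ee_half)

text \<open>In degree 2 one zero \<open>p\<close> is free and the other one, \<open>s - p\<close>,
  is determined by the multiplier \<open>ee s\<close>, so both can be kept away from
  \<open>a\<close>. Each further degree adds a factor with a free zero. In degree 1 the only zero is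
  forced, hence the bound.\<close>

lemma tf_ex_nonvanishing:
  assumes "n \<ge> 2" "c \<noteq> 0"
  shows "\<exists>u\<in>tf (int n) c. u a \<noteq> 0"
  using assms
proof (induction n arbitrary: c rule: nat_induct_at_least)
  case base
  obtain s where s: "ee s = c" using ee_surj[OF \<open>c \<noteq> 0\<close>] by blast
  \<comment> \<open>Excluding \<open>a\<close> keeps the zero \<open>p\<close> away from
    \<open>a\<close>; excluding \<open>s - a\<close> does the same for the zero
    \<open>s - p\<close>.\<close>
  obtain p where "\<And>x. x \<in> {a, s - a} \<Longrightarrow> p - x \<notin> lattice \<tau>"
    using ex_notin_lattice_translates[of "{a, s - a}"] by blast
  hence p: "p - a \<notin> lattice \<tau>" "p - (s - a) \<notin> lattice \<tau>" by blast+
  define u where "u = (\<lambda>z. sig (z - p) * sig (z - (s - p)))"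
  have "u \<in> tf (int 2) c" unfolding u_def
    by (rule tf_mult'[OF sig_tf sig_tf]) (use s in \<open>auto simp: ee_diff\<close>)
  moreover have "u a \<noteq> 0"
  proof -
    have e: "a - (s - p) = p - (s - a)" by simp
    have "a - (s - p) \<notin> lattice \<tau>" unfolding e by (rule p)
    moreover have "a - p \<notin> lattice \<tau>" using p lattice_minus_commute[of a p] by blast
    ultimately show ?thesis by (simp add: u_def sig_eq_0_iff)
  qed
  ultimately show ?case by blast
next
  case (Suc n)
  obtain p where p: "p - a \<notin> lattice \<tau>"
    using ex_notin_lattice_translates[of "{a}"] by auto
  obtain v where v: "v \<in> tf (int n) (c / (- ee p))" "v a \<noteq> 0"
    using Suc.IH[of "c / (- ee p)"] Suc.prems by auto
  have "(\<lambda>z. sig (z - p) * v z) \<in> tf (int (Suc n)) c"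
    by (rule tf_mult'[OF sig_tf v(1)]) auto
  moreover have "sig (a - p) * v a \<noteq> 0"
  proof -
    have "a - p \<notin> lattice \<tau>" using p lattice_minus_commute[of a p] by blast
    thus ?thesis using v by (simp add: sig_eq_0_iff)
  qed
  ultimately show ?case by (intro bexI[of _ "\<lambda>z. sig (z - p) * v z"])
qed

text \<open>Each zero splits off a factor \<open>sig\<close> and lowers the degree, and a nonzero
  section of degree 0 has no zeros. The set \<open>A\<close> collects one representative for each
  factor split off.\<close>

lemma tf_finite_zeros:
  assumes "f \<in> tf (int n) c" "c \<noteq> 0" "f z0 \<noteq> 0"
  shows "\<exists>A. finite A \<and> (\<forall>z. f z = 0 \<longrightarrow> (\<exists>a\<in>A. z - a \<in> lattice \<tau>))"
  using assms
proof (induction n arbitrary: f c)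
  case 0
  thus ?case using tf_degree_0_nonzero by (intro exI[of _ "{}"]) auto
next
  case (Suc n)
  show ?case
  proof (cases "\<exists>a. f a = 0")
    case True
    then obtain a where a: "f a = 0" ..
    obtain h where h: "h \<in> tf (int (Suc n) - 1) (c / (- ee a))" "\<And>z. f z = sig (z - a) * h z"
      using tf_divide_sig[OF Suc.prems(1,2) a] by blast
    have "h \<in> tf (int n) (c / (- ee a))" "h z0 \<noteq> 0" using h Suc.prems by auto
    then obtain A where A: "finite A" "\<And>z. h z = 0 \<Longrightarrow> \<exists>a\<in>A. z - a \<in> lattice \<tau>"
      using Suc.IH[of h "c / (- ee a)"] Suc.prems by auto
    thus ?thesis using h(2) by (intro exI[of _ "insert a A"]) (auto simp: sig_eq_0_iff)
  qed (auto intro: exI[of _ "{}"])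
qed

section \<open>The base-point-free pencil trick\<close>

lemma tf_pencil_unit:
  assumes "u1 \<in> tf (int n) c1" "c1 \<noteq> 0" "\<And>z. u1 z \<noteq> 0" "G \<in> tf (l + int M) (c2 * c')"
  shows "\<exists>g1 \<in> tf (l + int M - int n) (c2 * c' / c1). \<exists>g2 \<in> tf (int M) c'.
           \<forall>z. G z = u1 z * g1 z + u2 z * g2 z"
proof (rule bexI[of _ "\<lambda>z. G z / u1 z"], rule bexI[of _ "\<lambda>z. 0"])
  have "(\<lambda>z. G z / u1 z) holomorphic_on UNIV"
    using assms by (intro holomorphic_intros tf_holomorphic[OF assms(4)] tf_holomorphic[OF assms(1)]) auto
  thus "(\<lambda>z. G z / u1 z) \<in> tf (l + int M - int n) (c2 * c' / c1)"
    using assms by (intro tf_cancel[of u1 "\<lambda>z. G z / u1 z" "l + int M" "c2 * c'" "int n" c1 0]) auto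
qed (use assms in \<open>auto simp: tf_0\<close>)

text \<open>In cohomological terms the cokernel of
  \<open>(g1, g2) \<mapsto> u1 * g1 + u2 * g2\<close> lies in the first cohomology of a bundle of
  degree \<open>M - n\<close>, which vanishes for \<open>M - n \<ge> 1\<close>. The proof removes
  the zeros of \<open>u1\<close> one by one: at a zero \<open>a\<close> the value of
  \<open>G\<close> is corrected by a multiple of \<open>u2 * u\<close>, after which
  \<open>sig (z - a)\<close> divides both sides. Both \<open>n\<close> and \<open>M\<close> drop by
  one, so \<open>M \<ge> n + 1\<close> persists and provides \<open>M \<ge> 2\<close>, needed for a
  section \<open>u\<close> with \<open>u a \<noteq> 0\<close>.\<close>

lemma tf_pencil:
  assumes "u1 \<in> tf (int n) c1" "c1 \<noteq> 0" "u1 z0 \<noteq> 0"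
    and "u2 \<in> tf l c2" "c2 \<noteq> 0" "\<And>z. u1 z = 0 \<Longrightarrow> u2 z \<noteq> 0"
    and "G \<in> tf (l + int M) (c2 * c')" "c' \<noteq> 0" "M \<ge> n + 1"
  shows "\<exists>g1 \<in> tf (l + int M - int n) (c2 * c' / c1). \<exists>g2 \<in> tf (int M) c'.
           \<forall>z. G z = u1 z * g1 z + u2 z * g2 z"
  using assms
proof (induction n arbitrary: u1 c1 M G c')
    case 0
    thus ?case using tf_pencil_unit[of u1 0 c1 G l M c2 c' u2] tf_degree_0_nonzero[of u1 c1 z0] by simp
  next
    case (Suc n)
    show ?case
    proof (cases "\<exists>a. u1 a = 0")
      case False
      thus ?thesis using tf_pencil_unit[of u1 "Suc n" c1 G l M c2 c' u2] Suc.prems by blast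
    next
      case True
      then obtain a where a: "u1 a = 0" ..
      obtain v where v: "v \<in> tf (int (Suc n) - 1) (c1 / (- ee a))" "\<And>z. u1 z = sig (z - a) * v z"
        using tf_divide_sig[OF Suc.prems(1,2) a] by blast
      have "M \<ge> 2" using Suc.prems by simp
      then obtain u where u: "u \<in> tf (int M) c'" "u a \<noteq> 0"
        using tf_ex_nonvanishing[of M c' a] Suc.prems by blast
      have u2a: "u2 a \<noteq> 0" using Suc.prems(6) a by blast
      \<comment> \<open>The multiple of \<open>u2 * u\<close> that agrees with \<open>G\<close> at
        \<open>a\<close>; \<open>u2 a \<noteq> 0\<close> because \<open>u1\<close> and
        \<open>u2\<close> have no common zero.\<close>
      define t where "t = G a / (u2 a * u a)"
      define G1 where "G1 = (\<lambda>z. G z - t * (u2 z * u z))"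
      have "G1 \<in> tf (l + int M) (c2 * c')" unfolding G1_def
        by (intro tf_diff tf_scale tf_mult Suc.prems u)
      moreover have "G1 a = 0" using u2a u by (simp add: G1_def t_def)
      ultimately obtain G' where G': "G' \<in> tf (l + int M - 1) (c2 * c' / (- ee a))"
          "\<And>z. G1 z = sig (z - a) * G' z"
        using tf_divide_sig[of G1 "l + int M" "c2 * c'" a] Suc.prems by auto
      have "\<exists>g1 \<in> tf (l + int (M - 1) - int n) (c2 * (c' / (- ee a)) / (c1 / (- ee a))).
          \<exists>g2 \<in> tf (int (M - 1)) (c' / (- ee a)). \<forall>z. G' z = v z * g1 z + u2 z * g2 z"
      proof (rule Suc.IH)
        show "v \<in> tf (int n) (c1 / - ee a)" using v by simp
        show "v z0 \<noteq> 0" using v Suc.prems by auto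
        show "u2 z \<noteq> 0" if "v z = 0" for z using that v Suc.prems by simp
        have e: "l + int (M - 1) = l + int M - 1" "c2 * (c' / - ee a) = c2 * c' / - ee a"
          using \<open>M \<ge> 2\<close> by (simp_all add: of_nat_diff)
        show "G' \<in> tf (l + int (M - 1)) (c2 * (c' / - ee a))" unfolding e by (rule G'(1))
        show "n + 1 \<le> M - 1" using Suc.prems by simp
      qed (use Suc.prems in auto)
      then obtain g1 g2 where g: "g1 \<in> tf (l + int (M - 1) - int n) (c2 * (c' / (- ee a)) / (c1 / (- ee a)))"
        "g2 \<in> tf (int (M - 1)) (c' / (- ee a))" "\<And>z. G' z = v z * g1 z + u2 z * g2 z"
        by blast
      have e: "l + int (M - 1) - int n = l + int M - int (Suc n)"
          "c2 * (c' / (- ee a)) / (c1 / (- ee a)) = c2 * c' / c1"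
        using \<open>M \<ge> 2\<close> by (simp_all add: of_nat_diff)
      have g1: "g1 \<in> tf (l + int M - int (Suc n)) (c2 * c' / c1)" using g(1) unfolding e .
      define g2' where "g2' = (\<lambda>z. t * u z + sig (z - a) * g2 z)"
      have "(\<lambda>z. sig (z - a) * g2 z) \<in> tf (int M) c'"
        by (rule tf_mult'[OF sig_tf g(2)]) (use \<open>M \<ge> 2\<close> in auto)
      hence "g2' \<in> tf (int M) c'" unfolding g2'_def by (intro tf_add tf_scale u)
      moreover have "G z = u1 z * g1 z + u2 z * g2' z" for z
      proof -
        have "G z = G1 z + t * (u2 z * u z)" by (simp add: G1_def)
        thus ?thesis by (simp add: G' g(3) v(2) g2'_def algebra_simps)
      qed
      ultimately show ?thesis using g1 by blast
    qed
qed

text \<open>A complex vector space is not a finite union of proper subspaces: on a line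
  \<open>u + t * v\<close> only finitely many parameters \<open>t\<close> are bad. The space
  \<open>K\<close> is left abstract because it is also used for the linear system of hyperplanes
  through a point.\<close>

lemma tf_ex_nonvanishing_finite:
  assumes K: "\<And>f g t. f \<in> K \<Longrightarrow> g \<in> K \<Longrightarrow> (\<lambda>z. f z + t * g z) \<in> K" and K0: "(\<lambda>z::complex. 0) \<in> K"
    and A: "finite A" "\<And>a. a \<in> A \<Longrightarrow> \<exists>u\<in>K. u a \<noteq> (0::complex)"
  shows "\<exists>u\<in>K. \<forall>a\<in>A. u a \<noteq> 0"
  using A
proof (induction A rule: finite_induct)
  case empty thus ?case using K0 by auto
next
  case (insert a A)
  then obtain u where u: "u \<in> K" "\<forall>a\<in>A. u a \<noteq> 0" by blast
  obtain v where v: "v \<in> K" "v a \<noteq> 0" using insert by blast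
  define T where "T = (\<lambda>b. - u b / v b) ` insert a A"
  obtain t where t: "t \<notin> T"
    using insert(1) infinite_UNIV_char_0[where 'a = complex] unfolding T_def
    by (metis ex_new_if_finite finite.insertI finite_imageI)
  show ?case
  proof (cases "u a = 0")
    case False
    thus ?thesis using u by blast
  next
    case True
    have "t \<noteq> 0" using t True by (auto simp: T_def)
    have "u b + t * v b \<noteq> 0" if "b \<in> insert a A" for b
    proof
      assume eq: "u b + t * v b = 0"
      show False
      proof (cases "v b = 0")
        case True
        thus False using eq u v that by auto
      next
        case False
        hence "t = - u b / v b" using eq by (simp add: field_simps eq_neg_iff_add_eq_0)
        thus False using t that by (auto simp: T_def)
      qed
    qed
    thus ?thesis by (intro bexI[of _ "\<lambda>z. u z + t * v z"] ballI K u v)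
  qed
qed

end

section \<open>The theta series\<close>

lemma has_integral_ee_int:
  fixes c :: int
  shows "((\<lambda>x. ee (of_int c * of_real x)) has_integral (if c = 0 then 1 else 0)) {0..1::real}"
proof (cases "c = 0")
  case True
  thus ?thesis using has_integral_const_real[of "1::complex" 0 1] by simp
next
  case False
  define k where "k = 2 * of_real pi * \<i> * (of_int c :: complex)"
  have k: "k \<noteq> 0" using False by (simp add: k_def)
  have ee: "ee (of_int c * z) = exp (k * z)" for z by (simp add: ee_def k_def mult_ac)
  have "((\<lambda>x. exp (k * of_real x)) has_integral (exp (k * of_real 1) / k - exp (k * of_real 0) / k)) {0..1::real}"
  proof (rule fundamental_theorem_of_calculus)
    fix x :: real assume "x \<in> {0..1}"
    have "((\<lambda>z. exp (k * z) / k) has_field_derivative exp (k * of_real x)) (at (of_real x))"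
      using k by (auto intro!: derivative_eq_intros)
    thus "((\<lambda>x. exp (k * of_real x) / k) has_vector_derivative exp (k * of_real x)) (at x within {0..1})"
      by (rule has_vector_derivative_real_field)
  qed simp
  moreover have "exp (k * of_real 1) = 1" using ee[of 1] by simp
  ultimately show ?thesis using False by (simp add: ee)
qed

lemma summable_on_exp_neg_abs: "(\<lambda>n::int. exp (- \<bar>real_of_int n\<bar>)) summable_on UNIV"
proof -
  have s: "summable (\<lambda>n. exp (- real n))"
  proof -
    have "summable (\<lambda>n. exp (- 1 :: real) ^ n)" by (rule summable_geometric) simp
    thus ?thesis by (simp add: exp_of_nat_mult [symmetric])
  qed
  have 1: "(\<lambda>n::int. exp (- \<bar>real_of_int n\<bar>)) summable_on range int"
    using s by (subst summable_on_reindex) (auto simp: o_def summable_on_UNIV_nonneg_real_iff)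
  have 2: "(\<lambda>n::int. exp (- \<bar>real_of_int n\<bar>)) summable_on range (\<lambda>n. - int (Suc n))"
  proof (subst summable_on_reindex)
    have "summable (\<lambda>n. exp (- real (Suc n)))" using s by (subst summable_Suc_iff)
    hence "(\<lambda>n. exp (- real (Suc n))) summable_on UNIV"
      by (simp only: summable_on_UNIV_nonneg_real_iff exp_ge_zero)
    moreover have "((\<lambda>n::int. exp (- \<bar>real_of_int n\<bar>)) \<circ> (\<lambda>n. - int (Suc n))) = (\<lambda>n. exp (- real (Suc n)))"
      by (rule ext) (simp add: algebra_simps)
    ultimately show "((\<lambda>n::int. exp (- \<bar>real_of_int n\<bar>)) \<circ> (\<lambda>n. - int (Suc n))) summable_on UNIV"
      by (simp only:)
  qed (auto intro: injI)
  have "range int \<union> range (\<lambda>n. - int (Suc n)) = UNIV"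
  proof -
    have "x \<in> range int \<union> range (\<lambda>n. - int (Suc n))" for x
      by (cases x rule: int_cases2; cases "nat (- x)") (auto simp: image_iff intro: int_cases)
    thus ?thesis by auto
  qed
  moreover have "range int \<inter> range (\<lambda>n. - int (Suc n)) = {}" by auto
  ultimately show ?thesis using summable_on_Un_disjoint[OF 1 2] by simp
qed

locale theta_curve = upper_half_plane +
  fixes N :: nat
  assumes N_ge_4: "N \<ge> 4"
begin

lemma N_pos [simp]: "N > 0" "N \<noteq> 0" "real N > 0" "(of_nat N :: complex) \<noteq> 0"
  using N_ge_4 by auto

lemma diff_quotient_int:
  assumes "i < N" "j < N" "(real i - real j) / real N = real_of_int m"
  shows "i = j"
proof -
  have "real_of_int (int i - int j) = real_of_int (m * int N)"
    using assms(3) by (simp add: field_simps)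
  hence m: "int i - int j = m * int N" unfolding of_int_eq_iff .
  have "\<bar>m * int N\<bar> < int N" using assms(1,2) unfolding m [symmetric] by linarith
  hence "\<bar>m\<bar> * int N < 1 * int N" by (simp add: abs_mult)
  hence "\<bar>m\<bar> < 1" by (rule mult_right_less_imp_less) simp
  thus ?thesis using m by simp
qed

section \<open>Convergence and holomorphy of the theta series\<close>

definition theta_term :: "int \<Rightarrow> int \<Rightarrow> complex \<Rightarrow> complex" where
  "theta_term k n z = ee (1/2 * of_nat N * (of_int n - of_int k / of_nat N + 1/2)^2 * \<tau>
            + of_nat N * (of_int n - of_int k / of_nat N + 1/2) * (z + 1/2))"

lemma theta_eq: "theta N k z \<tau> = (\<Sum>\<^sub>\<infinity>n. theta_term k n z)"
  by (simp add: theta_def theta_term_def)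

text \<open>The Gaussian decay in \<open>n\<close> beats the linear exponent, by completing the
  square. Only a bound on \<open>Im z\<close> enters, so the convergence is uniform on horizontal
  strips.\<close>

lemma norm_theta_term_le:
  assumes "\<bar>Im z\<bar> \<le> R"
  shows "norm (theta_term k n z) \<le> exp ((2 * pi * N * R + 1)\<^sup>2 / (4 * (pi * N * Im \<tau>))
           + \<bar>1/2 - real_of_int k / N\<bar>) * exp (- \<bar>real_of_int n\<bar>)"
proof -
  define m where "m = real_of_int n - real_of_int k / N + 1/2"
  define a where "a = pi * N * Im \<tau>"
  \<comment> \<open>The summand \<open>1\<close> is balanced by the term
    \<open>- \<bar>m\<bar>\<close> below, which survives the completion of the square and becomes
    the summable factor.\<close>
  define b where "b = 2 * pi * N * R + 1"
  have a: "a > 0" using Im_tau by (simp add: a_def)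
  have mc: "of_int n - of_int k / of_nat N + 1/2 = complex_of_real m" by (simp add: m_def)
  have "Im (1/2 * of_nat N * (complex_of_real m)^2 * \<tau> + of_nat N * complex_of_real m * (z + 1/2))
      = N * m\<^sup>2 * Im \<tau> / 2 + N * m * Im z"
    by (simp flip: of_real_power)
  hence "norm (theta_term k n z) = exp (- 2 * pi * (N * m\<^sup>2 * Im \<tau> / 2 + N * m * Im z))"
    unfolding theta_term_def mc norm_ee by simp
  also have "- 2 * pi * (N * m\<^sup>2 * Im \<tau> / 2 + N * m * Im z) = - (a * m\<^sup>2) - 2 * pi * N * (m * Im z)"
    by (simp add: a_def field_simps)
  also have "\<dots> \<le> - (a * m\<^sup>2) + 2 * pi * N * (\<bar>m\<bar> * R)"
  proof -
    have "- (m * Im z) \<le> \<bar>m * Im z\<bar>" by simp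
    also have "\<dots> \<le> \<bar>m\<bar> * R" unfolding abs_mult using assms by (intro mult_left_mono) auto
    finally have "2 * pi * N * (- (m * Im z)) \<le> 2 * pi * N * (\<bar>m\<bar> * R)"
      by (intro mult_left_mono) auto
    thus ?thesis by simp
  qed
  also have "\<dots> = (- a * \<bar>m\<bar>\<^sup>2 + b * \<bar>m\<bar>) - \<bar>m\<bar>"
    by (simp add: b_def algebra_simps)
  also have "- a * \<bar>m\<bar>\<^sup>2 + b * \<bar>m\<bar> \<le> b\<^sup>2 / (4 * a)"
  proof -
    have "0 \<le> (2 * a * \<bar>m\<bar> - b)\<^sup>2 / (4 * a)" using a by simp
    also have "\<dots> = a * \<bar>m\<bar>\<^sup>2 - b * \<bar>m\<bar> + b\<^sup>2 / (4 * a)"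
      using a by (simp add: power2_eq_square field_simps)
    finally show ?thesis by simp
  qed
  also have "b\<^sup>2 / (4 * a) - \<bar>m\<bar> \<le> (b\<^sup>2 / (4 * a) + \<bar>1/2 - real_of_int k / N\<bar>) + - \<bar>real_of_int n\<bar>"
    unfolding m_def by linarith
  finally show ?thesis by (simp add: a_def b_def flip: exp_add)
qed

lemma summable_bound: "(\<lambda>n::int. C * exp (- \<bar>real_of_int n\<bar>)) summable_on UNIV"
  using summable_on_exp_neg_abs by (rule summable_on_cmult_right)

lemma uniform_limit_theta:
  assumes "\<And>z. z \<in> Y \<Longrightarrow> \<bar>Im z\<bar> \<le> R"
  shows "uniform_limit Y (\<lambda>X z. \<Sum>n\<in>X. theta_term k n z) (\<lambda>z. theta N k z \<tau>)
           (finite_subsets_at_top UNIV)"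
  unfolding theta_eq
  by (rule Weierstrass_m_test_general[OF norm_theta_term_le summable_bound]) (rule assms)

lemma holomorphic_theta: "(\<lambda>z. theta N k z \<tau>) holomorphic_on UNIV"
proof -
  have *: "(\<lambda>z. theta N k z \<tau>) holomorphic_on ball x 1" for x
  proof (rule holomorphic_uniform_limit)
    show "\<forall>\<^sub>F X in finite_subsets_at_top UNIV.
        continuous_on (cball x 1) (\<lambda>z. \<Sum>n\<in>X. theta_term k n z) \<and>
        (\<lambda>z. \<Sum>n\<in>X. theta_term k n z) holomorphic_on ball x 1"
      by (intro always_eventually allI conjI)
         (auto simp: theta_term_def intro!: continuous_intros holomorphic_intros)
    show "uniform_limit (cball x 1) (\<lambda>X z. \<Sum>n\<in>X. theta_term k n z) (\<lambda>z. theta N k z \<tau>)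
        (finite_subsets_at_top UNIV)"
    proof (rule uniform_limit_theta)
      fix z assume "z \<in> cball x 1"
      hence "\<bar>Im (z - x)\<bar> \<le> 1" using abs_Im_le_cmod[of "z - x"] by (simp add: dist_norm norm_minus_commute)
      thus "\<bar>Im z\<bar> \<le> \<bar>Im x\<bar> + 1" by simp
    qed
  qed auto
  have "(\<lambda>z. theta N k z \<tau>) field_differentiable at x" for x
    by (rule holomorphic_on_imp_differentiable_at[OF *[of x]]) auto
  thus ?thesis
    by (auto simp: holomorphic_on_def intro: field_differentiable_at_within)
qed

section \<open>Transformation laws of the theta series\<close>

lemma theta_shift_tau:
  "theta N k (z - \<tau> / of_nat N) \<tau> = ee (z + 1/2 - \<tau> / (2 * of_nat N)) * theta N (k + 1) z \<tau>"
proof -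
  have "theta_term k n (z - \<tau> / of_nat N) = ee (z + 1/2 - \<tau> / (2 * of_nat N)) * theta_term (k + 1) n z" for n
    unfolding theta_term_def ee_add [symmetric]
    by (rule arg_cong[of _ _ ee]) (simp add: field_simps power2_eq_square)
  thus ?thesis unfolding theta_eq by (simp add: infsum_cmult_right')
qed

lemma theta_shift_1:
  "theta N k (z - 1 / of_nat N) \<tau> = ee (of_int k / of_nat N + 1/2) * theta N k z \<tau>"
proof -
  have "theta_term k n (z - 1 / of_nat N) = ee (of_int k / of_nat N + 1/2) * theta_term k n z" for n
  proof -
    have "theta_term k n (z - 1 / of_nat N) = ee (of_int k / of_nat N + 1/2) * theta_term k n z * ee (of_int (- n - 1))"
      unfolding theta_term_def ee_add [symmetric]
      by (rule arg_cong[of _ _ ee]) (simp add: field_simps power2_eq_square)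
    thus ?thesis by (simp only: ee_of_int mult_1_right)
  qed
  thus ?thesis unfolding theta_eq by (simp add: infsum_cmult_right')
qed

text \<open>Replacing \<open>n\<close> by \<open>- n - 1\<close> turns \<open>n - k/N + 1/2\<close>
  into the negative of the same number formed with \<open>- k\<close>. The two linear terms then
  differ by \<open>N / 2\<close> up to an integer.\<close>

lemma theta_uminus: "theta N k (- z) \<tau> = ee (of_nat N / 2) * theta N (- k) z \<tau>"
proof -
  have *: "theta_term k (- n - 1) (- z) = ee (of_nat N / 2) * theta_term (- k) n z" for n
  proof -
    have "theta_term k (- n - 1) (- z) = ee (of_nat N / 2) * theta_term (- k) n z * ee (of_int (- int N * (n + 1) - k))"
      unfolding theta_term_def ee_add [symmetric]
      by (rule arg_cong[of _ _ ee]) (simp add: field_simps power2_eq_square)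
    thus ?thesis by (simp only: ee_of_int mult_1_right)
  qed
  have "theta N k (- z) \<tau> = (\<Sum>\<^sub>\<infinity>n. theta_term k (- n - 1) (- z))"
    unfolding theta_eq
    by (rule infsum_reindex_bij_witness[of _ "\<lambda>n. - n - 1" "\<lambda>n. - n - 1"]) auto
  thus ?thesis unfolding * theta_eq by (simp add: infsum_cmult_right')
qed

lemma theta_add_N: "theta N (k + int N) z \<tau> = theta N k z \<tau>"
proof -
  have "theta_term (k + int N) n z = theta_term k (n - 1) z" for n
    unfolding theta_term_def by (rule arg_cong[of _ _ ee]) (simp add: field_simps)
  hence "theta N (k + int N) z \<tau> = (\<Sum>\<^sub>\<infinity>n. theta_term k (n - 1) z)" by (simp add: theta_eq)
  also have "\<dots> = theta N k z \<tau>" unfolding theta_eq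
    by (rule infsum_reindex_bij_witness[of _ "\<lambda>n. n + 1" "\<lambda>n. n - 1"]) auto
  finally show ?thesis .
qed

lemma theta_mod: "theta N (k mod int N) z \<tau> = theta N k z \<tau>"
proof -
  have "theta N (k + int N * j) z \<tau> = theta N k z \<tau>" for j k
  proof (induction j rule: int_induct[where k = 0])
    case (step1 i)
    thus ?case using theta_add_N[of "k + int N * i"] by (simp add: algebra_simps)
  next
    case (step2 i)
    thus ?case using theta_add_N[of "k + int N * (i - 1)"] by (simp add: algebra_simps)
  qed simp
  from this[of "k mod int N" "k div int N"] show ?thesis by simp
qed

lemma theta_plus_tau:
  "theta N k (z + \<tau>) \<tau> = ee (- (of_nat N * \<tau> / 2) - of_nat N / 2 - of_nat N * z) * theta N k z \<tau>"
proof -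
  have "theta_term k n (z + \<tau>) = ee (- (of_nat N * \<tau> / 2) - of_nat N / 2 - of_nat N * z) * theta_term k (n + 1) z" for n
    unfolding theta_term_def ee_add [symmetric]
    by (rule arg_cong[of _ _ ee]) (simp add: field_simps power2_eq_square)
  hence "theta N k (z + \<tau>) \<tau> =
      ee (- (of_nat N * \<tau> / 2) - of_nat N / 2 - of_nat N * z) * (\<Sum>\<^sub>\<infinity>n. theta_term k (n + 1) z)"
    unfolding theta_eq by (simp add: infsum_cmult_right')
  also have "(\<Sum>\<^sub>\<infinity>n. theta_term k (n + 1) z) = theta N k z \<tau>" unfolding theta_eq
    by (rule infsum_reindex_bij_witness[of _ "\<lambda>n. n - 1" "\<lambda>n. n + 1"]) auto
  finally show ?thesis .
qed

text \<open>The factor makes the function periodic under \<open>z \<mapsto> z + 1\<close> also for odd \<open>N\<close>.\<close>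

definition th :: "int \<Rightarrow> complex \<Rightarrow> complex" where
  "th k z = ee (- (of_nat N * z / 2)) * theta N k z \<tau>"

text \<open>Half of the term \<open>- N * \<tau>\<close> comes from \<open>theta_plus_tau\<close>,
  the other half from the factor in \<open>th\<close>.\<close>

definition c0 :: complex where "c0 = ee (- (of_nat N * \<tau>) - of_nat N / 2)"

lemma c0_nonzero [simp]: "c0 \<noteq> 0"
  by (simp add: c0_def)

lemma th_shift_1: "th k (z - 1 / of_nat N) = ee (of_int k / of_nat N) * th k z"
proof -
  have "ee (- (of_nat N * (z - 1 / of_nat N) / 2)) * ee (of_int k / of_nat N + 1/2) =
      ee (of_int k / of_nat N) * ee (- (of_nat N * z / 2)) * ee 1"
    unfolding ee_add [symmetric] by (rule arg_cong[of _ _ ee]) (simp add: field_simps)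
  thus ?thesis by (simp add: th_def theta_shift_1)
qed

lemma th_shift_nat: "th k (z - of_nat n / of_nat N) = ee (of_nat n * of_int k / of_nat N) * th k z"
proof (induction n)
  case (Suc n)
  have "th k (z - of_nat (Suc n) / of_nat N) = th k ((z - of_nat n / of_nat N) - 1 / of_nat N)"
    by (intro arg_cong[of _ _ "th k"]) (simp add: field_simps)
  also have "\<dots> = ee (of_int k / of_nat N) * (ee (of_nat n * of_int k / of_nat N) * th k z)"
    by (simp only: th_shift_1 Suc.IH)
  also have "\<dots> = ee (of_nat (Suc n) * of_int k / of_nat N) * th k z"
    unfolding mult.assoc [symmetric] ee_add [symmetric] by (simp add: field_simps)
  finally show ?case .
qed simp

lemma th_tf: "th k \<in> tf (int N) c0"
proof (rule tfI)
  show "th k holomorphic_on UNIV"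
    unfolding th_def by (intro holomorphic_intros holomorphic_theta) auto
  \<comment> \<open>A shift by \<open>1\<close> consists of \<open>N\<close> shifts by
    \<open>1 / N\<close>, which together multiply by \<open>ee k = 1\<close>.\<close>
  show "th k (z + 1) = th k z" for z
    using th_shift_nat[of k "z + 1" N] by simp
  show "th k (z + \<tau>) = c0 * ee (- (of_int (int N) * z)) * th k z" for z
  proof -
    have "ee (- (of_nat N * (z + \<tau>) / 2)) * ee (- (of_nat N * \<tau> / 2) - of_nat N / 2 - of_nat N * z) =
        c0 * ee (- (of_nat N * z)) * ee (- (of_nat N * z / 2))"
      unfolding c0_def ee_add [symmetric] by (rule arg_cong[of _ _ ee]) (simp add: field_simps)
    thus ?thesis by (simp add: th_def theta_plus_tau)
  qed
qed

text \<open>A Fourier coefficient is computed: after removal of the common factor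
  \<open>ee (N * d * z)\<close> the terms have the frequencies \<open>N * n\<close>, and integration
  over \<open>[0, 1]\<close> extracts the coefficient \<open>a 0\<close>, an exponential. Uniform
  convergence on the real interval allows the interchange of limit and integral.\<close>

lemma theta_not_identically_0: "\<exists>z. theta N k z \<tau> \<noteq> 0"
proof (rule ccontr)
  assume "\<not> ?thesis"
  hence 0: "theta N k z \<tau> = 0" for z by simp
  define d where "d = 1/2 - complex_of_int k / of_nat N"
  define a where "a = (\<lambda>n::int. ee (1/2 * of_nat N * (of_int n + d)^2 * \<tau> + of_nat N * (of_int n + d) / 2))"
  have tt: "theta_term k n z = ee (of_nat N * d * z) * (a n * ee (of_int (int N * n) * z))" for n z
    unfolding a_def theta_term_def d_def ee_add [symmetric]
    by (rule arg_cong[of _ _ ee]) (simp add: field_simps)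
  define f where "f = (\<lambda>X x. ee (- (of_nat N * d * of_real x)) * (\<Sum>n\<in>X. theta_term k n (of_real x)))"
  have f: "f X x = (\<Sum>n\<in>X. a n * ee (of_int (int N * n) * of_real x))" for X x
    unfolding f_def tt sum_distrib_left [symmetric] by (simp add: ee_minus)
  have "uniform_limit (of_real ` {0..1::real}) (\<lambda>X z. \<Sum>n\<in>X. theta_term k n z) (\<lambda>z. theta N k z \<tau>)
      (finite_subsets_at_top UNIV)"
    by (rule uniform_limit_theta[of _ 0]) auto
  hence ul: "uniform_limit {0..1::real} (\<lambda>X x. \<Sum>n\<in>X. theta_term k n (of_real x)) (\<lambda>x. 0)
      (finite_subsets_at_top UNIV)"
    unfolding uniform_limit_iff 0 by (simp add: eventually_mono)
  have ul2: "uniform_limit {0..1::real} f (\<lambda>x. ee (- (of_nat N * d * of_real x)) * 0) (finite_subsets_at_top UNIV)"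
    unfolding f_def
  proof (rule uniform_lim_mult[OF uniform_limit_const ul])
    have "compact ((\<lambda>x. ee (- (of_nat N * d * of_real x))) ` {0..1::real})"
      by (intro compact_continuous_image continuous_intros) auto
    thus "bounded ((\<lambda>x. ee (- (of_nat N * d * of_real x))) ` {0..1::real})"
      by (rule compact_imp_bounded)
  qed (simp add: image_constant_conv)
  obtain I J where I: "\<And>X. (f X has_integral I X) {0..1}"
      "((\<lambda>x. ee (- (of_nat N * d * of_real x)) * 0) has_integral J) {0..1}"
      "(I \<longlongrightarrow> J) (finite_subsets_at_top UNIV)"
  proof (rule uniform_limit_integral[OF ul2])
    show "continuous_on {0..1} (f X)" for X unfolding f by (intro continuous_intros)
  qed auto
  have J: "J = 0" using I(2) by (simp add: has_integral_0_eq)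
  have "I X = a 0" if "finite X" "0 \<in> X" for X
  proof -
    have "(f X has_integral (\<Sum>n\<in>X. a n * (if int N * n = 0 then 1 else 0))) {0..1}"
      unfolding f using that by (intro has_integral_sum has_integral_mult_right has_integral_ee_int)
    also have "(\<Sum>n\<in>X. a n * (if int N * n = 0 then 1 else 0)) = (\<Sum>n\<in>X. if n = 0 then a n else 0)"
      by (rule sum.cong) auto
    also have "\<dots> = a 0" using that by simp
    finally show ?thesis using I(1) has_integral_unique by blast
  qed
  hence "\<forall>\<^sub>F X in finite_subsets_at_top UNIV. I X = a 0"
    unfolding eventually_finite_subsets_at_top by (intro exI[of _ "{0}"]) auto
  hence "(I \<longlongrightarrow> a 0) (finite_subsets_at_top UNIV)" by (rule tendsto_eventually)
  hence "a 0 = J" using I(3) by (rule tendsto_unique[rotated]) simp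
  thus False using J by (simp add: a_def)
qed

lemma th_not_identically_0: "\<exists>z. th k z \<noteq> 0"
  using theta_not_identically_0[of k] by (auto simp: th_def)

text \<open>The functions \<open>th k\<close> are eigenvectors of the translation by
  \<open>- 1 / N\<close> with the distinct eigenvalues \<open>ee (k / N)\<close>. A discrete Fourier
  sum over all \<open>N\<close> translates projects the relation onto the eigenspace of
  \<open>l\<close>.\<close>

lemma th_independent:
  assumes "\<And>z. (\<Sum>k<N. a k * th (int k) z) = 0" and "l < N"
  shows "a l = 0"
proof -
  have shift: "th (int k) (z - of_nat j / of_nat N) = ee (of_nat (k * j) / of_nat N) * th (int k) z" for k j z
    by (simp add: th_shift_nat mult.commute)
  \<comment> \<open>The ratio of the eigenvalues of \<open>th k\<close> and \<open>th l\<close>: an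
    \<open>N\<close>-th root of unity that equals \<open>1\<close> only for \<open>k = l\<close>, so
    that its powers sum to \<open>0\<close> or \<open>N\<close>.\<close>
  define w where "w = (\<lambda>k. ee ((of_nat k - of_nat l) / of_nat N))"
  have wpow: "w k ^ j = ee (of_nat (k * j) / of_nat N) * ee (- (of_nat (l * j) / of_nat N))" for k j
    unfolding w_def ee_power ee_add [symmetric] by (rule arg_cong[of _ _ ee]) (simp add: field_simps)
  have w1: "w k = 1 \<longleftrightarrow> k = l" if "k < N" for k
  proof
    assume "w k = 1"
    then obtain m :: int where m: "(of_nat k - of_nat l) / of_nat N = complex_of_int m"
      unfolding w_def ee_eq_1_iff by blast
    hence "complex_of_real ((real k - real l) / real N) = complex_of_real (of_int m)" by simp
    hence "(real k - real l) / real N = of_int m" unfolding of_real_eq_iff .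
    thus "k = l" by (rule diff_quotient_int[OF that assms(2)])
  qed (simp add: w_def)
  have wN: "w k ^ N = 1" for k
    unfolding w_def ee_power using ee_of_int[of "int k - int l"] by simp
  have geo: "(\<Sum>j<N. w k ^ j) = (if k = l then of_nat N else 0)" if "k < N" for k
    using w1[OF that] wN[of k] by (auto simp: geometric_sum)
  obtain z where z: "th (int l) z \<noteq> 0" using th_not_identically_0 by blast
  have "0 = (\<Sum>j<N. ee (- (of_nat (l * j) / of_nat N)) * (\<Sum>k<N. a k * th (int k) (z - of_nat j / of_nat N)))"
    by (simp add: assms(1))
  also have "\<dots> = (\<Sum>j<N. \<Sum>k<N. w k ^ j * (a k * th (int k) z))"
    unfolding sum_distrib_left shift wpow by (simp add: mult_ac)
  also have "\<dots> = (\<Sum>k<N. (\<Sum>j<N. w k ^ j) * (a k * th (int k) z))"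
    unfolding sum_distrib_right by (rule sum.swap)
  also have "\<dots> = (\<Sum>k<N. if k = l then of_nat N * (a l * th (int l) z) else 0)"
    by (rule sum.cong) (auto simp: geo)
  also have "\<dots> = of_nat N * (a l * th (int l) z)" using assms(2) by simp
  finally show ?thesis using z by simp
qed

end

section \<open>Rank-nullity for subspaces with a finite spanning set\<close>

context vector_space_pair begin

text \<open>Polynomials and entire functions form infinite-dimensional spaces, so rank-nullity is
  stated for the restriction of \<open>f\<close> to a subspace \<open>S\<close> inside a finitely
  generated span.\<close>

lemma dim_kernel_plus_dim_image:
  assumes f: "Vector_Spaces.linear s1 s2 f" and S: "vs1.subspace S" and T: "finite T" "S \<subseteq> vs1.span T"
  shows "vs1.dim S = vs1.dim {x\<in>S. f x = 0} + vs2.dim (f ` S)"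
proof -
  interpret f: Vector_Spaces.linear s1 s2 f by (rule f)
  define K where "K = {x\<in>S. f x = 0}"
  have K: "vs1.subspace K"
    using S unfolding K_def vs1.subspace_def by (auto simp: f.add f.scale)
  obtain A where A: "A \<subseteq> K" "vs1.independent A" "K \<subseteq> vs1.span A" "card A = vs1.dim K"
    using vs1.basis_exists[of K] by metis
  have spanA: "vs1.span A = K"
    using A K vs1.span_minimal by blast
  obtain B where B: "A \<subseteq> B" "B \<subseteq> S" "vs1.independent B" "S \<subseteq> vs1.span B"
    using vs1.maximal_independent_subset_extend[of A S] A unfolding K_def by blast
  have finB: "finite B" and "finite A"
    using vs1.independent_span_bound[OF T(1) B(3)] B T finite_subset by blast+
  have spanB: "vs1.span B = S"
    using B S vs1.span_minimal by blast
  define C where "C = B - A"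
  have C: "vs1.independent C" using B(3) by (rule vs1.independent_mono) (auto simp: C_def)
  have inj: "inj_on f (vs1.span C)"
  proof (subst f.inj_on_iff_eq_0)
    show "\<forall>x\<in>vs1.span C. f x = 0 \<longrightarrow> x = 0"
    proof (intro ballI impI)
      fix x assume x: "x \<in> vs1.span C" "f x = 0"
      have "x \<in> S" using x(1) vs1.span_mono[of C B] spanB by (auto simp: C_def)
      hence xA: "x \<in> vs1.span A" using x by (simp add: spanA K_def)
      \<comment> \<open>The unique representation of \<open>x\<close> in \<open>B\<close> is
        supported both in \<open>A\<close> and in the disjoint set \<open>B - A\<close>, hence is
        zero.\<close>
      have "vs1.representation A x = vs1.representation B x"
        by (rule vs1.representation_extend[OF B(3) xA B(1), symmetric])
      moreover have "vs1.representation C x = vs1.representation B x"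
        by (rule vs1.representation_extend[OF B(3) x(1), symmetric]) (auto simp: C_def)
      ultimately have "vs1.representation A x b = 0" for b
        using vs1.representation_ne_zero[of A x b] vs1.representation_ne_zero[of C x b]
        by (auto simp: C_def)
      thus "x = 0"
        using vs1.sum_nonzero_representation_eq[OF A(2) xA] by simp
    qed
  qed (rule vs1.subspace_span)
  have ind: "vs2.independent (f ` C)"
    by (rule linear_independent_injective_image[OF f C inj])
  have "f ` S = vs2.span (f ` C)"
  proof
    show "vs2.span (f ` C) \<subseteq> f ` S"
      unfolding linear_span_image[OF f] using vs1.span_mono[of C B] spanB by (auto simp: C_def)
    have "f b \<in> vs2.span (f ` C)" if "b \<in> B" for b
    proof (cases "b \<in> A")
      case True
      hence "f b = 0" using A(1) by (auto simp: K_def)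
      thus ?thesis by (simp add: vs2.span_zero)
    next
      case False
      thus ?thesis using that by (intro vs2.span_base) (auto simp: C_def)
    qed
    hence "vs2.span (f ` B) \<subseteq> vs2.span (f ` C)"
      by (intro vs2.span_minimal vs2.subspace_span) auto
    thus "f ` S \<subseteq> vs2.span (f ` C)"
      unfolding linear_span_image[OF f] spanB .
  qed
  hence "vs2.dim (f ` S) = card (f ` C)"
    by (simp add: vs2.dim_eq_card_independent[OF ind])
  also have "\<dots> = card C"
    using inj_on_subset[OF inj vs1.span_superset] by (rule card_image)
  finally have "vs2.dim (f ` S) = card B - card A"
    using B(1) finB \<open>finite A\<close> by (simp add: C_def card_Diff_subset)
  moreover have "vs1.dim S = card B"
    using B by (metis vs1.dim_span_eq_card_independent spanB)
  moreover have "card A \<le> card B" using B(1) finB by (rule card_mono[rotated])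
  ultimately show ?thesis using A(4) by (simp add: K_def)
qed

end

section \<open>Spaces of theta functions as vector spaces\<close>

definition fscale :: "complex \<Rightarrow> (complex \<Rightarrow> complex) \<Rightarrow> complex \<Rightarrow> complex" where
  "fscale c f = (\<lambda>z. c * f z)"

interpretation fn: vector_space fscale
  by standard (auto simp: fscale_def fun_eq_iff algebra_simps)

interpretation fn_pair: vector_space_pair fscale fscale ..

lemma sum_fun_apply: "(\<Sum>i\<in>A. f i) z = (\<Sum>i\<in>A. f i z)" for f :: "'a \<Rightarrow> 'b \<Rightarrow> 'c::comm_monoid_add"
  by (induction A rule: infinite_finite_induct) auto

context upper_half_plane begin

lemma subspace_tf: "fn.subspace (tf m c)"
  unfolding fn.subspace_def
  by (auto simp: zero_fun_def plus_fun_def fscale_def intro: tf_0 tf_add tf_scale)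

text \<open>Multiplication by \<open>sig\<close> embeds degree \<open>n\<close> into degree
  \<open>n + 1\<close> with the sections vanishing at \<open>0\<close> as image, and one section
  with \<open>u 0 \<noteq> 0\<close> completes a basis. The multiplier is divided by
  \<open>- 1\<close> because that is the multiplier of \<open>sig\<close>.\<close>

lemma tf_basis:
  assumes "n \<ge> 1" "c \<noteq> 0"
  shows "\<exists>B. finite B \<and> card B = n \<and> fn.independent B \<and> fn.span B = tf (int n) c"
  using assms
proof (induction n arbitrary: c rule: nat_induct_at_least)
  case base
  obtain s where s: "ee s = - c" using ee_surj[of "- c"] base by auto
  let ?f = "\<lambda>z. sig (z - s)"
  have f: "?f \<in> tf 1 c" using sig_tf[of s] s by simp
  obtain u where u: "u \<notin> lattice \<tau>"
    using ex_notin_lattice_translates[of "{0}"] by auto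
  have "?f (u + s) \<noteq> 0" using u by (simp add: sig_eq_0_iff)
  hence "?f \<noteq> (\<lambda>_. 0)" by metis
  hence "?f \<noteq> 0" by (simp add: zero_fun_def)
  moreover have "fn.span {?f} = tf 1 c"
  proof
    show "fn.span {?f} \<subseteq> tf 1 c" using f subspace_tf by (intro fn.span_minimal) auto
    show "tf 1 c \<subseteq> fn.span {?f}"
    proof
      fix g assume "g \<in> tf 1 c"
      hence "g \<in> tf 1 (- ee s)" using s by simp
      then obtain t where "\<And>z. g z = t * sig (z - s)" using tf_degree_1 by blast
      hence "g = fscale t ?f" by (auto simp: fscale_def)
      thus "g \<in> fn.span {?f}" by (simp add: fn.span_base fn.span_scale)
    qed
  qed
  ultimately show ?case by (intro exI[of _ "{?f}"]) simp
next
  case (Suc n)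
  obtain u where u: "u \<in> tf (int (Suc n)) c" "u 0 \<noteq> 0"
    using tf_ex_nonvanishing[of "Suc n" c 0] Suc by auto
  obtain B where B: "finite B" "card B = n" "fn.independent B" "fn.span B = tf (int n) (c / (- 1))"
    using Suc.IH[of "c / (- 1)"] Suc.prems by auto
  define M where "M = (\<lambda>b z. sig z * b z)"
  have M: "Vector_Spaces.linear fscale fscale M"
    by (simp add: Vector_Spaces.linear_iff M_def fscale_def fun_eq_iff algebra_simps)
       (auto intro!: fn.vector_space_axioms)
  then interpret M: Vector_Spaces.linear fscale fscale M .
  have inj: "inj_on M (fn.span B)"
  proof (rule inj_onI)
    fix f g assume fg: "f \<in> fn.span B" "g \<in> fn.span B" "M f = M g"
    obtain w where w: "w \<notin> lattice \<tau>"
      using ex_notin_lattice_translates[of "{0}"] by auto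
    have "f z - g z = 0" for z
    proof (rule entire_mult_zeroD[of "\<lambda>z. f z - g z" sig])
      show "(\<lambda>z. f z - g z) holomorphic_on UNIV"
        using fg B(4) by (intro holomorphic_intros tf_holomorphic) auto
      show "(f z - g z) * sig z = 0" for z
        using fun_cong[OF fg(3), of z] by (simp add: M_def algebra_simps)
      show "sig w \<noteq> 0" using w by (simp add: sig_eq_0_iff)
    qed (rule holomorphic_sig)
    thus "f = g" by (simp add: fun_eq_iff)
  qed
  have Mi: "fn.independent (M ` B)"
    by (rule fn_pair.linear_independent_injective_image[OF M B(3) inj])
  have z: "fn.span (M ` B) \<subseteq> {f. f 0 = 0}"
    by (intro fn.span_minimal) (auto simp: fn.subspace_def fscale_def M_def sig_eq_0_iff)
  hence un: "u \<notin> fn.span (M ` B)" using u by auto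
  have unM: "u \<notin> M ` B" using un fn.span_base[of u "M ` B"] by argo
  have Msub: "M ` tf (int n) (c / (- 1)) \<subseteq> tf (int (Suc n)) c"
  proof (rule image_subsetI)
    fix g assume "g \<in> tf (int n) (c / (- 1))"
    thus "M g \<in> tf (int (Suc n)) c"
      using tf_mult'[OF sig_tf[of 0], of g "int n" "c / (- 1)" "int (Suc n)" c] by (simp add: M_def)
  qed
  have "fn.span (insert u (M ` B)) = tf (int (Suc n)) c"
  proof
    show "fn.span (insert u (M ` B)) \<subseteq> tf (int (Suc n)) c"
      using u Msub B(4) fn.span_superset[of B] by (intro fn.span_minimal subspace_tf) auto
    show "tf (int (Suc n)) c \<subseteq> fn.span (insert u (M ` B))"
    proof
      fix f assume f: "f \<in> tf (int (Suc n)) c"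
      define t where "t = f 0 / u 0"
      have g: "(\<lambda>z. f z - t * u z) \<in> tf (int (Suc n)) c" by (intro tf_diff tf_scale f u)
      obtain h where h: "h \<in> tf (int (Suc n) - 1) (c / (- ee 0))" "\<And>z. f z - t * u z = sig (z - 0) * h z"
        by (rule tf_divide_sig[OF g, of 0]) (use u Suc in \<open>auto simp: t_def\<close>)
      have "h \<in> fn.span B" using h(1) B(4) by simp
      hence "M h \<in> fn.span (M ` B)" by (simp add: fn_pair.linear_span_image[OF M])
      hence "fscale t u + M h \<in> fn.span (insert u (M ` B))"
        using fn.span_mono[of "M ` B" "insert u (M ` B)"]
        by (intro fn.span_add fn.span_scale) (auto intro: fn.span_base)
      also have "fscale t u + M h = f" using h(2) by (auto simp: M_def fscale_def fun_eq_iff algebra_simps)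
      finally show "f \<in> fn.span (insert u (M ` B))" .
    qed
  qed
  moreover have "fn.independent (insert u (M ` B))" by (rule fn.independent_insertI[OF un Mi])
  moreover have "card (insert u (M ` B)) = Suc n"
    using B unM card_image[OF inj_on_subset[OF inj fn.span_superset]] by simp
  ultimately show ?case using B(1) by (intro exI[of _ "insert u (M ` B)"]) auto
qed

lemma dim_tf: "n \<ge> 1 \<Longrightarrow> c \<noteq> 0 \<Longrightarrow> fn.dim (tf (int n) c) = n"
  using tf_basis[of n c] fn.dim_span_eq_card_independent by metis

end

context theta_curve begin

text \<open>The \<open>N\<close> independent functions \<open>th k\<close> lie in a space of
  dimension \<open>N\<close> and therefore span it: the coordinate functions form a complete linear
  system.\<close>

lemma tf_theta_coeffs:
  assumes f: "f \<in> tf (int N) c0"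
  obtains a where "\<And>z. f z = (\<Sum>k<N. a k * th (int k) z)"
proof -
  let ?C = "(\<lambda>k. th (int k)) ` {..<N}"
  have inj: "inj_on (\<lambda>k. th (int k)) {..<N}"
  proof (rule inj_onI)
    fix k l assume kl: "k \<in> {..<N}" "l \<in> {..<N}" "th (int k) = th (int l)"
    show "k = l"
    proof (rule ccontr)
      assume "k \<noteq> l"
      have "(\<Sum>i<N. (of_bool (i = k) - of_bool (i = l)) * th (int i) z) = th (int k) z - th (int l) z" for z
        using kl by (simp add: left_diff_distrib sum_subtractf of_bool_def if_distrib[of "\<lambda>x. x * _"] cong: if_cong)
      hence "(of_bool (k = k) - of_bool (k = l) :: complex) = 0"
        using kl th_independent[of "\<lambda>i. of_bool (i = k) - of_bool (i = l)" k] by simp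
      thus False using \<open>k \<noteq> l\<close> by simp
    qed
  qed
  have ind: "fn.independent ?C"
  proof (rule fn.independent_if_scalars_zero)
    fix g x assume g: "(\<Sum>x\<in>?C. fscale (g x) x) = 0" and x: "x \<in> ?C"
    have "(\<Sum>k<N. g (th (int k)) * th (int k) z) = 0" for z
    proof -
      have "(\<Sum>x\<in>?C. fscale (g x) x) z = (\<Sum>k<N. g (th (int k)) * th (int k) z)"
        by (simp add: sum_fun_apply sum.reindex[OF inj] fscale_def)
      thus ?thesis by (simp add: g)
    qed
    from th_independent[OF this] show "g x = 0" using x by auto
  qed simp
  obtain B where B: "finite B" "card B = N" "fn.span B = tf (int N) c0"
    using tf_basis[of N c0] N_ge_4 by auto
  have "?C \<subseteq> tf (int N) c0" using th_tf by (rule image_subsetI)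
  then obtain D where D: "?C \<subseteq> D" "D \<subseteq> tf (int N) c0" "fn.independent D" "tf (int N) c0 \<subseteq> fn.span D"
    by (rule fn.maximal_independent_subset_extend[OF _ ind])
  have "finite D" "card D \<le> N"
    using fn.independent_span_bound[OF B(1) D(3)] D(2) B by auto
  hence "?C = D"
    using D(1) by (intro card_seteq) (auto simp: card_image[OF inj])
  hence "f \<in> fn.span ?C" using f D(4) by auto
  then obtain u where u: "f = (\<Sum>v\<in>?C. fscale (u v) v)"
    by (subst (asm) fn.span_finite) auto
  have "f z = (\<Sum>k<N. u (th (int k)) * th (int k) z)" for z
    unfolding u by (simp add: sum_fun_apply sum.reindex[OF inj] fscale_def)
  thus ?thesis by (rule that)
qed

end

section \<open>Polynomials and their evaluation\<close>

definition mon :: "(nat \<Rightarrow> complex) \<Rightarrow> (nat \<Rightarrow>\<^sub>0 nat) \<Rightarrow> complex" where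
  "mon x m = (\<Prod>i\<in>Poly_Mapping.keys m. x i ^ Poly_Mapping.lookup m i)"

text \<open>Evaluation at a total family of values instead of a vector, so that it is a ring
  homomorphism without any bound on the variables that occur.\<close>

definition peval :: "mpoly \<Rightarrow> (nat \<Rightarrow> complex) \<Rightarrow> complex" where
  "peval f x = (\<Sum>m\<in>Poly_Mapping.keys f. Poly_Mapping.lookup f m * mon x m)"

lemma mpoly_eval_eq_peval: "mpoly_eval f v = peval f (\<lambda>i. vec_index v i)"
  by (simp add: mpoly_eval_def peval_def mon_def)

lemma mon_superset:
  "finite S \<Longrightarrow> Poly_Mapping.keys m \<subseteq> S \<Longrightarrow> mon x m = (\<Prod>i\<in>S. x i ^ Poly_Mapping.lookup m i)"
  unfolding mon_def by (rule prod.mono_neutral_left) (auto simp: in_keys_iff)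

lemma mon_0 [simp]: "mon x 0 = 1"
  by (simp add: mon_def)

lemma mon_single [simp]: "mon x (Poly_Mapping.single i e) = x i ^ e"
  by (subst mon_superset[of "{i}"]) (auto split: if_splits)

lemma mon_add: "mon x (m + n) = mon x m * mon x n"
proof -
  let ?S = "Poly_Mapping.keys m \<union> Poly_Mapping.keys n"
  have "mon x (m + n) = (\<Prod>i\<in>?S. x i ^ Poly_Mapping.lookup (m + n) i)"
    using keys_add[of m n] by (intro mon_superset) auto
  also have "\<dots> = (\<Prod>i\<in>?S. x i ^ Poly_Mapping.lookup m i) * (\<Prod>i\<in>?S. x i ^ Poly_Mapping.lookup n i)"
    by (simp add: lookup_add power_add prod.distrib)
  also have "\<dots> = mon x m * mon x n"
    by (simp add: mon_superset[symmetric])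
  finally show ?thesis .
qed

lemma peval_superset:
  "finite S \<Longrightarrow> Poly_Mapping.keys f \<subseteq> S \<Longrightarrow> peval f x = (\<Sum>m\<in>S. Poly_Mapping.lookup f m * mon x m)"
  unfolding peval_def by (rule sum.mono_neutral_left) (auto simp: in_keys_iff)

lemma peval_0 [simp]: "peval 0 x = 0"
  by (simp add: peval_def)

lemma peval_single [simp]: "peval (Poly_Mapping.single m a) x = a * mon x m"
  by (subst peval_superset[of "{m}"]) (auto split: if_splits)

lemma peval_1 [simp]: "peval 1 x = 1"
  using peval_single[of 0 1 x] by simp

lemma peval_var [simp]: "peval (mpoly_var i) x = x i"
  by (simp add: mpoly_var_def)

lemma peval_add [simp]: "peval (f + g) x = peval f x + peval g x"
proof -
  let ?S = "Poly_Mapping.keys f \<union> Poly_Mapping.keys g"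
  have "peval (f + g) x = (\<Sum>m\<in>?S. Poly_Mapping.lookup (f + g) m * mon x m)"
    using keys_add[of f g] by (intro peval_superset) auto
  also have "\<dots> = (\<Sum>m\<in>?S. Poly_Mapping.lookup f m * mon x m) + (\<Sum>m\<in>?S. Poly_Mapping.lookup g m * mon x m)"
    by (simp add: lookup_add algebra_simps sum.distrib)
  also have "\<dots> = peval f x + peval g x"
    by (simp add: peval_superset[symmetric])
  finally show ?thesis .
qed

lemma peval_sum [simp]: "peval (sum f A) x = (\<Sum>a\<in>A. peval (f a) x)"
  by (induction A rule: infinite_finite_induct) auto

lemma poly_mapping_eq_sum_single:
  "f = (\<Sum>m\<in>Poly_Mapping.keys f. Poly_Mapping.single m (Poly_Mapping.lookup f m))"
proof (rule poly_mapping_eqI)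
  fix k
  have "Poly_Mapping.lookup (\<Sum>m\<in>Poly_Mapping.keys f. Poly_Mapping.single m (Poly_Mapping.lookup f m)) k
      = (\<Sum>m\<in>Poly_Mapping.keys f. if m = k then Poly_Mapping.lookup f m else 0)"
    unfolding lookup_sum by (rule sum.cong) (auto simp: lookup_single when_def)
  also have "\<dots> = Poly_Mapping.lookup f k"
    by (simp add: in_keys_iff)
  finally show "Poly_Mapping.lookup f k = Poly_Mapping.lookup
      (\<Sum>m\<in>Poly_Mapping.keys f. Poly_Mapping.single m (Poly_Mapping.lookup f m)) k" ..
qed

lemma peval_mult [simp]: "peval (f * g) x = peval f x * peval g x"
proof -
  have "f * g = (\<Sum>m\<in>Poly_Mapping.keys f. \<Sum>n\<in>Poly_Mapping.keys g.
      Poly_Mapping.single (m + n) (Poly_Mapping.lookup f m * Poly_Mapping.lookup g n))"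
    by (subst poly_mapping_eq_sum_single[of f], subst poly_mapping_eq_sum_single[of g])
       (simp add: sum_product mult_single)
  hence "peval (f * g) x = (\<Sum>m\<in>Poly_Mapping.keys f. \<Sum>n\<in>Poly_Mapping.keys g.
      (Poly_Mapping.lookup f m * mon x m) * (Poly_Mapping.lookup g n * mon x n))"
    by (simp add: mon_add mult_ac)
  also have "\<dots> = peval f x * peval g x"
    by (simp add: peval_def sum_product)
  finally show ?thesis .
qed

lemma peval_power [simp]: "peval (f ^ n) x = peval f x ^ n"
  by (induction n) auto

lemma peval_uminus [simp]: "peval (- f) x = - peval f x"
  using peval_add[of f "- f" x] by (simp add: add_eq_0_iff del: peval_add)

lemma peval_diff [simp]: "peval (f - g) x = peval f x - peval g x"
  using peval_add[of f "- g" x] by (simp del: peval_add)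

lemma peval_scale [simp]: "peval (mpoly_scale c f) x = c * peval f x"
  by (simp add: mpoly_scale_def)

lemma lookup_mpoly_scale [simp]: "Poly_Mapping.lookup (mpoly_scale c f) m = c * Poly_Mapping.lookup f m"
  unfolding mpoly_scale_def mult_map_scale_conv_mult [symmetric] by (simp add: map.rep_eq when_def)

definition mdeg :: "(nat \<Rightarrow>\<^sub>0 nat) \<Rightarrow> nat" where
  "mdeg m = (\<Sum>i\<in>Poly_Mapping.keys m. Poly_Mapping.lookup m i)"

lemma mdeg_superset:
  "finite S \<Longrightarrow> Poly_Mapping.keys m \<subseteq> S \<Longrightarrow> mdeg m = (\<Sum>i\<in>S. Poly_Mapping.lookup m i)"
  unfolding mdeg_def by (rule sum.mono_neutral_left) (auto simp: in_keys_iff)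

lemma mdeg_add: "mdeg (m + n) = mdeg m + mdeg n"
proof -
  let ?S = "Poly_Mapping.keys m \<union> Poly_Mapping.keys n"
  have "mdeg (m + n) = (\<Sum>i\<in>?S. Poly_Mapping.lookup (m + n) i)"
    using keys_add[of m n] by (intro mdeg_superset) auto
  thus ?thesis by (simp add: lookup_add sum.distrib mdeg_superset[symmetric])
qed

lemma mdeg_single [simp]: "mdeg (Poly_Mapping.single i e) = e"
  by (subst mdeg_superset[of "{i}"]) (auto split: if_splits)

lemma mdeg_eq_0_iff: "mdeg m = 0 \<longleftrightarrow> m = 0"
proof
  assume "mdeg m = 0"
  hence "Poly_Mapping.lookup m i = 0" for i
    by (cases "i \<in> Poly_Mapping.keys m") (auto simp: mdeg_def in_keys_iff)
  thus "m = 0" by (intro poly_mapping_eqI) simp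
qed (simp add: mdeg_def)

definition mons :: "nat \<Rightarrow> nat \<Rightarrow> (nat \<Rightarrow>\<^sub>0 nat) set" where
  "mons N d = {m. Poly_Mapping.keys m \<subseteq> {..<N} \<and> mdeg m = d}"

lemma mem_forms_iff: "f \<in> forms N d \<longleftrightarrow> Poly_Mapping.keys f \<subseteq> mons N d"
  by (auto simp: forms_def mpoly_ring_def mons_def mdeg_def)

lemma mons_split:
  assumes "m \<in> mons N (Suc d)"
  obtains i n where "i < N" "n \<in> mons N d" "m = Poly_Mapping.single i 1 + n"
proof -
  have m: "Poly_Mapping.keys m \<subseteq> {..<N}" "mdeg m = Suc d" using assms by (auto simp: mons_def)
  have "Poly_Mapping.keys m \<noteq> {}" using m(2) by (auto simp: mdeg_def)
  then obtain i where i: "i \<in> Poly_Mapping.keys m" by blast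
  define n where "n = Poly_Mapping.update i (Poly_Mapping.lookup m i - 1) m"
  have eq: "m = Poly_Mapping.single i 1 + n"
    using i by (intro poly_mapping_eqI)
      (auto simp: n_def lookup_add lookup_update lookup_single when_def in_keys_iff)
  moreover have "Poly_Mapping.keys n \<subseteq> {..<N}"
    using m i unfolding n_def keys_update by auto
  moreover have "mdeg n = d" using m(2) unfolding eq mdeg_add by simp
  moreover have "i < N" using i m by auto
  ultimately show ?thesis using that unfolding mons_def by blast
qed

lemma mons_add: "m \<in> mons N d \<Longrightarrow> n \<in> mons N e \<Longrightarrow> m + n \<in> mons N (d + e)"
  using keys_add[of m n] by (auto simp: mons_def mdeg_add)

lemma single_mem_mons: "i < N \<Longrightarrow> Poly_Mapping.single i 1 \<in> mons N 1"
  by (simp add: mons_def)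

lemma subspace_forms: "mpoly.subspace (forms N d)"
proof -
  have e: "forms N d = {f. Poly_Mapping.keys f \<subseteq> mons N d}" using mem_forms_iff by blast
  show ?thesis
  proof (rule mpoly.subspaceI)
    show "f + g \<in> forms N d" if "f \<in> forms N d" "g \<in> forms N d" for f g
      using that keys_add[of f g] unfolding e by auto
  qed (auto simp: e in_keys_iff subset_iff)
qed

section \<open>Forms and ideals\<close>

lemma forms_add: "f \<in> forms N d \<Longrightarrow> g \<in> forms N d \<Longrightarrow> f + g \<in> forms N d"
  by (rule mpoly.subspace_add[OF subspace_forms])

lemma forms_diff: "f \<in> forms N d \<Longrightarrow> g \<in> forms N d \<Longrightarrow> f - g \<in> forms N d"
  by (rule mpoly.subspace_diff[OF subspace_forms])

lemma forms_scale: "f \<in> forms N d \<Longrightarrow> mpoly_scale c f \<in> forms N d"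
  by (rule mpoly.subspace_scale[OF subspace_forms])

lemma forms_sum: "(\<And>i. i \<in> A \<Longrightarrow> f i \<in> forms N d) \<Longrightarrow> sum f A \<in> forms N d"
  by (rule mpoly.subspace_sum[OF subspace_forms])

lemma forms_zero [simp]: "0 \<in> forms N d"
  by (rule mpoly.subspace_0[OF subspace_forms])

lemma forms_mult:
  assumes "f \<in> forms N d" "g \<in> forms N e" shows "f * g \<in> forms N (d + e)"
  unfolding mem_forms_iff
proof
  fix m assume "m \<in> Poly_Mapping.keys (f * g)"
  then obtain a b where "m = a + b" "a \<in> Poly_Mapping.keys f" "b \<in> Poly_Mapping.keys g"
    using keys_mult[of f g] by blast
  thus "m \<in> mons N (d + e)" using assms unfolding mem_forms_iff by (blast intro: mons_add)
qed

lemma forms_one [simp]: "1 \<in> forms N 0"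
  by (auto simp: mem_forms_iff mons_def mdeg_def)

lemma forms_power: "f \<in> forms N d \<Longrightarrow> f ^ n \<in> forms N (n * d)"
  by (induction n) (auto intro: forms_mult)

lemma forms_power1: "f \<in> forms N 1 \<Longrightarrow> f ^ n \<in> forms N n"
  using forms_power[of f N 1 n] by simp

lemma forms_mult': "f \<in> forms N d \<Longrightarrow> g \<in> forms N e \<Longrightarrow> k = d + e \<Longrightarrow> f * g \<in> forms N k"
  using forms_mult by blast

lemma forms_var: "i < N \<Longrightarrow> mpoly_var i \<in> forms N 1"
  unfolding mem_forms_iff mpoly_var_def using single_mem_mons by simp

lemma forms_single: "m \<in> mons N d \<Longrightarrow> Poly_Mapping.single m c \<in> forms N d"
  by (simp add: mem_forms_iff)

lemma forms_subset_mpoly_ring: "f \<in> forms N d \<Longrightarrow> f \<in> mpoly_ring N"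
  by (simp add: forms_def)

lemma mpoly_ring_add: "f \<in> mpoly_ring N \<Longrightarrow> g \<in> mpoly_ring N \<Longrightarrow> f + g \<in> mpoly_ring N"
  using keys_add[of f g] by (auto simp: mpoly_ring_def)

lemma mpoly_ring_mult:
  assumes "f \<in> mpoly_ring N" "g \<in> mpoly_ring N" shows "f * g \<in> mpoly_ring N"
  unfolding mpoly_ring_def
proof (intro CollectI ballI)
  fix m assume "m \<in> Poly_Mapping.keys (f * g)"
  then obtain a b where "m = a + b" "a \<in> Poly_Mapping.keys f" "b \<in> Poly_Mapping.keys g"
    using keys_mult[of f g] by blast
  moreover from this have "Poly_Mapping.keys a \<subseteq> {..<N}" "Poly_Mapping.keys b \<subseteq> {..<N}"
    using assms by (auto simp: mpoly_ring_def)
  ultimately show "Poly_Mapping.keys m \<subseteq> {..<N}" using keys_add[of a b] by blast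
qed

text \<open>Every monomial of positive degree contains a variable, so forms of degree
  \<open>d + 1\<close> are sums of products \<open>mpoly_var i * g\<close> with \<open>g\<close> of
  degree \<open>d\<close>. With this rule later inductions on the degree can avoid
  monomials.\<close>

lemma forms_Suc_induct [consumes 1, case_names zero add var]:
  assumes f: "f \<in> forms N (Suc d)" and P0: "P 0"
    and add: "\<And>f g. P f \<Longrightarrow> P g \<Longrightarrow> P (f + g)"
    and var: "\<And>i g. i < N \<Longrightarrow> g \<in> forms N d \<Longrightarrow> P (mpoly_var i * g)"
  shows "P f"
proof -
  have sum: "P (sum h A)" if "\<And>a. a \<in> A \<Longrightarrow> P (h a)" for h and A :: "(nat \<Rightarrow>\<^sub>0 nat) set"
    using that by (induction A rule: infinite_finite_induct) (auto intro: P0 add)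
  have "P (Poly_Mapping.single m c)" if "m \<in> mons N (Suc d)" for m c
  proof -
    obtain i n where n: "i < N" "n \<in> mons N d" "m = Poly_Mapping.single i 1 + n"
      using mons_split[OF \<open>m \<in> mons N (Suc d)\<close>] by blast
    have "Poly_Mapping.single m c = mpoly_var i * Poly_Mapping.single n c"
      by (simp add: n(3) mpoly_var_def mult_single)
    thus ?thesis using var[OF n(1) forms_single[OF n(2)]] by simp
  qed
  moreover have "Poly_Mapping.keys f \<subseteq> mons N (Suc d)" using f by (simp add: mem_forms_iff)
  ultimately show ?thesis
    by (subst poly_mapping_eq_sum_single[of f]) (rule sum, blast)
qed

lemma forms_0_iff: "f \<in> forms N 0 \<longleftrightarrow> (\<exists>c. f = mpoly_scale c 1)"
proof
  assume "f \<in> forms N 0"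
  hence "Poly_Mapping.keys f \<subseteq> {0}" by (auto simp: mem_forms_iff mons_def mdeg_eq_0_iff)
  hence "f = mpoly_scale (Poly_Mapping.lookup f 0) 1"
    by (intro poly_mapping_eqI) (auto simp: lookup_one when_def in_keys_iff)
  thus "\<exists>c. f = mpoly_scale c 1" ..
qed (auto intro: forms_scale)

lemma scale_mult_left: "mpoly_scale c (f * g) = mpoly_scale c f * g"
  and scale_mult_right: "mpoly_scale c (f * g) = f * mpoly_scale c g"
  by (simp_all add: mpoly_scale_def mult_ac)

lemma forms_1_lincomb:
  assumes "f \<in> forms N 1"
  obtains a where "f = (\<Sum>k<N. mpoly_scale (a k) (mpoly_var k))"
proof -
  have "f \<in> forms N (Suc 0)" using assms by simp
  hence "\<exists>a. f = (\<Sum>k<N. mpoly_scale (a k) (mpoly_var k))"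
  proof (induction rule: forms_Suc_induct)
    case zero
    show ?case by (intro exI[of _ "\<lambda>_. 0"]) simp
  next
    case (add f g)
    then obtain a b where "f = (\<Sum>k<N. mpoly_scale (a k) (mpoly_var k))"
      "g = (\<Sum>k<N. mpoly_scale (b k) (mpoly_var k))" by blast
    thus ?case by (intro exI[of _ "\<lambda>k. a k + b k"]) (simp add: mpoly.scale_left_distrib sum.distrib)
  next
    case (var i g)
    then obtain c where "g = mpoly_scale c 1" by (auto simp: forms_0_iff)
    moreover have "(\<Sum>k<N. mpoly_scale (if k = i then c else 0) (mpoly_var k)) = mpoly_scale c (mpoly_var i)"
      using var by (simp add: if_distrib[of "\<lambda>c. mpoly_scale c _"] cong: if_cong)
    ultimately show ?case
      by (intro exI[of _ "\<lambda>k. if k = i then c else 0"]) (simp add: scale_mult_right[symmetric])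
  qed
  thus ?thesis using that by blast
qed

lemma finite_mons: "finite (mons N d)"
proof (rule inj_on_finite)
  let ?h = "\<lambda>m. restrict (Poly_Mapping.lookup m) {..<N}"
  show "inj_on ?h (mons N d)"
  proof (rule inj_onI, rule poly_mapping_eqI)
    fix m n i assume mn: "m \<in> mons N d" "n \<in> mons N d" "?h m = ?h n"
    show "Poly_Mapping.lookup m i = Poly_Mapping.lookup n i"
    proof (cases "i < N")
      case True
      thus ?thesis using fun_cong[OF mn(3), of i] by simp
    next
      case False
      hence "i \<notin> Poly_Mapping.keys m" "i \<notin> Poly_Mapping.keys n" using mn by (auto simp: mons_def)
      thus ?thesis by (simp add: in_keys_iff)
    qed
  qed
  have "Poly_Mapping.lookup m i \<le> mdeg m" for m i
  proof (cases "i \<in> Poly_Mapping.keys m")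
    case True
    thus ?thesis unfolding mdeg_def by (intro member_le_sum) auto
  qed (simp add: in_keys_iff)
  thus "?h ` mons N d \<subseteq> (\<Pi>\<^sub>E i\<in>{..<N}. {..d})"
    by (intro image_subsetI) (auto simp: restrict_PiE_iff mons_def)
  show "finite (\<Pi>\<^sub>E i\<in>{..<N}. {..d})" by (intro finite_PiE) auto
qed

lemma forms_basis:
  defines "B \<equiv> \<lambda>N d. (\<lambda>m. Poly_Mapping.single m (1::complex)) ` mons N d"
  shows "finite (B N d)" "card (B N d) = card (mons N d)" "mpoly.independent (B N d)"
    "mpoly.span (B N d) = forms N d"
proof -
  have inj: "inj_on (\<lambda>m. Poly_Mapping.single m (1::complex)) (mons N d)"
    by (auto simp: inj_on_def dest!: arg_cong[of _ _ Poly_Mapping.keys])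
  show fin: "finite (B N d)" unfolding B_def using finite_mons by simp
  show "card (B N d) = card (mons N d)" unfolding B_def using inj by (rule card_image)
  show "mpoly.independent (B N d)"
  proof (rule mpoly.independent_if_scalars_zero[OF fin])
    fix g x assume g: "(\<Sum>x\<in>B N d. mpoly_scale (g x) x) = 0" and "x \<in> B N d"
    then obtain m where m: "m \<in> mons N d" "x = Poly_Mapping.single m 1" by (auto simp: B_def)
    have "0 = Poly_Mapping.lookup (\<Sum>x\<in>B N d. mpoly_scale (g x) x) m" by (simp add: g)
    also have "\<dots> = (\<Sum>n\<in>mons N d. if n = m then g x else 0)"
      unfolding B_def lookup_sum sum.reindex[OF inj] o_def
      by (rule sum.cong) (auto simp: lookup_single when_def m)
    also have "\<dots> = g x" using m finite_mons by simp
    finally show "g x = 0" ..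
  qed
  show "mpoly.span (B N d) = forms N d"
  proof
    show "mpoly.span (B N d) \<subseteq> forms N d"
      by (rule mpoly.span_minimal[OF _ subspace_forms]) (auto simp: B_def intro: forms_single)
    show "forms N d \<subseteq> mpoly.span (B N d)"
    proof
      fix f assume f: "f \<in> forms N d"
      have "mpoly_scale (Poly_Mapping.lookup f m) (Poly_Mapping.single m 1) \<in> mpoly.span (B N d)"
        if "m \<in> Poly_Mapping.keys f" for m
        using that f by (intro mpoly.span_scale mpoly.span_base) (auto simp: B_def mem_forms_iff)
      moreover have "mpoly_scale (Poly_Mapping.lookup f m) (Poly_Mapping.single m 1)
          = Poly_Mapping.single m (Poly_Mapping.lookup f m)" for m
        by (simp add: mpoly_scale_def mult_single)
      ultimately show "f \<in> mpoly.span (B N d)"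
        by (subst poly_mapping_eq_sum_single[of f]) (auto intro: mpoly.span_sum)
    qed
  qed
qed

lemma dim_forms: "mpoly.dim (forms N d) = card (mons N d)"
  using forms_basis[where N = N and d = d] mpoly.dim_span_eq_card_independent by metis

lemma card_mons_2: "card (mons N 2) = N * (N + 1) div 2"
proof -
  \<comment> \<open>Pairs \<open>(j, i)\<close> with \<open>i \<le> j < N\<close>; the ordered pair
    is recovered from the support \<open>{i, j}\<close> of the monomial.\<close>
  let ?A = "SIGMA j:{..<N}. {..j}"
  have "bij_betw (\<lambda>(j, i). Poly_Mapping.single i 1 + Poly_Mapping.single j 1) ?A (mons N 2)"
    unfolding bij_betw_def
  proof (intro conjI inj_onI equalityI subsetI)
    have keys: "Poly_Mapping.keys (Poly_Mapping.single i 1 + Poly_Mapping.single j (1::nat)) = {i, j}" for i j :: nat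
      by (auto simp: in_keys_iff lookup_add lookup_single when_def split: if_splits)
    fix x y assume xy: "x \<in> ?A" "y \<in> ?A"
      "(case x of (j, i) \<Rightarrow> Poly_Mapping.single i 1 + Poly_Mapping.single j (1::nat)) =
       (case y of (j, i) \<Rightarrow> Poly_Mapping.single i 1 + Poly_Mapping.single j 1)"
    obtain a b c d where [simp]: "x = (a, b)" "y = (c, d)" by (cases x, cases y) auto
    have "{b, a} = {d, c}" using arg_cong[OF xy(3), of Poly_Mapping.keys] unfolding \<open>x = _\<close> \<open>y = _\<close> prod.case keys .
    thus "x = y" using xy(1,2) by (auto simp: doubleton_eq_iff)
  next
    fix m :: "nat \<Rightarrow>\<^sub>0 nat"
    assume "m \<in> (\<lambda>(j, i). Poly_Mapping.single i 1 + Poly_Mapping.single j 1) ` ?A"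
    then obtain i j where "m = Poly_Mapping.single i 1 + Poly_Mapping.single j 1" "i \<le> j" "j < N" by auto
    thus "m \<in> mons N 2" using mons_add[of "Poly_Mapping.single i 1" N 1 "Poly_Mapping.single j 1" 1]
      single_mem_mons[of i N] single_mem_mons[of j N] by (simp add: numeral_2_eq_2)
  next
    fix m assume "m \<in> mons N 2"
    hence "m \<in> mons N (Suc 1)" by (simp add: numeral_2_eq_2)
    then obtain i n where i: "i < N" "n \<in> mons N 1" "m = Poly_Mapping.single i 1 + n"
      using mons_split by blast
    from i(2) have "n \<in> mons N (Suc 0)" by simp
    then obtain j k where j: "j < N" "k \<in> mons N 0" "n = Poly_Mapping.single j 1 + k"
      using mons_split by blast
    have "k = 0" using j(2) by (simp add: mons_def mdeg_eq_0_iff)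
    hence m: "m = Poly_Mapping.single i 1 + Poly_Mapping.single j 1" using i j by simp
    show "m \<in> (\<lambda>(j, i). Poly_Mapping.single i 1 + Poly_Mapping.single j 1) ` ?A"
    proof (cases "i \<le> j")
      case True
      thus ?thesis using m j by (intro image_eqI[of _ _ "(j, i)"]) auto
    next
      case False
      thus ?thesis using m i by (intro image_eqI[of _ _ "(i, j)"]) (auto simp: add.commute)
    qed
  qed
  hence "card (mons N 2) = card ?A" by (simp add: bij_betw_same_card)
  also have "\<dots> = (\<Sum>j<N. Suc j)" by simp
  also have "\<dots> = N * (N + 1) div 2"
    by (induction N) auto
  finally show ?thesis .
qed

lemma mons_less: "m \<in> mons N d \<Longrightarrow> i \<in> Poly_Mapping.keys m \<Longrightarrow> i < N"
  by (auto simp: mons_def)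

lemma peval_cong:
  assumes "f \<in> forms N d" "\<And>i. i < N \<Longrightarrow> x i = y i"
  shows "peval f x = peval f y"
  unfolding peval_def mon_def using assms
  by (intro sum.cong prod.cong refl arg_cong2[of _ _ _ _ "(*)"] arg_cong2[of _ _ _ _ "(^)"])
     (auto simp: mem_forms_iff dest!: mons_less subsetD)

lemma peval_homogeneous:
  assumes "f \<in> forms N d" shows "peval f (\<lambda>i. c * x i) = c ^ d * peval f x"
proof -
  have "mon (\<lambda>i. c * x i) m = c ^ mdeg m * mon x m" for m
    by (simp add: mon_def mdeg_def power_mult_distrib prod.distrib power_sum)
  thus ?thesis using assms
    unfolding peval_def sum_distrib_left
    by (intro sum.cong) (auto simp: mem_forms_iff mons_def mult_ac dest!: subsetD)
qed

lemma ideal_gen_base: "q \<in> Q \<Longrightarrow> q \<in> ideal_gen N Q"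
  unfolding ideal_gen_def
  by (intro CollectI exI[of _ "{q}"] exI[of _ "\<lambda>_. 1"])
     (auto intro: forms_subset_mpoly_ring[OF forms_one])

lemma ideal_gen_zero: "0 \<in> ideal_gen N Q"
  unfolding ideal_gen_def by (intro CollectI exI[of _ "{}"]) auto

lemma ideal_gen_add:
  assumes "f \<in> ideal_gen N Q" "g \<in> ideal_gen N Q"
  shows "f + g \<in> ideal_gen N Q"
proof -
  obtain F a where F: "f = (\<Sum>q\<in>F. a q * q)" "finite F" "F \<subseteq> Q" "\<forall>q\<in>F. a q \<in> mpoly_ring N"
    using assms(1) unfolding ideal_gen_def by blast
  obtain G b where G: "g = (\<Sum>q\<in>G. b q * q)" "finite G" "G \<subseteq> Q" "\<forall>q\<in>G. b q \<in> mpoly_ring N"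
    using assms(2) unfolding ideal_gen_def by blast
  let ?a = "\<lambda>q. if q \<in> F then a q else 0" and ?b = "\<lambda>q. if q \<in> G then b q else 0"
  have "f = (\<Sum>q\<in>F \<union> G. ?a q * q)" unfolding F
    by (rule sum.mono_neutral_cong_left) (use F G in auto)
  moreover have "g = (\<Sum>q\<in>F \<union> G. ?b q * q)" unfolding G
    by (rule sum.mono_neutral_cong_left) (use F G in auto)
  ultimately have "f + g = (\<Sum>q\<in>F \<union> G. (?a q + ?b q) * q)"
    by (simp only: sum.distrib distrib_right)
  moreover have "\<forall>q\<in>F \<union> G. ?a q + ?b q \<in> mpoly_ring N"
    using F G by (auto intro: mpoly_ring_add)
  ultimately show ?thesis using F G unfolding ideal_gen_def
    by (intro CollectI exI[of _ "F \<union> G"] exI[of _ "\<lambda>q. ?a q + ?b q"]) auto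
qed

lemma ideal_gen_mult:
  assumes "r \<in> mpoly_ring N" "f \<in> ideal_gen N Q"
  shows "r * f \<in> ideal_gen N Q"
proof -
  obtain F a where F: "f = (\<Sum>q\<in>F. a q * q)" "finite F" "F \<subseteq> Q" "\<forall>q\<in>F. a q \<in> mpoly_ring N"
    using assms(2) unfolding ideal_gen_def by blast
  have "r * f = (\<Sum>q\<in>F. (r * a q) * q)" unfolding F by (simp add: sum_distrib_left mult.assoc)
  thus ?thesis using F assms(1) unfolding ideal_gen_def
    by (intro CollectI exI[of _ F] exI[of _ "\<lambda>q. r * a q"]) (auto intro: mpoly_ring_mult)
qed

lemma ideal_gen_span: "mpoly.span Q \<subseteq> ideal_gen N Q"
proof (rule mpoly.span_minimal)
  show "mpoly.subspace (ideal_gen N Q)"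
    unfolding mpoly.subspace_def
  proof (intro conjI ballI allI)
    fix c f assume "f \<in> ideal_gen N Q"
    moreover have "mpoly_scale c 1 \<in> mpoly_ring N"
      using forms_0_iff forms_subset_mpoly_ring by blast
    ultimately have "mpoly_scale c 1 * f \<in> ideal_gen N Q" by (rule ideal_gen_mult[rotated])
    thus "mpoly_scale c f \<in> ideal_gen N Q" by (simp add: scale_mult_left[symmetric])
  qed (auto intro: ideal_gen_add ideal_gen_zero)
qed (auto intro: ideal_gen_base)

lemma ideal_gen_vanish:
  "f \<in> ideal_gen N Q \<Longrightarrow> (\<And>q. q \<in> Q \<Longrightarrow> peval q x = 0) \<Longrightarrow> peval f x = 0"
proof -
  assume f: "f \<in> ideal_gen N Q" and q: "\<And>q. q \<in> Q \<Longrightarrow> peval q x = 0"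
  obtain F a where F: "f = (\<Sum>q\<in>F. a q * q)" "F \<subseteq> Q"
    using f unfolding ideal_gen_def by blast
  have "peval f x = (\<Sum>q\<in>F. peval (a q) x * peval q x)" by (simp add: F(1))
  also have "\<dots> = 0" using F(2) q by (intro sum.neutral) auto
  finally show ?thesis .
qed

context theta_curve begin

section \<open>Restriction of forms to the curve\<close>

text \<open>The coordinates are the \<open>th k\<close> rather than the theta series, so that forms
  of degree \<open>d\<close> become theta functions with multiplier \<open>c0 ^ d\<close>. The
  common nonzero factor does not affect the point of projective space.\<close>

definition pullback :: "mpoly \<Rightarrow> complex \<Rightarrow> complex" where
  "pullback f z = peval f (\<lambda>k. th (int k) z)"

lemma pullback_simps [simp]:
  "pullback 0 z = 0" "pullback 1 z = 1"
  "pullback (f + g) z = pullback f z + pullback g z"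
  "pullback (f - g) z = pullback f z - pullback g z"
  "pullback (f * g) z = pullback f z * pullback g z"
  "pullback (f ^ n) z = pullback f z ^ n"
  "pullback (mpoly_scale c f) z = c * pullback f z"
  "pullback (mpoly_var i) z = th (int i) z"
  "pullback (sum h A) z = (\<Sum>a\<in>A. pullback (h a) z)"
  by (simp_all add: pullback_def)

lemma pullback_tf: "f \<in> forms N d \<Longrightarrow> pullback f \<in> tf (int (d * N)) (c0 ^ d)"
proof (induction d arbitrary: f)
  case 0
  then obtain c where "f = mpoly_scale c 1" by (auto simp: forms_0_iff)
  thus ?case by (auto intro!: tfI simp: holomorphic_on_const)
next
  case (Suc d)
  from Suc.prems show ?case
  proof (induction rule: forms_Suc_induct)
    case zero
    have "pullback 0 = (\<lambda>z. 0)" by (rule ext) simp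
    thus ?case by (simp add: tf_0)
  next
    case (add f g)
    have "pullback (f + g) = (\<lambda>z. pullback f z + pullback g z)" by (rule ext) simp
    thus ?case using add by (simp add: tf_add)
  next
    case (var i g)
    have "pullback (mpoly_var i * g) = (\<lambda>z. th (int i) z * pullback g z)" by (rule ext) simp
    thus ?case using tf_mult'[OF th_tf Suc.IH[OF var(2)]] by simp
  qed
qed

lemma pullback_holomorphic: "f \<in> forms N d \<Longrightarrow> pullback f holomorphic_on UNIV"
  using pullback_tf tf_holomorphic by blast

lemma ex_linear_form:
  assumes "g \<in> tf (int N) c0"
  obtains l where "l \<in> forms N 1" "pullback l = g"
proof -
  obtain a where a: "\<And>z. g z = (\<Sum>k<N. a k * th (int k) z)"
    using tf_theta_coeffs[OF assms] by blast
  let ?l = "\<Sum>k<N. mpoly_scale (a k) (mpoly_var k)"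
  have "?l \<in> forms N 1" by (intro forms_sum forms_scale forms_var) auto
  moreover have "pullback ?l = g" by (rule ext) (simp add: a)
  ultimately show ?thesis by (rule that)
qed

section \<open>The homogeneous ideal of the curve, degree by degree\<close>

definition curve_forms :: "nat \<Rightarrow> mpoly set" where
  "curve_forms d = {f \<in> forms N d. \<forall>z. pullback f z = 0}"

text \<open>Linear independence of the \<open>th k\<close> means that the curve lies in no
  hyperplane.\<close>

lemma curve_forms_1: "curve_forms 1 = {0}"
proof -
  have "f = 0" if f: "f \<in> forms N 1" and f0: "\<And>z. pullback f z = 0" for f
  proof -
    obtain a where a: "f = (\<Sum>k<N. mpoly_scale (a k) (mpoly_var k))"
      using forms_1_lincomb[OF f] by blast
    have "(\<Sum>k<N. a k * th (int k) z) = 0" for z using f0[of z] by (simp add: a)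
    hence "a k = 0" if "k < N" for k using th_independent that by blast
    thus ?thesis by (simp add: a)
  qed
  thus ?thesis by (auto simp: curve_forms_def)
qed

lemma curve_forms_0: "curve_forms 0 = {0}"
  by (auto simp: curve_forms_def forms_0_iff)

lemma th_base_point_free: "\<exists>k<N. th (int k) z \<noteq> 0"
proof (rule ccontr)
  assume *: "\<not> ?thesis"
  obtain u where "u \<in> tf (int N) c0" "u z \<noteq> 0"
    using tf_ex_nonvanishing[of N c0 z] N_ge_4 by auto
  moreover obtain a where "\<And>z. u z = (\<Sum>k<N. a k * th (int k) z)"
    using tf_theta_coeffs[OF \<open>u \<in> _\<close>] by blast
  ultimately show False using * by (simp add: sum.neutral)
qed

lemma tf_common_zero_free_pair:
  assumes "n \<ge> 2" "c \<noteq> 0"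
  obtains u v where "u \<in> tf (int n) c" "v \<in> tf (int n) c" "u 0 \<noteq> 0" "\<And>z. u z = 0 \<Longrightarrow> v z \<noteq> 0"
proof -
  obtain u where u: "u \<in> tf (int n) c" "u 0 \<noteq> 0"
    using tf_ex_nonvanishing[OF assms] by blast
  obtain A where A: "finite A" "\<And>z. u z = 0 \<Longrightarrow> \<exists>a\<in>A. z - a \<in> lattice \<tau>"
    using tf_finite_zeros[OF u(1) assms(2) u(2)] by blast
  have "\<exists>v\<in>tf (int n) c. \<forall>a\<in>A. v a \<noteq> 0"
    by (rule tf_ex_nonvanishing_finite[OF _ tf_0 A(1)])
       (auto intro: tf_add tf_scale tf_ex_nonvanishing[OF assms])
  then obtain v where v: "v \<in> tf (int n) c" "\<And>a. a \<in> A \<Longrightarrow> v a \<noteq> 0" by blast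
  have "v z \<noteq> 0" if "u z = 0" for z
    using A(2)[OF that] v tf_eq_0_lattice[OF v(1) assms(2)] by blast
  thus ?thesis using that u v by blast
qed

text \<open>The pencil is taken with the base point \<open>0\<close>: a pencil without base points would only fill
  a hyperplane of the target for \<open>d = 1\<close>.\<close>

lemma pullback_surj:
  assumes "d \<ge> 1" "G \<in> tf (int (d * N)) (c0 ^ d)"
  shows "\<exists>f \<in> forms N d. pullback f = G"
  using assms
proof (induction d arbitrary: G rule: nat_induct_at_least)
  case base
  hence "G \<in> tf (int N) c0" by simp
  thus ?case using ex_linear_form by blast
next
  case (Suc d)
  \<comment> \<open>The multiplier that remains when a factor \<open>sig z\<close>, of multiplier
    \<open>- 1\<close>, is split off from a section of multiplier \<open>c0\<close>.\<close>
  define b where "b = - c0"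
  obtain v where v: "v \<in> tf (int N) c0" "v 0 \<noteq> 0"
    using tf_ex_nonvanishing[of N c0 0] N_ge_4 by auto
  obtain V where V: "V \<in> forms N 1" "pullback V = v" using ex_linear_form[OF v(1)] by blast
  have VS: "V ^ Suc d \<in> forms N (Suc d)" by (rule forms_power1[OF V(1)])
  \<comment> \<open>Products with members of the pencil vanish at \<open>0\<close>. The value of
    \<open>G\<close> there is accounted for separately, by a power of a linear form that is nonzero
    at \<open>0\<close>.\<close>
  define t where "t = G 0 / v 0 ^ Suc d"
  have "(\<lambda>z. G z - t * pullback (V ^ Suc d) z) \<in> tf (int (Suc d * N)) (c0 ^ Suc d)"
    by (intro tf_diff tf_scale Suc.prems pullback_tf VS)
  then obtain H where H: "H \<in> tf (int (Suc d * N) - 1) (c0 ^ Suc d / (- ee 0))"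
      "\<And>z. G z - t * pullback (V ^ Suc d) z = sig (z - 0) * H z"
    by (rule tf_divide_sig[where a = 0]) (use v V in \<open>auto simp: t_def\<close>)
  have n2: "N - 1 \<ge> 2" using N_ge_4 by simp
  have b0: "b \<noteq> 0" by (simp add: b_def)
  obtain u1 u2 where u: "u1 \<in> tf (int (N - 1)) b" "u2 \<in> tf (int (N - 1)) b" "u1 0 \<noteq> 0"
      "\<And>z. u1 z = 0 \<Longrightarrow> u2 z \<noteq> 0"
    by (rule tf_common_zero_free_pair[OF n2 b0]) (rule that)
  have "H \<in> tf (int (N - 1) + int (d * N)) (b * c0 ^ d)"
    using H(1) N_ge_4 by (simp add: b_def of_nat_diff algebra_simps)
  moreover have "d * N \<ge> N - 1 + 1" using Suc.hyps N_ge_4 by simp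
  moreover have "b \<noteq> 0" by (simp add: b_def)
  ultimately obtain g1 g2 where g: "g1 \<in> tf (int (N - 1) + int (d * N) - int (N - 1)) (b * c0 ^ d / b)"
      "g2 \<in> tf (int (d * N)) (c0 ^ d)" "\<And>z. H z = u1 z * g1 z + u2 z * g2 z"
    using tf_pencil[OF u(1) _ u(3) u(2) _ u(4), of H "d * N" "c0 ^ d"] by auto
  have "g1 \<in> tf (int (d * N)) (c0 ^ d)" using g(1) \<open>b \<noteq> 0\<close> by simp
  then obtain G1 where G1: "G1 \<in> forms N d" "pullback G1 = g1" using Suc.IH by blast
  obtain G2 where G2: "G2 \<in> forms N d" "pullback G2 = g2" using Suc.IH g by blast
  have su: "(\<lambda>z. sig (z - 0) * u z) \<in> tf (int N) c0" if "u \<in> tf (int (N - 1)) b" for u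
    by (rule tf_mult'[OF sig_tf that]) (use N_ge_4 in \<open>auto simp: b_def\<close>)
  obtain L1 where L1: "L1 \<in> forms N 1" "pullback L1 = (\<lambda>z. sig (z - 0) * u1 z)"
    using ex_linear_form[OF su[OF u(1)]] by blast
  obtain L2 where L2: "L2 \<in> forms N 1" "pullback L2 = (\<lambda>z. sig (z - 0) * u2 z)"
    using ex_linear_form[OF su[OF u(2)]] by blast
  let ?f = "mpoly_scale t (V ^ Suc d) + L1 * G1 + L2 * G2"
  have "?f \<in> forms N (Suc d)"
    by (intro forms_add forms_scale VS forms_mult'[OF L1(1) G1(1)] forms_mult'[OF L2(1) G2(1)]) auto
  moreover have "pullback ?f z = G z" for z
    using H(2)[of z] by (simp add: L1 L2 G1 G2 g(3) algebra_simps)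
  ultimately show ?case by (intro bexI[of _ ?f]) auto
qed

lemma linear_pullback: "Vector_Spaces.linear mpoly_scale fscale pullback"
  by (simp add: Vector_Spaces.linear_iff fn.vector_space_axioms mpoly.vector_space_axioms
      fscale_def fun_eq_iff)

text \<open>By projective normality (\<open>pullback_surj\<close>) restriction to the curve has the
  full space of theta functions of degree \<open>d * N\<close> as image, and rank-nullity
  applies.\<close>

lemma dim_curve_forms:
  assumes "d \<ge> 1"
  shows "mpoly.dim (forms N d) = mpoly.dim (curve_forms d) + d * N"
proof -
  interpret pair: vector_space_pair mpoly_scale fscale ..
  have "mpoly.dim (forms N d) = mpoly.dim {x \<in> forms N d. pullback x = 0} + fn.dim (pullback ` forms N d)"
    by (rule pair.dim_kernel_plus_dim_image[OF linear_pullback subspace_forms forms_basis(1)[of N d]])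
       (simp add: forms_basis(4))
  also have "{x \<in> forms N d. pullback x = 0} = curve_forms d"
    by (auto simp: curve_forms_def fun_eq_iff)
  also have "pullback ` forms N d = tf (int (d * N)) (c0 ^ d)"
    using pullback_tf pullback_surj[OF assms] by blast
  also have "fn.dim \<dots> = d * N"
    using assms by (intro dim_tf) (auto simp: Suc_le_eq)
  finally show ?thesis .
qed

lemma dim_curve_forms_2: "mpoly.dim (curve_forms 2) = N * (N - 3) div 2"
proof -
  have "N * (N + 1) div 2 = mpoly.dim (curve_forms 2) + 2 * N"
    using dim_curve_forms[of 2] by (simp add: dim_forms card_mons_2)
  moreover have "N * (N + 1) = N * (N - 3) + 2 * (2 * N)"
  proof -
    have "N = (N - 3) + 3" using N_ge_4 by simp
    then obtain k where "N = k + 3" ..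
    thus ?thesis by (simp add: algebra_simps)
  qed
  hence "N * (N + 1) div 2 = N * (N - 3) div 2 + 2 * N" by simp
  ultimately show ?thesis by simp
qed

section \<open>A hyperplane section consisting of \<open>N\<close> distinct points\<close>

text \<open>Solves Abel's condition for the points \<open>hs i\<close>: the product of the
  \<open>- ee (hs i)\<close> is \<open>ee\<close> of \<open>N * hs_start\<close> plus the sum of the
  \<open>i / N\<close> plus \<open>N / 2\<close>, and it has to equal \<open>c0\<close> for a
  section with exactly these zeros to exist.\<close>

definition hs_start :: complex where
  "hs_start = (SOME s. ee (of_nat N * s) = c0 / ee (of_nat (\<Sum>i<N. i) / of_nat N + of_nat N / 2))"

definition hs :: "nat \<Rightarrow> complex" where
  "hs i = hs_start + of_nat i / of_nat N"

lemma hs_distinct: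
  assumes "i < N" "j < N" "hs i - hs j \<in> lattice \<tau>" shows "i = j"
proof -
  have "hs i - hs j = of_real ((real i - real j) / real N)"
    by (simp add: hs_def diff_divide_distrib)
  then obtain m :: int where m: "(real i - real j) / real N = real_of_int m"
    using real_in_lattice assms(3) by metis
  thus ?thesis by (rule diff_quotient_int[OF assms(1,2)])
qed

lemma prod_ee: "(\<Prod>i\<in>A. ee (f i)) = ee (\<Sum>i\<in>A. f i)"
  by (induction A rule: infinite_finite_induct) (auto simp: ee_add)

lemma prod_hs: "(\<Prod>i<N. - ee (hs i)) = c0"
proof -
  let ?c = "of_nat (\<Sum>i<N. i) / of_nat N + of_nat N / (2::complex)"
  obtain s where "ee s = c0 / ee ?c" using ee_surj[of "c0 / ee ?c"] by auto
  hence "ee (of_nat N * (s / of_nat N)) = c0 / ee ?c" by simp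
  hence s: "ee (of_nat N * hs_start) = c0 / ee ?c"
    unfolding hs_start_def by (rule someI)
  have "(\<Prod>i<N. - ee (hs i)) = ee (\<Sum>i<N. hs i + 1/2)"
    by (simp add: minus_ee prod_ee)
  also have "(\<Sum>i<N. hs i + 1/2) = of_nat N * hs_start + ?c"
    by (simp add: hs_def sum.distrib sum_divide_distrib [symmetric])
  also have "ee \<dots> = c0" by (simp add: ee_add s)
  finally show ?thesis .
qed

definition sigs :: "nat set \<Rightarrow> complex \<Rightarrow> complex" where
  "sigs A z = (\<Prod>i\<in>A. sig (z - hs i))"

lemma sigs_tf: "finite A \<Longrightarrow> sigs A \<in> tf (int (card A)) (\<Prod>i\<in>A. - ee (hs i))"
proof (induction A rule: finite_induct)
  case empty
  show ?case unfolding sigs_def by (intro tfI) auto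
next
  case (insert a A)
  have "sigs (insert a A) = (\<lambda>z. sig (z - hs a) * sigs A z)"
    using insert by (simp add: sigs_def fun_eq_iff)
  thus ?case using tf_mult'[OF sig_tf[of "hs a"] insert.IH] insert by simp
qed

lemma sigs_eq_0_iff:
  assumes "A \<subseteq> {..<N}" "j < N"
  shows "sigs A (hs j) = 0 \<longleftrightarrow> j \<in> A"
proof -
  have "finite A" using assms(1) finite_subset by blast
  hence "sigs A (hs j) = 0 \<longleftrightarrow> (\<exists>i\<in>A. hs j - hs i \<in> lattice \<tau>)"
    by (simp add: sigs_def sig_eq_0_iff)
  thus ?thesis using hs_distinct[OF assms(2)] assms by force
qed

lemma sigs_divide:
  assumes "A \<subseteq> {..<N}" "F \<in> tf m c" "c \<noteq> 0" "\<And>i. i \<in> A \<Longrightarrow> F (hs i) = 0"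
  shows "\<exists>h \<in> tf (m - int (card A)) (c / (\<Prod>i\<in>A. - ee (hs i))). \<forall>z. F z = sigs A z * h z"
proof -
  have "finite A" using assms(1) finite_subset by blast
  from this assms(1,4) show ?thesis
  proof (induction A rule: finite_induct)
    case empty
    thus ?case using assms(2) by (auto simp: sigs_def)
  next
    case (insert a A)
    then obtain h where h: "h \<in> tf (m - int (card A)) (c / (\<Prod>i\<in>A. - ee (hs i)))"
      "\<And>z. F z = sigs A z * h z" by auto
    \<comment> \<open>The points are pairwise inequivalent, so the zero of \<open>F\<close> at
      \<open>hs a\<close> passes to the quotient \<open>h\<close>.\<close>
    have "sigs A (hs a) \<noteq> 0" using sigs_eq_0_iff[of A a] insert by auto
    hence "h (hs a) = 0" using h(2)[of "hs a"] insert.prems by simp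
    then obtain k where k: "k \<in> tf (m - int (card A) - 1) (c / (\<Prod>i\<in>A. - ee (hs i)) / (- ee (hs a)))"
      "\<And>z. h z = sig (z - hs a) * k z"
      using insert assms(3) by (elim tf_divide_sig[OF h(1), rotated]) auto
    have "k \<in> tf (m - int (card (insert a A))) (c / (\<Prod>i\<in>insert a A. - ee (hs i)))"
      using k(1) insert by (simp add: algebra_simps)
    moreover have "F z = sigs (insert a A) z * k z" for z
      using h(2)[of z] k(2)[of z] insert by (simp add: sigs_def)
    ultimately show ?case by blast
  qed
qed

text \<open>Any \<open>N - 1\<close> of the \<open>N\<close> points impose independent conditions on
  linear forms, so modulo \<open>l\<close> there is a basis dual, up to scaling, to the first
  \<open>N - 1\<close> points. The remaining freedom of scaling is spent on the value
  \<open>1\<close> at the last point, which makes all mixed products \<open>Y i * Y j\<close> agree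
  on the hyperplane section.\<close>

lemma ex_hyperplane_basis:
  obtains l Y where "l \<in> forms N 1" "pullback l = sigs {..<N}"
    "\<And>i. i < N - 1 \<Longrightarrow> Y i \<in> forms N 1"
    "\<And>i j. i < N - 1 \<Longrightarrow> j < N - 1 \<Longrightarrow> pullback (Y i) (hs j) = 0 \<longleftrightarrow> i \<noteq> j"
    "\<And>i. i < N - 1 \<Longrightarrow> pullback (Y i) (hs (N - 1)) = 1"
    "\<And>f. f \<in> forms N 1 \<Longrightarrow> \<exists>t b. f = mpoly_scale t l + (\<Sum>i<N-1. mpoly_scale (b i) (Y i))"
proof -
  have "sigs {..<N} \<in> tf (int N) c0" using sigs_tf[of "{..<N}"] prod_hs by simp
  then obtain l where l: "l \<in> forms N 1" "pullback l = sigs {..<N}" using ex_linear_form by blast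
  have "\<exists>y \<in> forms N 1. (\<forall>j<N-1. pullback y (hs j) = 0 \<longleftrightarrow> i \<noteq> j) \<and> pullback y (hs (N - 1)) = 1"
    if i: "i < N - 1" for i
  proof -
    define A where "A = {..<N-1} - {i}"
    define c where "c = c0 / (\<Prod>i\<in>A. - ee (hs i))"
    have A: "A \<subseteq> {..<N}" "card A = N - 2" "finite A" using i by (auto simp: A_def)
    have c: "c \<noteq> 0" by (simp add: c_def A)
    \<comment> \<open>The \<open>N - 2\<close> prescribed zeros in \<open>A\<close> leave degree 2,
      which is just enough to avoid both remaining points.\<close>
    have "\<exists>u\<in>tf (int 2) c. \<forall>a\<in>{hs i, hs (N - 1)}. u a \<noteq> 0"
      by (rule tf_ex_nonvanishing_finite[OF _ tf_0])
         (use tf_ex_nonvanishing[OF _ c, of 2] in \<open>auto intro: tf_add tf_scale\<close>)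
    then obtain u where u: "u \<in> tf (int 2) c" "u (hs i) \<noteq> 0" "u (hs (N - 1)) \<noteq> 0" by auto
    define t where "t = 1 / (sigs A (hs (N - 1)) * u (hs (N - 1)))"
    define y where "y = (\<lambda>z. t * (sigs A z * u z))"
    have "(\<lambda>z. sigs A z * u z) \<in> tf (int N) c0"
      by (rule tf_mult'[OF sigs_tf[OF A(3)] u(1)]) (use N_ge_4 A in \<open>auto simp: c_def\<close>)
    hence "y \<in> tf (int N) c0" unfolding y_def by (rule tf_scale)
    then obtain L where L: "L \<in> forms N 1" "pullback L = y" using ex_linear_form by blast
    have s: "sigs A (hs j) = 0 \<longleftrightarrow> j \<in> A" if "j < N" for j
      by (rule sigs_eq_0_iff[OF A(1) that])
    have t: "t \<noteq> 0" "y (hs (N - 1)) = 1"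
      using s[of "N - 1"] u N_ge_4 by (auto simp: t_def y_def A_def)
    have "y (hs j) = 0 \<longleftrightarrow> i \<noteq> j" if j: "j < N - 1" for j
      using s[of j] j t(1) u(2) by (auto simp: y_def A_def)
    thus ?thesis using L t by (intro bexI[of _ L]) auto
  qed
  then obtain Y where Y: "\<And>i. i < N - 1 \<Longrightarrow> Y i \<in> forms N 1"
    "\<And>i j. i < N - 1 \<Longrightarrow> j < N - 1 \<Longrightarrow> pullback (Y i) (hs j) = 0 \<longleftrightarrow> i \<noteq> j"
    "\<And>i. i < N - 1 \<Longrightarrow> pullback (Y i) (hs (N - 1)) = 1"
    by metis
  have "\<exists>t b. f = mpoly_scale t l + (\<Sum>i<N-1. mpoly_scale (b i) (Y i))" if f: "f \<in> forms N 1" for f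
  proof -
    define b where "b = (\<lambda>i. pullback f (hs i) / pullback (Y i) (hs i))"
    define g where "g = f - (\<Sum>i<N-1. mpoly_scale (b i) (Y i))"
    have g: "g \<in> forms N 1" unfolding g_def by (intro forms_diff f forms_sum forms_scale Y) auto
    have "pullback g \<in> tf (int N) c0" using pullback_tf[OF g] by simp
    moreover have "pullback g (hs j) = 0" if "j \<in> {..<N-1}" for j
    proof -
      have "(\<Sum>i<N-1. b i * pullback (Y i) (hs j)) = (\<Sum>i<N-1. if i = j then pullback f (hs j) else 0)"
        by (rule sum.cong) (use Y(2) that in \<open>auto simp: b_def\<close>)
      thus ?thesis using that by (simp add: g_def)
    qed
    ultimately obtain h where h: "h \<in> tf (int N - int (card {..<N-1})) (c0 / (\<Prod>i<N-1. - ee (hs i)))"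
        "\<And>z. pullback g z = sigs {..<N-1} z * h z"
      using sigs_divide[of "{..<N-1}" "pullback g" "int N" c0] by auto
    have insN: "{..<N} = insert (N - 1) {..<N-1}" using N_ge_4 by auto
    \<comment> \<open>After division by the first \<open>N - 1\<close> zeros the multiplier is that
      of a section of degree 1 with zero \<open>hs (N - 1)\<close>. The last zero is forced, so
      \<open>g\<close> is a multiple of \<open>l\<close>.\<close>
    have "c0 / (\<Prod>i<N-1. - ee (hs i)) = - ee (hs (N - 1))"
      by (simp add: prod_hs[symmetric] insN)
    hence "h \<in> tf 1 (- ee (hs (N - 1)))" using h(1) N_ge_4 by (simp add: of_nat_diff)
    then obtain t where t: "\<And>z. h z = t * sig (z - hs (N - 1))" using tf_degree_1 by blast
    have "pullback g z = t * pullback l z" for z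
      using h(2)[of z] t[of z] by (simp add: l insN sigs_def)
    hence "g - mpoly_scale t l \<in> curve_forms 1"
      using g l by (auto simp: curve_forms_def intro: forms_diff forms_scale)
    hence "g - mpoly_scale t l = 0" unfolding curve_forms_1 by blast
    hence "g = mpoly_scale t l" by simp
    thus ?thesis by (auto simp: g_def algebra_simps)
  qed
  thus ?thesis using that[OF l Y] by blast
qed

end

section \<open>The ideal of the curve is generated by quadrics\<close>

locale curve_quadrics = theta_curve +
  fixes Q :: "mpoly set"
  assumes Q_sub: "Q \<subseteq> curve_forms 2" and Q_span: "curve_forms 2 \<subseteq> mpoly.span Q"
begin

definition idl :: "mpoly set" where "idl = ideal_gen N Q"

lemma idl_pullback: "f \<in> idl \<Longrightarrow> pullback f z = 0"
  unfolding idl_def pullback_def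
  by (rule ideal_gen_vanish) (use Q_sub in \<open>auto simp: curve_forms_def pullback_def\<close>)

lemma quadric_in_idl: "f \<in> curve_forms 2 \<Longrightarrow> f \<in> idl"
  using Q_span ideal_gen_span[of Q N] by (auto simp: idl_def)

text \<open>Modulo the quadrics and the linear form \<open>l\<close>, all products \<open>Y\<^sub>i Y\<^sub>j\<close> with \<open>i \<noteq> j\<close> agree. Hence in
  degree \<open>d\<close> the quotient is spanned by the powers \<open>Y\<^sub>i\<^sup>d\<close> and one mixed monomial, and these are
  separated by the \<open>N\<close> points of the hyperplane section.\<close>

context
  fixes l :: mpoly and Y :: "nat \<Rightarrow> mpoly"
  assumes l: "l \<in> forms N 1" "pullback l = sigs {..<N}"
    and Y: "\<And>i. i < N - 1 \<Longrightarrow> Y i \<in> forms N 1"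
    and Y_hs: "\<And>i j. i < N - 1 \<Longrightarrow> j < N - 1 \<Longrightarrow> pullback (Y i) (hs j) = 0 \<longleftrightarrow> i \<noteq> j"
    and Y_last: "\<And>i. i < N - 1 \<Longrightarrow> pullback (Y i) (hs (N - 1)) = 1"
    and span: "\<And>f. f \<in> forms N 1 \<Longrightarrow> \<exists>t b. f = mpoly_scale t l + (\<Sum>i<N-1. mpoly_scale (b i) (Y i))"
begin

lemma l_hs: "i < N \<Longrightarrow> pullback l (hs i) = 0"
  by (simp add: l sigs_eq_0_iff)

text \<open>For \<open>d \<ge> 1\<close> this is the part of degree \<open>d\<close> of the ideal
  generated by the quadrics and \<open>l\<close>. In degree 0 the truncated \<open>d - 1\<close>
  would admit constant multiples of \<open>l\<close>, hence the hypotheses \<open>d \<ge> 1\<close>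
  in \<open>J_mult\<close> and its consequences.\<close>

definition J :: "nat \<Rightarrow> mpoly set" where
  "J d = {q + l * g | q g. q \<in> idl \<inter> forms N d \<and> g \<in> forms N (d - 1)}"

lemma JI: "q \<in> idl \<Longrightarrow> q \<in> forms N d \<Longrightarrow> g \<in> forms N (d - 1) \<Longrightarrow> q + l * g \<in> J d"
  unfolding J_def by blast

lemma J_zero: "0 \<in> J d"
  using JI[of 0 d 0] by (simp add: idl_def ideal_gen_zero)

lemma J_add: assumes "f \<in> J d" "g \<in> J d" shows "f + g \<in> J d"
proof -
  obtain q r where f: "q \<in> idl" "q \<in> forms N d" "r \<in> forms N (d - 1)" "f = q + l * r"
    using assms(1) unfolding J_def by blast
  obtain q' r' where g: "q' \<in> idl" "q' \<in> forms N d" "r' \<in> forms N (d - 1)" "g = q' + l * r'"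
    using assms(2) unfolding J_def by blast
  have "(q + q') + l * (r + r') \<in> J d"
    using f g by (intro JI forms_add) (auto simp: idl_def intro: ideal_gen_add)
  thus ?thesis by (simp add: f g algebra_simps)
qed

lemma J_mult:
  assumes "f \<in> J d" "d \<ge> 1" "g \<in> forms N e" shows "g * f \<in> J (e + d)"
proof -
  obtain q r where f: "q \<in> idl" "q \<in> forms N d" "r \<in> forms N (d - 1)" "f = q + l * r"
    using assms(1) unfolding J_def by blast
  have "g * q + l * (g * r) \<in> J (e + d)"
  proof (rule JI)
    show "g * q \<in> idl" using f assms(3) unfolding idl_def
      by (intro ideal_gen_mult forms_subset_mpoly_ring[of g N e])
    show "g * q \<in> forms N (e + d)" by (rule forms_mult[OF assms(3) f(2)])
    show "g * r \<in> forms N (e + d - 1)"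
      by (rule forms_mult'[OF assms(3) f(3)]) (use assms(2) in simp)
  qed
  thus ?thesis by (simp add: f algebra_simps)
qed

lemma J_mult1: "f \<in> J d \<Longrightarrow> d \<ge> 1 \<Longrightarrow> g \<in> forms N 1 \<Longrightarrow> g * f \<in> J (Suc d)"
  using J_mult[of f d g 1] by simp

lemma J_scale: assumes "f \<in> J d" "d \<ge> 1" shows "mpoly_scale c f \<in> J d"
  using J_mult[OF assms forms_scale[OF forms_one], of c] by (simp add: scale_mult_left[symmetric])

lemma J_l: "g \<in> forms N d \<Longrightarrow> l * g \<in> J (Suc d)"
  using JI[of 0 "Suc d" g] by (simp add: idl_def ideal_gen_zero)

text \<open>Both products vanish at the first \<open>N - 1\<close> points and equal \<open>1\<close>
  at the last, so the pullback of the difference is divisible by that of \<open>l\<close>. The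
  quotient has degree \<open>N\<close> and multiplier \<open>c0\<close>, hence comes from a linear
  form \<open>g\<close>, and the difference minus \<open>l * g\<close> is a quadric through the
  curve.\<close>

lemma mixed_products:
  assumes "i < N - 1" "j < N - 1" "i \<noteq> j" "k < N - 1" "m < N - 1" "k \<noteq> m"
  shows "Y i * Y j - Y k * Y m \<in> J 2"
proof -
  let ?f = "Y i * Y j - Y k * Y m"
  have f: "?f \<in> forms N 2"
    by (intro forms_diff forms_mult'[OF Y Y]) (use assms in auto)
  have "pullback ?f (hs n) = 0" if "n \<in> {..<N}" for n
  proof (cases "n = N - 1")
    case True
    thus ?thesis using assms Y_last by simp
  next
    case False
    hence "n < N - 1" using that by auto
    hence "pullback (Y i) (hs n) = 0 \<or> pullback (Y j) (hs n) = 0"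
      "pullback (Y k) (hs n) = 0 \<or> pullback (Y m) (hs n) = 0"
      using assms Y_hs by blast+
    thus ?thesis by auto
  qed
  then obtain h where h: "h \<in> tf (int (2 * N) - int (card {..<N})) (c0 ^ 2 / (\<Prod>i<N. - ee (hs i)))"
      "\<And>z. pullback ?f z = sigs {..<N} z * h z"
    using sigs_divide[OF _ pullback_tf[OF f], of "{..<N}"] by auto
  have "h \<in> tf (int N) c0" using h(1) by (simp add: prod_hs power2_eq_square)
  then obtain g where g: "g \<in> forms N 1" "pullback g = h" using ex_linear_form by blast
  have "l * g \<in> forms N 2" by (rule forms_mult'[OF l(1) g(1)]) simp
  hence "?f - l * g \<in> curve_forms 2"
    using f h(2) g l by (auto simp: curve_forms_def intro!: forms_diff)
  hence "(?f - l * g) + l * g \<in> J 2"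
    using g by (intro JI quadric_in_idl) (auto simp: curve_forms_def)
  thus ?thesis by simp
qed

lemma N_minus_1: "0 < N - 1" "1 < N - 1" "2 < N - 1"
  using N_ge_4 by auto

text \<open>With a third index \<open>k\<close> the factors are exchanged in two steps: modulo
  \<open>J 3\<close>, \<open>Y i * (Y 0 * Y 1)\<close> agrees with \<open>Y i * (Y j * Y k)\<close>,
  and regrouped as \<open>Y j * (Y i * Y k)\<close> this agrees with
  \<open>Y j * (Y 0 * Y 1)\<close>. The index exists because \<open>N - 1 \<ge> 3\<close>.\<close>

lemma mixed_cubic:
  assumes "i < N - 1" "j < N - 1"
  shows "Y i * (Y 0 * Y 1) - Y j * (Y 0 * Y 1) \<in> J 3"
proof -
  obtain k where k: "k < N - 1" "k \<noteq> i" "k \<noteq> j"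
  proof -
    have "\<exists>k<3. k \<noteq> i \<and> k \<noteq> j" by presburger
    then obtain k where "k < 3" "k \<noteq> i" "k \<noteq> j" by blast
    thus ?thesis using that[of k] N_minus_1 by simp
  qed
  have "Y i * (Y 0 * Y 1 - Y j * Y k) \<in> J 3"
    using J_mult1[OF mixed_products[of 0 1 j k] _ Y[of i]] assms k N_minus_1 by (simp add: numeral_3_eq_3)
  moreover have "Y j * (Y i * Y k - Y 0 * Y 1) \<in> J 3"
    using J_mult1[OF mixed_products[of i k 0 1] _ Y[of j]] assms k N_minus_1 by (simp add: numeral_3_eq_3)
  ultimately have "Y i * (Y 0 * Y 1 - Y j * Y k) + Y j * (Y i * Y k - Y 0 * Y 1) \<in> J 3"
    by (rule J_add)
  thus ?thesis by (simp add: algebra_simps)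
qed

lemma mixed_power:
  assumes "i < N - 1"
  shows "Y i ^ e * (Y 0 * Y 1) - Y 0 ^ e * (Y 0 * Y 1) \<in> J (e + 2)"
proof (induction e)
  case 0
  show ?case by (simp add: J_zero)
next
  case (Suc e)
  have "Y i * (Y i ^ e * (Y 0 * Y 1) - Y 0 ^ e * (Y 0 * Y 1)) \<in> J (Suc (e + 2))"
    using Suc assms by (intro J_mult1 Y) auto
  moreover have "Y 0 ^ e * (Y i * (Y 0 * Y 1) - Y 0 * (Y 0 * Y 1)) \<in> J (e + 3)"
    using assms N_minus_1 by (intro J_mult mixed_cubic forms_power1 Y) auto
  ultimately have "Y i * (Y i ^ e * (Y 0 * Y 1) - Y 0 ^ e * (Y 0 * Y 1)) +
      Y 0 ^ e * (Y i * (Y 0 * Y 1) - Y 0 * (Y 0 * Y 1)) \<in> J (e + 3)"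
    by (intro J_add) (auto simp: numeral_3_eq_3)
  thus ?case by (simp add: algebra_simps numeral_3_eq_3)
qed

section \<open>Normal forms modulo the quadrics and the linear form \<open>l\<close>\<close>

definition reducible :: "nat \<Rightarrow> mpoly \<Rightarrow> bool" where
  "reducible d f \<longleftrightarrow> (\<exists>j\<in>J d. \<exists>a b. f = j + (\<Sum>i<N-1. mpoly_scale (a i) (Y i ^ d))
      + mpoly_scale b (Y 0 ^ (d - 1) * Y 1))"

lemma reducible_J: "f \<in> J d \<Longrightarrow> reducible d f"
  unfolding reducible_def by (intro bexI[of _ f] exI[of _ "\<lambda>_. 0"] exI[of _ 0]) auto

lemma reducible_zero: "reducible d 0"
  by (rule reducible_J[OF J_zero])

lemma reducible_add: assumes "reducible d f" "reducible d g" shows "reducible d (f + g)"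
proof -
  obtain j a b where f: "j \<in> J d" "f = j + (\<Sum>i<N-1. mpoly_scale (a i) (Y i ^ d)) + mpoly_scale b (Y 0 ^ (d - 1) * Y 1)"
    using assms(1) unfolding reducible_def by blast
  obtain j' a' b' where g: "j' \<in> J d" "g = j' + (\<Sum>i<N-1. mpoly_scale (a' i) (Y i ^ d)) + mpoly_scale b' (Y 0 ^ (d - 1) * Y 1)"
    using assms(2) unfolding reducible_def by blast
  show ?thesis unfolding reducible_def
    by (intro bexI[OF _ J_add[OF f(1) g(1)]] exI[of _ "\<lambda>i. a i + a' i"] exI[of _ "b + b'"])
       (simp add: f g mpoly.scale_left_distrib sum.distrib algebra_simps)
qed

lemma reducible_scale: assumes "reducible d f" "d \<ge> 1" shows "reducible d (mpoly_scale c f)"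
proof -
  obtain j a b where f: "j \<in> J d" "f = j + (\<Sum>i<N-1. mpoly_scale (a i) (Y i ^ d)) + mpoly_scale b (Y 0 ^ (d - 1) * Y 1)"
    using assms(1) unfolding reducible_def by blast
  show ?thesis unfolding reducible_def
    by (intro bexI[OF _ J_scale[OF f(1) assms(2)], of _ c] exI[of _ "\<lambda>i. c * a i"] exI[of _ "c * b"])
       (simp add: f mpoly.scale_right_distrib mpoly.scale_sum_right)
qed

lemma reducible_sum: "(\<And>i. i \<in> A \<Longrightarrow> reducible d (f i)) \<Longrightarrow> reducible d (sum f A)"
  by (induction A rule: infinite_finite_induct) (auto intro: reducible_zero reducible_add)

lemma reducible_diffD: "f - g \<in> J d \<Longrightarrow> reducible d g \<Longrightarrow> reducible d f"
  using reducible_add[OF reducible_J, of "f - g" d g] by simp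

lemma reducible_power: "i < N - 1 \<Longrightarrow> reducible d (Y i ^ d)"
  unfolding reducible_def
  by (intro bexI[OF _ J_zero] exI[of _ "\<lambda>k. if k = i then 1 else 0"] exI[of _ 0])
     (simp add: if_distrib[of "\<lambda>c. mpoly_scale c _"] cong: if_cong)

lemma reducible_mixed: "reducible d (Y 0 ^ (d - 1) * Y 1)"
  unfolding reducible_def by (intro bexI[OF _ J_zero] exI[of _ "\<lambda>k. 0"] exI[of _ 1]) simp

text \<open>For \<open>i \<noteq> j\<close> the mixed factor \<open>Y i * Y j\<close> is exchanged
  for \<open>Y 0 * Y 1\<close>, and then the remaining power of \<open>Y j\<close> for one of
  \<open>Y 0\<close>.\<close>

lemma reducible_Y_power:
  assumes "i < N - 1" "j < N - 1" "d \<ge> 1"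
  shows "reducible (Suc d) (Y i * Y j ^ d)"
proof (cases "i = j")
  case True
  thus ?thesis using reducible_power[OF assms(1), of "Suc d"] by simp
next
  case False
  obtain e where e: "d = Suc e" using assms(3) by (cases d) auto
  have "Y j ^ e * (Y i * Y j - Y 0 * Y 1) \<in> J (e + 2)"
    using assms False N_minus_1 by (intro J_mult mixed_products forms_power1 Y) auto
  moreover have "Y j ^ e * (Y 0 * Y 1) - Y 0 ^ e * (Y 0 * Y 1) \<in> J (e + 2)"
    by (rule mixed_power) fact
  ultimately have "Y j ^ e * (Y i * Y j - Y 0 * Y 1) + (Y j ^ e * (Y 0 * Y 1) - Y 0 ^ e * (Y 0 * Y 1)) \<in> J (e + 2)"
    by (rule J_add)
  hence "Y i * Y j ^ d - Y 0 ^ (Suc d - 1) * Y 1 \<in> J (Suc d)"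
    by (simp add: e algebra_simps)
  thus ?thesis using reducible_mixed by (rule reducible_diffD)
qed

lemma reducible_Y_mixed:
  assumes "i < N - 1" "d \<ge> 1"
  shows "reducible (Suc d) (Y i * (Y 0 ^ (d - 1) * Y 1))"
proof (cases "d = 1")
  case True
  thus ?thesis using reducible_Y_power[of i 1 1] assms N_minus_1 by simp
next
  case False
  hence "d = (d - 2) + 2" using assms(2) by simp
  then obtain e where e: "d = e + 2" ..
  have "Y 0 ^ e * (Y i * (Y 0 * Y 1) - Y 0 * (Y 0 * Y 1)) \<in> J (e + 3)"
    using assms N_minus_1 by (intro J_mult mixed_cubic forms_power1 Y) auto
  hence "Y i * (Y 0 ^ (d - 1) * Y 1) - Y 0 ^ (Suc d - 1) * Y 1 \<in> J (Suc d)"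
    by (simp add: e algebra_simps numeral_3_eq_3)
  thus ?thesis using reducible_mixed by (rule reducible_diffD)
qed

lemma reducible_form: "f \<in> forms N d \<Longrightarrow> d \<ge> 1 \<Longrightarrow> reducible d f"
proof (induction d arbitrary: f)
  case (Suc d)
  show ?case
  proof (cases "d = 0")
    case True
    obtain t b where f: "f = mpoly_scale t l + (\<Sum>i<N-1. mpoly_scale (b i) (Y i))"
      using span Suc.prems True by force
    have "reducible 1 (mpoly_scale t l)"
      using J_l[of "mpoly_scale t 1" 0] by (intro reducible_J) (simp add: forms_scale scale_mult_right[symmetric])
    moreover have "reducible 1 (mpoly_scale (b i) (Y i))" if "i \<in> {..<N-1}" for i
      using reducible_scale[OF reducible_power[of i 1]] that by simp
    ultimately show ?thesis unfolding f using True by (auto intro: reducible_add reducible_sum)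
  next
    case False
    from Suc.prems(1) show ?thesis
    proof (induction rule: forms_Suc_induct)
      case (var k g)
      obtain t b where X: "mpoly_var k = mpoly_scale t l + (\<Sum>i<N-1. mpoly_scale (b i) (Y i))"
        using span[OF forms_var[OF var(1)]] by blast
      have "reducible d g" using Suc.IH var(2) False by simp
      then obtain j a c where g: "j \<in> J d"
          "g = j + (\<Sum>i<N-1. mpoly_scale (a i) (Y i ^ d)) + mpoly_scale c (Y 0 ^ (d - 1) * Y 1)"
        unfolding reducible_def by blast
      have Yg: "reducible (Suc d) (Y i * g)" if i: "i < N - 1" for i
      proof -
        have "Y i * g = Y i * j + (\<Sum>m<N-1. mpoly_scale (a m) (Y i * Y m ^ d))
            + mpoly_scale c (Y i * (Y 0 ^ (d - 1) * Y 1))"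
          by (simp add: g distrib_left sum_distrib_left scale_mult_right)
        moreover have "reducible (Suc d) (Y i * j)"
          using i False by (intro reducible_J J_mult1 g(1) Y) auto
        moreover have "reducible (Suc d) (\<Sum>m<N-1. mpoly_scale (a m) (Y i * Y m ^ d))"
          using i False by (intro reducible_sum reducible_scale reducible_Y_power) auto
        moreover have "reducible (Suc d) (mpoly_scale c (Y i * (Y 0 ^ (d - 1) * Y 1)))"
          using i False by (intro reducible_scale reducible_Y_mixed) auto
        ultimately show ?thesis by (simp only: reducible_add)
      qed
      have "mpoly_var k * g = mpoly_scale t (l * g) + (\<Sum>i<N-1. mpoly_scale (b i) (Y i * g))"
        by (simp add: X distrib_right sum_distrib_right scale_mult_left)
      moreover have "reducible (Suc d) (mpoly_scale t (l * g))"
        using var(2) by (intro reducible_scale reducible_J J_l) auto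
      moreover have "reducible (Suc d) (\<Sum>i<N-1. mpoly_scale (b i) (Y i * g))"
        by (intro reducible_sum reducible_scale Yg) auto
      ultimately show ?case by (simp only: reducible_add)
    qed (auto intro: reducible_add reducible_zero)
  qed
qed simp

lemma curve_forms_idl_aux: "f \<in> curve_forms d \<Longrightarrow> f \<in> idl"
proof (induction d arbitrary: f)
  case 0
  thus ?case by (simp add: curve_forms_0 idl_def ideal_gen_zero)
next
  case (Suc d)
  have fz: "f \<in> forms N (Suc d)" "\<And>z. pullback f z = 0" using Suc.prems by (auto simp: curve_forms_def)
  show ?case
  proof (cases "d = 0")
    \<comment> \<open>In degree 1 the mixed monomial is \<open>Y 1\<close> itself and no longer
      vanishes at all of the first \<open>N - 1\<close> points, so the evaluation argument below
      would fail; nondegeneracy of the curve settles this case.\<close>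
    case True
    hence "f = 0" using Suc.prems curve_forms_1 by auto
    thus ?thesis by (simp add: idl_def ideal_gen_zero)
  next
    case False
    obtain j a b where j: "j \<in> J (Suc d)"
       and f: "f = j + (\<Sum>i<N-1. mpoly_scale (a i) (Y i ^ Suc d)) + mpoly_scale b (Y 0 ^ d * Y 1)"
      using reducible_form[OF fz(1)] unfolding reducible_def by auto
    obtain q g where q: "q \<in> idl" "q \<in> forms N (Suc d)" "g \<in> forms N d" "j = q + l * g"
      using j unfolding J_def by auto
    \<comment> \<open>The part \<open>q\<close> vanishes on the whole curve and \<open>l\<close> on
      the hyperplane section, so only the normal form contributes to the values at the
      \<open>N\<close> points.\<close>
    have jz: "pullback j (hs m) = 0" if "m < N" for m
      using q l_hs[OF that] by (simp add: idl_pullback)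
    have a0: "a m = 0" if m: "m < N - 1" for m
    proof -
      have "(\<Sum>i<N-1. a i * pullback (Y i) (hs m) ^ Suc d) =
          (\<Sum>i<N-1. if i = m then a m * pullback (Y m) (hs m) ^ Suc d else 0)"
        by (rule sum.cong) (use Y_hs m in auto)
      also have "\<dots> = a m * pullback (Y m) (hs m) ^ Suc d" using m by simp
      finally have s: "(\<Sum>i<N-1. a i * pullback (Y i) (hs m) ^ Suc d) = a m * pullback (Y m) (hs m) ^ Suc d" .
      \<comment> \<open>At one of the first \<open>N - 1\<close> points at most one of
        \<open>Y 0\<close> and \<open>Y 1\<close> is nonzero, and both occur in the monomial since
        \<open>d \<noteq> 0\<close>.\<close>
      have mx: "pullback (Y 0) (hs m) ^ d * pullback (Y 1) (hs m) = 0"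
        using Y_hs[of 0 m] Y_hs[of 1 m] m False N_minus_1 by (cases "m = 0") auto
      have "pullback f (hs m) = pullback j (hs m) + (\<Sum>i<N-1. a i * pullback (Y i) (hs m) ^ Suc d)
          + b * (pullback (Y 0) (hs m) ^ d * pullback (Y 1) (hs m))"
        unfolding f by (simp only: pullback_simps)
      hence "a m * pullback (Y m) (hs m) ^ Suc d = 0"
        using fz(2)[of "hs m"] jz[of m] m unfolding s mx by simp
      thus ?thesis using Y_hs[OF m m] by simp
    qed
    \<comment> \<open>The pure powers are already eliminated, and the mixed monomial has the value
      \<open>1\<close> at the last point.\<close>
    have "b = 0"
      using fz(2)[of "hs (N - 1)"] jz[of "N - 1"] N_minus_1 Y_last[of 0] Y_last[of 1]
      unfolding f by (simp add: a0)
    hence fq: "f = q + l * g" by (simp add: f a0 q(4))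
    obtain p where p: "\<And>x. x \<in> hs ` {..<N} \<Longrightarrow> p - x \<notin> lattice \<tau>"
      by (rule ex_notin_lattice_translates[of "hs ` {..<N}"]) auto
    have "pullback g z = 0" for z
    proof (rule entire_mult_zeroD[where f = "pullback g" and g = "pullback l"])
      show "pullback g w * pullback l w = 0" for w
        using fz(2)[of w] idl_pullback[OF q(1), of w] by (auto simp: fq)
      show "pullback l p \<noteq> 0" using p by (auto simp: l sigs_def sig_eq_0_iff)
    qed (use q l pullback_holomorphic in blast)+
    hence "g \<in> curve_forms d" using q by (simp add: curve_forms_def)
    hence "l * g \<in> idl" using Suc.IH l unfolding idl_def
      by (intro ideal_gen_mult forms_subset_mpoly_ring[of l N 1]) auto
    thus ?thesis unfolding fq using q(1) unfolding idl_def by (intro ideal_gen_add) auto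
  qed
qed

end

lemma curve_forms_subset_idl: "curve_forms d \<subseteq> idl"
proof (rule ex_hyperplane_basis)
  fix l Y
  assume *: "l \<in> forms N 1" "pullback l = sigs {..<N}"
    "\<And>i. i < N - 1 \<Longrightarrow> Y i \<in> forms N 1"
    "\<And>i j. i < N - 1 \<Longrightarrow> j < N - 1 \<Longrightarrow> pullback (Y i) (hs j) = 0 \<longleftrightarrow> i \<noteq> j"
    "\<And>i. i < N - 1 \<Longrightarrow> pullback (Y i) (hs (N - 1)) = 1"
    "\<And>f. f \<in> forms N 1 \<Longrightarrow> \<exists>t b. f = mpoly_scale t l + (\<Sum>i<N-1. mpoly_scale (b i) (Y i))"
  show ?thesis using curve_forms_idl_aux[OF *] by blast
qed

lemma common_zero_on_curve:
  assumes v: "\<And>q. q \<in> Q \<Longrightarrow> peval q v = 0" and nz: "i0 < N" "v i0 \<noteq> 0"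
  shows "\<exists>z c. c \<noteq> 0 \<and> (\<forall>i<N. v i = c * th (int i) z)"
proof -
  have idl0: "peval f v = 0" if "f \<in> curve_forms d" for f d
    using ideal_gen_vanish[of f N Q v] v curve_forms_subset_idl[of d] that by (auto simp: idl_def)
  \<comment> \<open>The linear system cut out by the hyperplanes through \<open>v\<close>. A common
    zero of it is a parameter of \<open>v\<close> on the curve.\<close>
  define K where "K = pullback ` {f \<in> forms N 1. peval f v = 0}"
  have K_lin: "(\<lambda>z. f z + t * g z) \<in> K" if fg: "f \<in> K" "g \<in> K" for f g t
  proof -
    obtain F where F: "F \<in> forms N 1" "peval F v = 0" "f = pullback F" using fg unfolding K_def by blast
    obtain G where G: "G \<in> forms N 1" "peval G v = 0" "g = pullback G" using fg unfolding K_def by blast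
    have "F + mpoly_scale t G \<in> {f \<in> forms N 1. peval f v = 0}"
      using F(1,2) G(1,2) forms_add[OF F(1) forms_scale[OF G(1)]] by simp
    moreover have "(\<lambda>z. f z + t * g z) = pullback (F + mpoly_scale t G)" by (rule ext) (simp add: F G)
    ultimately show ?thesis unfolding K_def by (rule rev_image_eqI)
  qed
  have K_0: "(\<lambda>z. 0) \<in> K"
  proof -
    have "(\<lambda>z. 0) = pullback 0" by (rule ext) simp
    thus ?thesis unfolding K_def by auto
  qed
  have "\<exists>z. \<forall>f\<in>K. f z = 0"
  proof (rule ccontr)
    assume "\<not> ?thesis"
    hence ex: "\<exists>f\<in>K. f z \<noteq> 0" for z by blast
    obtain f1 where f1: "f1 \<in> K" "f1 0 \<noteq> 0" using ex by blast
    then obtain L1 where L1: "L1 \<in> forms N 1" "peval L1 v = 0" "f1 = pullback L1" unfolding K_def by blast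
    have f1t: "f1 \<in> tf (int N) c0" using pullback_tf[OF L1(1)] L1(3) by simp
    obtain A where A: "finite A" "\<And>z. f1 z = 0 \<Longrightarrow> \<exists>a\<in>A. z - a \<in> lattice \<tau>"
      using tf_finite_zeros[OF f1t c0_nonzero f1(2)] by blast
    obtain f2 where f2: "f2 \<in> K" "\<And>a. a \<in> A \<Longrightarrow> f2 a \<noteq> 0"
      using tf_ex_nonvanishing_finite[OF K_lin K_0 A(1)] ex by blast
    then obtain L2 where L2: "L2 \<in> forms N 1" "peval L2 v = 0" "f2 = pullback L2" unfolding K_def by blast
    have f2t: "f2 \<in> tf (int N) c0" using pullback_tf[OF L2(1)] L2(3) by simp
    have f12: "f2 z \<noteq> 0" if "f1 z = 0" for z
      using A(2)[OF that] f2(2) tf_eq_0_lattice[OF f2t c0_nonzero] by blast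
    \<comment> \<open>A form with nonzero value at \<open>v\<close>. Degree 3 leaves cofactors of
      degree \<open>2 * N \<ge> N + 1\<close> for the pencil trick; a quadratic form would leave
      only \<open>N\<close>.\<close>
    define F where "F = mpoly_var i0 ^ 3"
    have F: "F \<in> forms N 3" unfolding F_def by (intro forms_power1 forms_var nz)
    have "c0 ^ 3 = c0 * c0 ^ 2" by (simp add: power3_eq_cube power2_eq_square)
    hence "pullback F \<in> tf (int N + int (2 * N)) (c0 * c0 ^ 2)"
      using pullback_tf[OF F] by simp
    moreover have "2 * N \<ge> N + 1" using N_ge_4 by simp
    ultimately obtain g1 g2 where g: "g1 \<in> tf (int N + int (2 * N) - int N) (c0 * c0 ^ 2 / c0)"
        "g2 \<in> tf (int (2 * N)) (c0 ^ 2)" "\<And>z. pullback F z = f1 z * g1 z + f2 z * g2 z"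
      using tf_pencil[OF f1t c0_nonzero f1(2) f2t c0_nonzero f12, of "pullback F" "2 * N" "c0 ^ 2"] by auto
    have "g1 \<in> tf (int (2 * N)) (c0 ^ 2)" using g(1) by simp
    then obtain G1 where G1: "G1 \<in> forms N 2" "pullback G1 = g1" using pullback_surj[of 2] by auto
    obtain G2 where G2: "G2 \<in> forms N 2" "pullback G2 = g2" using pullback_surj[of 2] g(2) by auto
    have "F - (L1 * G1 + L2 * G2) \<in> forms N 3"
      by (intro forms_diff F forms_add forms_mult'[OF L1(1) G1(1)] forms_mult'[OF L2(1) G2(1)]) auto
    hence "F - (L1 * G1 + L2 * G2) \<in> curve_forms 3"
      using g(3) by (auto simp: curve_forms_def L1(3) L2(3) G1 G2)
    \<comment> \<open>The cubic form through the curve vanishes at \<open>v\<close> because it lies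
      in the ideal of the quadrics, and \<open>L1\<close>, \<open>L2\<close> vanish there by
      choice.\<close>
    from idl0[OF this] have "peval F v = 0" by (simp add: L1 L2)
    thus False using nz by (simp add: F_def)
  qed
  then obtain z where z: "\<And>f. f \<in> K \<Longrightarrow> f z = 0" by blast
  have ratio: "v i0 * th (int j) z = v j * th (int i0) z" if j: "j < N" for j
  proof -
    \<comment> \<open>This form vanishes at \<open>v\<close>. Its vanishing at the common zero says
      that the coordinates \<open>j\<close> and \<open>i0\<close> are in the same ratio at both
      points.\<close>
    let ?l = "mpoly_scale (v i0) (mpoly_var j) - mpoly_scale (v j) (mpoly_var i0)"
    have "?l \<in> forms N 1" by (intro forms_diff forms_scale forms_var j nz)
    hence "pullback ?l \<in> K" unfolding K_def by auto
    from z[OF this] show ?thesis by simp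
  qed
  obtain k where k: "k < N" "th (int k) z \<noteq> 0" using th_base_point_free by blast
  have "th (int i0) z \<noteq> 0" using ratio[OF k(1)] k nz by auto
  hence "v j = (v i0 / th (int i0) z) * th (int j) z" if "j < N" for j
    using ratio[OF that] by (simp add: field_simps)
  moreover have "v i0 / th (int i0) z \<noteq> 0" using nz \<open>th (int i0) z \<noteq> 0\<close> by simp
  ultimately show ?thesis by blast
qed

end

section \<open>Projective space\<close>

lemma proj_pt_smult: "c \<noteq> 0 \<Longrightarrow> proj_pt (c \<cdot>\<^sub>v v) = proj_pt v"
proof -
  assume c: "c \<noteq> 0"
  have "x \<in> proj_pt v" if "x \<in> proj_pt (c \<cdot>\<^sub>v v)" for x
    using that c unfolding proj_pt_def by (auto simp: smult_smult_assoc)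
  moreover have "x \<in> proj_pt (c \<cdot>\<^sub>v v)" if "x \<in> proj_pt v" for x
  proof -
    obtain d where d: "x = d \<cdot>\<^sub>v v" "d \<noteq> 0" using \<open>x \<in> proj_pt v\<close> unfolding proj_pt_def by blast
    have "x = (d / c) \<cdot>\<^sub>v (c \<cdot>\<^sub>v v)" using c d by (simp add: smult_smult_assoc)
    thus ?thesis using c d unfolding proj_pt_def by (intro CollectI exI[of _ "d / c"]) auto
  qed
  ultimately show ?thesis by blast
qed

lemma self_in_proj_pt: "v \<in> proj_pt v"
  unfolding proj_pt_def by (intro CollectI exI[of _ 1]) auto

lemma proj_pt_eqD: "proj_pt v = proj_pt w \<Longrightarrow> \<exists>c. c \<noteq> 0 \<and> v = c \<cdot>\<^sub>v w"
  using self_in_proj_pt[of v] unfolding proj_pt_def by auto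

lemma vec_nonzero_iff: "v \<in> carrier_vec N \<Longrightarrow> v \<noteq> 0\<^sub>v N \<longleftrightarrow> (\<exists>i<N. vec_index v i \<noteq> 0)"
  by (auto simp: vec_eq_iff)

lemma proj_spaceE:
  assumes "P \<in> proj_space N"
  obtains v i where "v \<in> carrier_vec N" "i < N" "vec_index v i \<noteq> 0" "P = proj_pt v"
  using assms vec_nonzero_iff unfolding proj_space_def by blast

lemma proj_spaceI:
  "v \<in> carrier_vec N \<Longrightarrow> i < N \<Longrightarrow> vec_index v i \<noteq> 0 \<Longrightarrow> proj_pt v \<in> proj_space N"
  using vec_nonzero_iff[of v N] unfolding proj_space_def by blast

lemma affine_coord_proj_pt:
  assumes "v \<in> carrier_vec N" "i < N" "j < N" "vec_index v i \<noteq> 0"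
  shows "affine_coord i j (proj_pt v) = vec_index v j / vec_index v i"
proof -
  define w where "w = (SOME w. w \<in> proj_pt v)"
  have "w \<in> proj_pt v" unfolding w_def using self_in_proj_pt[of v] by (rule someI)
  then obtain c where c: "c \<noteq> 0" "w = c \<cdot>\<^sub>v v" unfolding proj_pt_def by blast
  thus ?thesis using assms by (simp add: affine_coord_def Let_def w_def[symmetric])
qed

lemma mpoly_eval_smult:
  assumes "f \<in> forms N d" "v \<in> carrier_vec N"
  shows "mpoly_eval f (c \<cdot>\<^sub>v v) = c ^ d * mpoly_eval f v"
proof -
  have "peval f (\<lambda>i. vec_index (c \<cdot>\<^sub>v v) i) = peval f (\<lambda>i. c * vec_index v i)"
    by (rule peval_cong[OF assms(1)]) (use assms(2) in auto)
  thus ?thesis by (simp add: mpoly_eval_eq_peval peval_homogeneous[OF assms(1)])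
qed

lemma mem_zero_locus_iff:
  assumes "F \<subseteq> (\<Union>d. forms N d)" "v \<in> carrier_vec N" "proj_pt v \<in> proj_space N"
  shows "proj_pt v \<in> zero_locus N F \<longleftrightarrow> (\<forall>f\<in>F. mpoly_eval f v = 0)"
proof -
  have "(\<forall>w\<in>proj_pt v. mpoly_eval f w = 0) \<longleftrightarrow> mpoly_eval f v = 0" if fF: "f \<in> F" for f
  proof
    assume "\<forall>w\<in>proj_pt v. mpoly_eval f w = 0"
    thus "mpoly_eval f v = 0" using self_in_proj_pt by blast
  next
    assume "mpoly_eval f v = 0"
    moreover obtain d where "f \<in> forms N d" using assms(1) fF by blast
    ultimately show "\<forall>w\<in>proj_pt v. mpoly_eval f w = 0"
      using mpoly_eval_smult[OF _ assms(2)] by (auto simp: proj_pt_def)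
  qed
  thus ?thesis using assms(3) by (auto simp: zero_locus_def)
qed

section \<open>Zariski closed sets and finite sets of points\<close>

lemma zariski_closed_empty: "zariski_closed N {}"
proof -
  have "zero_locus N {1} = {}"
  proof -
    have "P \<notin> zero_locus N {1}" for P
    proof
      assume P: "P \<in> zero_locus N {1}"
      then obtain v where "P = proj_pt v" by (auto simp: zero_locus_def proj_space_def)
      thus False using P self_in_proj_pt[of v] by (auto simp: zero_locus_def mpoly_eval_eq_peval)
    qed
    thus ?thesis by blast
  qed
  moreover have "{1} \<subseteq> (\<Union>d. forms N d)" using forms_one by blast
  ultimately show ?thesis unfolding zariski_closed_def by metis
qed

lemma zariski_closed_Un:
  assumes "zariski_closed N A" "zariski_closed N B"
  shows "zariski_closed N (A \<union> B)"
proof -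
  obtain F where F: "F \<subseteq> (\<Union>d. forms N d)" "A = zero_locus N F"
    using assms(1) unfolding zariski_closed_def by blast
  obtain G where G: "G \<subseteq> (\<Union>d. forms N d)" "B = zero_locus N G"
    using assms(2) unfolding zariski_closed_def by blast
  define H where "H = {f * g | f g. f \<in> F \<and> g \<in> G}"
  have H: "H \<subseteq> (\<Union>d. forms N d)"
  proof
    fix h assume "h \<in> H"
    then obtain f g where fg: "h = f * g" "f \<in> F" "g \<in> G" unfolding H_def by blast
    obtain d e where "f \<in> forms N d" "g \<in> forms N e" using fg F(1) G(1) by blast
    thus "h \<in> (\<Union>d. forms N d)" unfolding fg(1) using forms_mult by blast
  qed
  have "P \<in> A \<union> B \<longleftrightarrow> P \<in> zero_locus N H" if P: "P \<in> proj_space N" for P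
  proof -
    obtain v i where v: "v \<in> carrier_vec N" "P = proj_pt v" using P by (rule proj_spaceE)
    have "P \<in> A \<union> B \<longleftrightarrow> (\<forall>f\<in>F. mpoly_eval f v = 0) \<or> (\<forall>g\<in>G. mpoly_eval g v = 0)"
      using P v mem_zero_locus_iff[OF F(1) v(1)] mem_zero_locus_iff[OF G(1) v(1)] F(2) G(2) by auto
    also have "\<dots> \<longleftrightarrow> (\<forall>h\<in>H. mpoly_eval h v = 0)"
    proof
      assume H0: "\<forall>h\<in>H. mpoly_eval h v = 0"
      show "(\<forall>f\<in>F. mpoly_eval f v = 0) \<or> (\<forall>g\<in>G. mpoly_eval g v = 0)"
      proof (rule disjCI)
        assume "\<not> (\<forall>g\<in>G. mpoly_eval g v = 0)"
        then obtain g where g: "g \<in> G" "mpoly_eval g v \<noteq> 0" by blast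
        have "mpoly_eval (f * g) v = 0" if "f \<in> F" for f
          using H0 that g(1) unfolding H_def by blast
        thus "\<forall>f\<in>F. mpoly_eval f v = 0" using g(2) by (auto simp: mpoly_eval_eq_peval)
      qed
    qed (auto simp: H_def mpoly_eval_eq_peval)
    also have "\<dots> \<longleftrightarrow> P \<in> zero_locus N H"
      using P v mem_zero_locus_iff[OF H v(1)] by auto
    finally show ?thesis .
  qed
  hence "A \<union> B = zero_locus N H"
    using F(2) G(2) unfolding zero_locus_def by blast
  thus ?thesis using H unfolding zariski_closed_def by blast
qed

text \<open>Proportionality to \<open>v\<close> is expressed by the \<open>2 \<times> 2\<close>
  minors; those that involve one fixed index \<open>i\<close> with nonzero coordinate
  suffice.\<close>

lemma zariski_closed_point:
  assumes "P \<in> proj_space N" shows "zariski_closed N {P}"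
proof -
  obtain v i where v: "v \<in> carrier_vec N" "i < N" "vec_index v i \<noteq> 0" "P = proj_pt v"
    using assms by (rule proj_spaceE)
  define l where "l = (\<lambda>j. mpoly_scale (vec_index v i) (mpoly_var j) - mpoly_scale (vec_index v j) (mpoly_var i))"
  have l: "l ` {..<N} \<subseteq> (\<Union>d. forms N d)"
    unfolding l_def using v(2) by (auto intro!: exI[of _ "1::nat"] forms_diff forms_scale forms_var[unfolded One_nat_def] simp del: One_nat_def)
  have "Q \<in> zero_locus N (l ` {..<N}) \<longleftrightarrow> Q = P" if Q: "Q \<in> proj_space N" for Q
  proof -
    obtain w k where w: "w \<in> carrier_vec N" "k < N" "vec_index w k \<noteq> 0" "Q = proj_pt w"
      using Q by (rule proj_spaceE)
    have "Q \<in> zero_locus N (l ` {..<N}) \<longleftrightarrow> (\<forall>j<N. vec_index v i * vec_index w j = vec_index v j * vec_index w i)"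
      using Q w mem_zero_locus_iff[OF l w(1)] by (auto simp: l_def mpoly_eval_eq_peval)
    also have "\<dots> \<longleftrightarrow> Q = P"
    proof
      assume *: "\<forall>j<N. vec_index v i * vec_index w j = vec_index v j * vec_index w i"
      define c where "c = vec_index w i / vec_index v i"
      have "vec_index w j = c * vec_index v j" if "j < N" for j
        using * that v(3) by (simp add: c_def field_simps)
      hence wc: "w = c \<cdot>\<^sub>v v" using v(1) w(1) by (intro eq_vecI) auto
      moreover have "c \<noteq> 0" using wc w v by auto
      ultimately show "Q = P" using w v proj_pt_smult by simp
    next
      assume "Q = P"
      then obtain c where "w = c \<cdot>\<^sub>v v" using proj_pt_eqD[of w v] w v by auto
      thus "\<forall>j<N. vec_index v i * vec_index w j = vec_index v j * vec_index w i" using v by auto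
    qed
    finally show ?thesis .
  qed
  hence "{P} = zero_locus N (l ` {..<N})"
    using assms unfolding zero_locus_def by blast
  thus ?thesis using l unfolding zariski_closed_def by blast
qed

lemma zariski_closed_finite: "finite A \<Longrightarrow> A \<subseteq> proj_space N \<Longrightarrow> zariski_closed N A"
proof (induction A rule: finite_induct)
  case (insert P A)
  thus ?case using zariski_closed_Un[OF zariski_closed_point, of P N A] by simp
qed (rule zariski_closed_empty)

text \<open>Removing one point from a finite set leaves a closed set, so two points would give a
  decomposition.\<close>

lemma irreducible_finite:
  assumes "irreducible_closed N Z" "finite Z" "Z \<subseteq> proj_space N"
  obtains P where "Z = {P}"
proof -
  obtain P where P: "P \<in> Z" using assms(1) unfolding irreducible_closed_def by blast
  have "zariski_closed N {P}" "zariski_closed N (Z - {P})"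
    using assms P by (auto intro: zariski_closed_point zariski_closed_finite)
  hence "Z \<subseteq> {P} \<or> Z \<subseteq> Z - {P}" using assms(1) unfolding irreducible_closed_def by blast
  thus ?thesis using P that by blast
qed

lemma irreducible_point: "P \<in> proj_space N \<Longrightarrow> irreducible_closed N {P}"
  unfolding irreducible_closed_def using zariski_closed_point by auto

section \<open>The embedded curve\<close>

context theta_curve begin

definition thv :: "complex \<Rightarrow> complex Matrix.vec" where
  "thv z = Matrix.vec N (\<lambda>k. th (int k) z)"

lemma thv_carrier [simp]: "thv z \<in> carrier_vec N"
  by (simp add: thv_def)

lemma dim_thv [simp]: "dim_vec (thv z) = N"
  by (simp add: thv_def)

lemma thv_index [simp]: "i < N \<Longrightarrow> vec_index (thv z) i = th (int i) z"
  by (simp add: thv_def)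

lemma theta_vec_eq: "theta_vec N \<tau> z = ee (of_nat N * z / 2) \<cdot>\<^sub>v thv z"
  by (intro eq_vecI) (auto simp: theta_vec_def thv_def th_def ee_minus)

lemma proj_pt_theta_vec: "proj_pt (theta_vec N \<tau> z) = proj_pt (thv z)"
  by (simp add: theta_vec_eq proj_pt_smult)

lemma thv_in_proj_space: "proj_pt (thv z) \<in> proj_space N"
  using th_base_point_free[of z] by (auto intro: proj_spaceI)

lemma theta_vec_nonzero: "theta_vec N \<tau> z \<noteq> 0\<^sub>v N"
proof
  assume *: "theta_vec N \<tau> z = 0\<^sub>v N"
  have "th (int k) z = 0" if "k < N" for k
    using arg_cong[OF *, of "\<lambda>v. vec_index v k"] that by (simp add: theta_vec_eq)
  thus False using th_base_point_free[of z] by blast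
qed

lemma proj_pt_thv_lattice:
  assumes "l \<in> lattice \<tau>" shows "proj_pt (thv (z + l)) = proj_pt (thv z)"
proof -
  have 1: "thv (z + of_int m) = thv z" for z m
    by (intro eq_vecI) (auto simp: thv_def tf_plus_int[OF th_tf])
  have t: "proj_pt (thv (z + \<tau>)) = proj_pt (thv z)" for z
  proof -
    have "thv (z + \<tau>) = (c0 * ee (- (of_int (int N) * z))) \<cdot>\<^sub>v thv z"
      by (intro eq_vecI) (auto simp: thv_def tf_plus_tau[OF th_tf])
    thus ?thesis by (simp add: proj_pt_smult)
  qed
  have "proj_pt (thv (z + of_int n * \<tau>)) = proj_pt (thv z)" for n z
  proof (induction n rule: int_induct[where k = 0])
    case (step1 i)
    thus ?case using t[of "z + of_int i * \<tau>"] by (simp add: algebra_simps)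
  next
    case (step2 i)
    thus ?case using t[of "z + of_int (i - 1) * \<tau>"] by (simp add: algebra_simps)
  qed simp
  moreover obtain m n :: int where "l = of_int m + of_int n * \<tau>"
    using assms unfolding lattice_def by blast
  ultimately show ?thesis using 1[of "z + of_int n * \<tau>" m] by (simp add: add_ac)
qed

lemma proj_pt_thv_cong: "z - w \<in> lattice \<tau> \<Longrightarrow> proj_pt (thv z) = proj_pt (thv w)"
  using proj_pt_thv_lattice[of "z - w" w] by simp

lemma proj_pt_thv_inj:
  assumes "proj_pt (thv z) = proj_pt (thv w)" shows "z - w \<in> lattice \<tau>"
proof (rule ccontr)
  assume nl: "z - w \<notin> lattice \<tau>"
  obtain c where c: "thv z = c \<cdot>\<^sub>v thv w" using proj_pt_eqD[OF assms] by blast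
  have thc: "th (int k) z = c * th (int k) w" if "k < N" for k
    using arg_cong[OF c, of "\<lambda>v. vec_index v k"] that by simp
  have n: "N - 1 \<ge> 2" and "c0 / (- ee w) \<noteq> 0" using N_ge_4 by auto
  then obtain u where u: "u \<in> tf (int (N - 1)) (c0 / (- ee w))" "u z \<noteq> 0"
    using tf_ex_nonvanishing by blast
  \<comment> \<open>A linear form in the coordinates that vanishes at \<open>w\<close> but not at
    \<open>z\<close>, which contradicts proportionality of the two coordinate vectors.\<close>
  have "(\<lambda>x. sig (x - w) * u x) \<in> tf (int N) c0"
    by (rule tf_mult'[OF sig_tf u(1)]) (use N_ge_4 in auto)
  then obtain a where a: "\<And>x. sig (x - w) * u x = (\<Sum>k<N. a k * th (int k) x)"
    using tf_theta_coeffs by blast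
  have "sig (z - w) * u z = c * (sig (w - w) * u w)"
    unfolding a sum_distrib_left by (rule sum.cong) (auto simp: thc)
  also have "\<dots> = 0" by (simp add: sig_eq_0_iff)
  finally show False using u nl by (simp add: sig_eq_0_iff)
qed

section \<open>The torus as a quotient and the immersion\<close>

lemma equiv_lattice_rel: "equiv UNIV (lattice_rel \<tau>)"
proof (rule equivI)
  show "refl (lattice_rel \<tau>)" by (auto simp: refl_on_def lattice_rel_def)
  show "sym (lattice_rel \<tau>)" using lattice_minus_commute by (auto simp: sym_def lattice_rel_def)
  show "trans (lattice_rel \<tau>)"
  proof (rule transI)
    fix x y z assume "(x, y) \<in> lattice_rel \<tau>" "(y, z) \<in> lattice_rel \<tau>"
    thus "(x, z) \<in> lattice_rel \<tau>" using lattice_add[of "x - y" "y - z"] by (simp add: lattice_rel_def)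
  qed
qed auto

lemma torus_pt_eq_iff: "torus_pt \<tau> z = torus_pt \<tau> w \<longleftrightarrow> z - w \<in> lattice \<tau>"
  unfolding torus_pt_def using eq_equiv_class_iff[OF equiv_lattice_rel] by (simp add: lattice_rel_def)

lemma mem_torus_pt: "w \<in> torus_pt \<tau> z \<longleftrightarrow> w - z \<in> lattice \<tau>"
  using lattice_minus_commute by (auto simp: torus_pt_def lattice_rel_def)

lemma torus_eq: "torus \<tau> = range (torus_pt \<tau>)"
  by (auto simp: torus_def torus_pt_def quotient_def)

lemma Theta_torus_pt: "Theta N \<tau> (torus_pt \<tau> z) = proj_pt (thv z)"
proof -
  have "z \<in> torus_pt \<tau> z" by (simp add: mem_torus_pt)
  moreover have "proj_pt (theta_vec N \<tau> w) = proj_pt (thv z)" if "w \<in> torus_pt \<tau> z" for w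
    using that unfolding proj_pt_theta_vec mem_torus_pt by (rule proj_pt_thv_cong)
  ultimately show ?thesis unfolding Theta_def by auto
qed

lemma inj_on_Theta: "inj_on (Theta N \<tau>) (torus \<tau>)"
  by (auto simp: inj_on_def torus_eq Theta_torus_pt torus_pt_eq_iff intro: proj_pt_thv_inj)

lemma Theta_curve_eq: "Theta_curve N \<tau> = range (\<lambda>z. proj_pt (thv z))"
  unfolding Theta_curve_def torus_eq image_image Theta_torus_pt ..

lemma theta_vec_respects: "(\<lambda>z. proj_pt (theta_vec N \<tau> z)) respects lattice_rel \<tau>"
  unfolding proj_pt_theta_vec
  by (rule congruentI, rule proj_pt_thv_cong) (simp add: lattice_rel_def)

lemma torus_immersion_Theta: "torus_immersion \<tau> N (Theta N \<tau>)"
  unfolding torus_immersion_def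
proof (intro conjI allI)
  show "Theta N \<tau> \<in> torus \<tau> \<rightarrow> proj_space N"
    by (auto simp: torus_eq Theta_torus_pt thv_in_proj_space)
  show "inj_on (Theta N \<tau>) (torus \<tau>)" by (rule inj_on_Theta)
  fix z0
  obtain i where i: "i < N" "th (int i) z0 \<noteq> 0" using th_base_point_free by blast
  define W where "W = {z. th (int i) z \<noteq> 0}"
  have hol: "th k holomorphic_on A" for k A
    using tf_holomorphic[OF th_tf] by (rule holomorphic_on_subset) auto
  have W: "open W" "z0 \<in> W"
    using holomorphic_on_imp_continuous_on[OF hol[of "int i" UNIV]] i
    unfolding W_def by (auto intro!: open_Collect_neq)
  have coord: "affine_coord i j (Theta N \<tau> (torus_pt \<tau> z)) = th (int j) z / th (int i) z"
    if "j < N" "z \<in> W" for j z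
    using that i affine_coord_proj_pt[OF thv_carrier, of i j z] by (simp add: Theta_torus_pt W_def)
  have quot: "(\<lambda>z. th (int j) z / th (int i) z) holomorphic_on W" for j
    by (intro holomorphic_intros hol) (auto simp: W_def)
  have ch: "Theta N \<tau> (torus_pt \<tau> z) \<in> affine_chart N i" if "z \<in> W" for z
    using that i thv_in_proj_space[of z]
    by (auto simp: affine_chart_def Theta_torus_pt proj_pt_def W_def thv_def)
  have hc: "(\<lambda>z. affine_coord i j (Theta N \<tau> (torus_pt \<tau> z))) holomorphic_on W" if "j < N" for j
    using quot[of j] by (rule holomorphic_transform) (simp add: coord that)
  have dn: "\<exists>j<N. deriv (\<lambda>z. affine_coord i j (Theta N \<tau> (torus_pt \<tau> z))) z0 \<noteq> 0"
  proof (rule ccontr)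
    assume neg: "\<not> ?thesis"
    have d0: "((\<lambda>z. th (int j) z / th (int i) z) has_field_derivative 0) (at z0)" if j: "j < N" for j
    proof -
      have "((\<lambda>z. affine_coord i j (Theta N \<tau> (torus_pt \<tau> z))) has_field_derivative 0) (at z0)"
        using holomorphic_derivI[OF hc[OF j] W] neg j by simp
      thus ?thesis
        by (rule has_field_derivative_transform_within_open[OF _ W]) (simp add: coord j)
    qed
    have "N - 1 \<ge> 2" and "c0 / (- ee z0) \<noteq> 0" using N_ge_4 by auto
    then obtain u where u: "u \<in> tf (int (N - 1)) (c0 / (- ee z0))" "u z0 \<noteq> 0"
      using tf_ex_nonvanishing by blast
    \<comment> \<open>A linear form in the coordinates with a simple zero at \<open>z0\<close>. If
      all affine coordinates had derivative zero there, so would its quotient \<open>h\<close> by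
      \<open>th i\<close>, and the zero would be at least double.\<close>
    have "(\<lambda>x. sig (x - z0) * u x) \<in> tf (int N) c0"
      by (rule tf_mult'[OF sig_tf u(1)]) (use N_ge_4 in auto)
    then obtain a where a: "\<And>x. sig (x - z0) * u x = (\<Sum>k<N. a k * th (int k) x)"
      using tf_theta_coeffs by blast
    define h where "h = (\<lambda>z. \<Sum>k<N. a k * (th (int k) z / th (int i) z))"
    have "(h has_field_derivative (\<Sum>k<N. a k * 0)) (at z0)"
      unfolding h_def by (intro DERIV_sum DERIV_cmult d0) auto
    hence dh: "(h has_field_derivative 0) (at z0)" by simp
    have ht: "sig (z - z0) * u z = h z * th (int i) z" if "z \<in> W" for z
      using that unfolding a h_def sum_distrib_right by (intro sum.cong) (auto simp: W_def)
    have s0: "sig 0 = 0" by (simp add: sig_eq_0_iff)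
    have "h z0 = 0" using ht[OF W(2)] i by (simp add: s0)
    obtain E where E: "(th (int i) has_field_derivative E) (at z0)"
      using hol[of "int i" UNIV] by (auto simp: holomorphic_on_open)
    have "((\<lambda>z. h z * th (int i) z) has_field_derivative 0) (at z0)"
      using DERIV_mult[OF dh E] \<open>h z0 = 0\<close> by simp
    hence d1: "((\<lambda>z. sig (z - z0) * u z) has_field_derivative 0) (at z0)"
      by (rule has_field_derivative_transform_within_open[OF _ W]) (simp add: ht)
    obtain D where D: "(sig has_field_derivative D) (at 0)"
      using holomorphic_sig by (auto simp: holomorphic_on_open)
    have "((\<lambda>z. sig (z - z0)) has_field_derivative D) (at z0)"
      using DERIV_shift[of sig D z0 "- z0"] D by simp
    moreover obtain U where "(u has_field_derivative U) (at z0)"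
      using tf_holomorphic[OF u(1)] by (auto simp: holomorphic_on_open)
    ultimately have "((\<lambda>z. sig (z - z0) * u z) has_field_derivative D * u z0) (at z0)"
      using DERIV_mult[of "\<lambda>z. sig (z - z0)" D z0 UNIV u U] by (simp add: s0)
    hence "D * u z0 = 0" using d1 DERIV_unique by blast
    moreover have "D \<noteq> 0" using deriv_sig_nonzero[of 0] D DERIV_imp_deriv by force
    ultimately show False using u by simp
  qed
  thus "\<exists>i<N. \<exists>W. open W \<and> z0 \<in> W \<and>
        (\<forall>z\<in>W. Theta N \<tau> (torus_pt \<tau> z) \<in> affine_chart N i) \<and>
        (\<forall>j<N. (\<lambda>z. affine_coord i j (Theta N \<tau> (torus_pt \<tau> z))) holomorphic_on W) \<and>
        (\<exists>j<N. deriv (\<lambda>z. affine_coord i j (Theta N \<tau> (torus_pt \<tau> z))) z0 \<noteq> 0)"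
    by (intro exI[of _ i] exI[of _ W] conjI ballI allI impI i W ch hc dn)
qed

section \<open>Equations, Hilbert function and degree of the curve\<close>

lemma mpoly_eval_thv: "f \<in> forms N d \<Longrightarrow> mpoly_eval f (thv z) = pullback f z"
  unfolding mpoly_eval_eq_peval pullback_def by (rule peval_cong) auto

lemma thv_mem_zero_locus_iff:
  assumes "F \<subseteq> (\<Union>d. forms N d)"
  shows "proj_pt (thv z) \<in> zero_locus N F \<longleftrightarrow> (\<forall>f\<in>F. pullback f z = 0)"
proof -
  have "mpoly_eval f (thv z) = pullback f z" if "f \<in> F" for f
    using assms that mpoly_eval_thv by blast
  thus ?thesis using mem_zero_locus_iff[OF assms thv_carrier thv_in_proj_space] by auto
qed

lemma vanishing_forms_Theta_curve: "vanishing_forms N (Theta_curve N \<tau>) d = curve_forms d"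
proof -
  have "(\<forall>P\<in>Theta_curve N \<tau>. \<forall>v\<in>P. mpoly_eval f v = 0) \<longleftrightarrow> (\<forall>z. pullback f z = 0)"
    if f: "f \<in> forms N d" for f
  proof -
    have "(\<forall>v\<in>proj_pt (thv z). mpoly_eval f v = 0) \<longleftrightarrow> pullback f z = 0" for z
    proof
      assume "\<forall>v\<in>proj_pt (thv z). mpoly_eval f v = 0"
      thus "pullback f z = 0" using self_in_proj_pt mpoly_eval_thv[OF f] by metis
    qed (auto simp: proj_pt_def mpoly_eval_smult[OF f] mpoly_eval_thv[OF f])
    thus ?thesis by (simp add: Theta_curve_eq)
  qed
  thus ?thesis unfolding vanishing_forms_def curve_forms_def by blast
qed

lemma hilbert_function_Theta_curve:
  "d \<ge> 1 \<Longrightarrow> hilbert_function N (Theta_curve N \<tau>) d = d * N"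
  unfolding hilbert_function_def vanishing_forms_Theta_curve by (simp add: dim_curve_forms)

text \<open>The Hilbert polynomial is \<open>N * d\<close>, of degree 1, so its leading coefficient
  is multiplied by \<open>1! = 1\<close>.\<close>

lemma has_proj_degree_Theta_curve: "has_proj_degree N (Theta_curve N \<tau>) N"
  unfolding has_proj_degree_def
proof (intro exI[of _ "[:0, of_nat N :: rat:]"] conjI)
  show "\<forall>\<^sub>F d in sequentially. of_nat (hilbert_function N (Theta_curve N \<tau>) d) =
      poly [:0, of_nat N :: rat:] (of_nat d)"
    using eventually_ge_at_top[of 1] by eventually_elim (simp add: hilbert_function_Theta_curve)
qed (use N_ge_4 in simp)

lemma ex_quadric_basis:
  obtains Q where "Q \<subseteq> curve_forms 2" "curve_forms 2 \<subseteq> mpoly.span Q" "mpoly.independent Q"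
    "finite Q" "card Q = N * (N - 3) div 2"
proof -
  obtain Q where Q: "Q \<subseteq> curve_forms 2" "mpoly.independent Q" "curve_forms 2 \<subseteq> mpoly.span Q"
    "card Q = mpoly.dim (curve_forms 2)"
    using mpoly.basis_exists by metis
  have "Q \<subseteq> mpoly.span ((\<lambda>m. Poly_Mapping.single m (1::complex)) ` mons N 2)"
    using Q(1) by (auto simp: forms_basis(4) curve_forms_def)
  hence "finite Q"
    using mpoly.independent_span_bound[OF forms_basis(1) Q(2)] by blast
  thus ?thesis using that Q by (simp add: dim_curve_forms_2)
qed

lemma scheme_intersection_Theta_curve:
  assumes "Q \<subseteq> curve_forms 2" "curve_forms 2 \<subseteq> mpoly.span Q"
  shows "scheme_intersection N (Theta_curve N \<tau>) Q"
proof -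
  interpret curve_quadrics \<tau> N Q by unfold_locales (use assms in auto)
  have QF: "Q \<subseteq> (\<Union>d. forms N d)" using assms(1) unfolding curve_forms_def by blast
  have "Theta_curve N \<tau> = zero_locus N Q"
  proof
    have "pullback q z = 0" if "q \<in> Q" for q z
      using assms(1) that unfolding curve_forms_def by blast
    thus "Theta_curve N \<tau> \<subseteq> zero_locus N Q"
      using thv_mem_zero_locus_iff[OF QF] by (auto simp: Theta_curve_eq)
    show "zero_locus N Q \<subseteq> Theta_curve N \<tau>"
    proof
      fix P assume P: "P \<in> zero_locus N Q"
      hence PP: "P \<in> proj_space N" by (simp add: zero_locus_def)
      obtain v i where v: "v \<in> carrier_vec N" "i < N" "vec_index v i \<noteq> 0" "P = proj_pt v"
        using PP by (rule proj_spaceE)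
      have "peval q (vec_index v) = 0" if "q \<in> Q" for q
        using P PP v mem_zero_locus_iff[OF QF v(1)] that by (auto simp: mpoly_eval_eq_peval)
      then obtain z c where zc: "c \<noteq> 0" "\<And>i. i < N \<Longrightarrow> vec_index v i = c * th (int i) z"
        using common_zero_on_curve[of "vec_index v" i] v by blast
      have "v = c \<cdot>\<^sub>v thv z" using v(1) by (intro eq_vecI) (auto simp: zc(2) thv_def)
      hence "P = proj_pt (thv z)" using v zc proj_pt_smult by simp
      thus "P \<in> Theta_curve N \<tau>" by (simp add: Theta_curve_eq)
    qed
  qed
  \<comment> \<open>The exponent \<open>0\<close> works: the quadrics generate all forms through the
    curve, not only up to saturation.\<close>
  moreover have "\<exists>e. mpoly_var i ^ e * f \<in> ideal_gen N Q"
    if "f \<in> vanishing_forms N (Theta_curve N \<tau>) d" for d f i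
    using that curve_forms_subset_idl[of d]
    by (intro exI[of _ 0]) (auto simp: vanishing_forms_Theta_curve idl_def)
  ultimately show ?thesis unfolding scheme_intersection_def by blast
qed

lemma zariski_closed_Theta_curve: "zariski_closed N (Theta_curve N \<tau>)"
proof -
  obtain Q where Q: "Q \<subseteq> curve_forms 2" "curve_forms 2 \<subseteq> mpoly.span Q"
    using ex_quadric_basis by metis
  have "Theta_curve N \<tau> = zero_locus N Q"
    using scheme_intersection_Theta_curve[OF Q] by (simp add: scheme_intersection_def)
  moreover have "Q \<subseteq> (\<Union>d. forms N d)" using Q(1) unfolding curve_forms_def by blast
  ultimately show ?thesis unfolding zariski_closed_def by blast
qed

section \<open>Irreducibility and dimension\<close>

lemma separating_form:
  assumes "zariski_closed N A" "\<not> Theta_curve N \<tau> \<subseteq> A"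
  obtains f d z0 where "f \<in> forms N d" "pullback f z0 \<noteq> 0"
    "\<And>z. proj_pt (thv z) \<in> A \<Longrightarrow> pullback f z = 0"
proof -
  obtain F where F: "F \<subseteq> (\<Union>d. forms N d)" "A = zero_locus N F"
    using assms(1) unfolding zariski_closed_def by blast
  obtain z0 where "proj_pt (thv z0) \<notin> A" using assms(2) by (auto simp: Theta_curve_eq)
  then obtain f where f: "f \<in> F" "pullback f z0 \<noteq> 0" using F thv_mem_zero_locus_iff by auto
  moreover obtain d where "f \<in> forms N d" using f F by blast
  moreover have "pullback f z = 0" if "proj_pt (thv z) \<in> A" for z
    using that f(1) F thv_mem_zero_locus_iff by auto
  ultimately show ?thesis using that by blast
qed

text \<open>The pullbacks of forms are entire functions, and entire functions have no zero
  divisors.\<close>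

lemma irreducible_Theta_curve: "irreducible_closed N (Theta_curve N \<tau>)"
  unfolding irreducible_closed_def
proof (intro conjI allI impI)
  show "zariski_closed N (Theta_curve N \<tau>)" by (rule zariski_closed_Theta_curve)
  show "Theta_curve N \<tau> \<noteq> {}" by (simp add: Theta_curve_eq)
  fix A B assume AB: "zariski_closed N A \<and> zariski_closed N B \<and> Theta_curve N \<tau> \<subseteq> A \<union> B"
  show "Theta_curve N \<tau> \<subseteq> A \<or> Theta_curve N \<tau> \<subseteq> B"
  proof (rule ccontr)
    assume *: "\<not> ?thesis"
    have A: "zariski_closed N A" "\<not> Theta_curve N \<tau> \<subseteq> A" and B: "zariski_closed N B" "\<not> Theta_curve N \<tau> \<subseteq> B"
      using AB * by auto
    obtain f d z0 where f: "f \<in> forms N d" "pullback f z0 \<noteq> 0"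
      "\<And>z. proj_pt (thv z) \<in> A \<Longrightarrow> pullback f z = 0"
      using separating_form[OF A] by metis
    obtain g e z1 where g: "g \<in> forms N e" "pullback g z1 \<noteq> 0"
      "\<And>z. proj_pt (thv z) \<in> B \<Longrightarrow> pullback g z = 0"
      using separating_form[OF B] by metis
    have "proj_pt (thv z) \<in> A \<or> proj_pt (thv z) \<in> B" for z
      using AB by (auto simp: Theta_curve_eq)
    hence "pullback f z * pullback g z = 0" for z using f(3) g(3) by auto
    hence "pullback f z0 = 0"
      using entire_mult_zeroD[of "pullback f" "pullback g" z1 z0] f g pullback_holomorphic by blast
    thus False using f by simp
  qed
qed

text \<open>On a proper closed subset some form vanishes whose pullback is not identically zero. The
  pullback has finitely many zeros modulo the lattice, so the subset is finite.\<close>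

lemma proper_irreducible_subset:
  assumes "irreducible_closed N Z" "Z \<subset> Theta_curve N \<tau>"
  obtains P where "Z = {P}"
proof -
  have "zariski_closed N Z" "\<not> Theta_curve N \<tau> \<subseteq> Z"
    using assms unfolding irreducible_closed_def by auto
  then obtain f d z0 where f: "f \<in> forms N d" "pullback f z0 \<noteq> 0"
      "\<And>z. proj_pt (thv z) \<in> Z \<Longrightarrow> pullback f z = 0"
    using separating_form by metis
  have "c0 ^ d \<noteq> 0" by simp
  then obtain A where A: "finite A" "\<And>z. pullback f z = 0 \<Longrightarrow> \<exists>a\<in>A. z - a \<in> lattice \<tau>"
    using tf_finite_zeros[OF pullback_tf[OF f(1)] _ f(2)] by blast
  have "Z \<subseteq> (\<lambda>a. proj_pt (thv a)) ` A"
  proof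
    fix P assume P: "P \<in> Z"
    then obtain z where z: "P = proj_pt (thv z)" using assms(2) by (auto simp: Theta_curve_eq)
    then obtain a where "a \<in> A" "z - a \<in> lattice \<tau>" using f(3) A(2) P by blast
    thus "P \<in> (\<lambda>a. proj_pt (thv a)) ` A" using z proj_pt_thv_cong by blast
  qed
  hence "finite Z" using A(1) finite_surj by blast
  moreover have "Z \<subseteq> proj_space N" using assms(2) thv_in_proj_space by (auto simp: Theta_curve_eq)
  ultimately show ?thesis using irreducible_finite[OF assms(1)] that by blast
qed

lemma krull_dim_Theta_curve: "krull_dim N (Theta_curve N \<tau>) = 1"
proof (rule antisym)
  show "krull_dim N (Theta_curve N \<tau>) \<le> 1"
    unfolding krull_dim_def
  proof (rule Sup_least, clarify)
    fix n and Z :: "nat \<Rightarrow> complex Matrix.vec set set"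
    assume Z: "\<forall>i\<le>n. irreducible_closed N (Z i) \<and> Z i \<subseteq> Theta_curve N \<tau>" "\<forall>i<n. Z i \<subset> Z (Suc i)"
    have "n \<le> 1"
    proof (rule ccontr)
      assume "\<not> n \<le> 1"
      hence n: "2 \<le> n" by simp
      have Z01: "Z 0 \<subset> Z 1" and Z12: "Z 1 \<subset> Z 2"
        using Z(2)[rule_format, of 0] Z(2)[rule_format, of 1] n by (auto simp: numeral_2_eq_2)
      have irr: "irreducible_closed N (Z 1)" "irreducible_closed N (Z 0)" and sub: "Z 2 \<subseteq> Theta_curve N \<tau>"
        using Z(1) n by auto
      have "Z 1 \<subset> Theta_curve N \<tau>" using Z12 sub by (rule psubset_subset_trans)
      then obtain P where P: "Z 1 = {P}" by (rule proper_irreducible_subset[OF irr(1)])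
      have "Z 0 \<subseteq> {P}" "Z 0 \<noteq> {P}" using Z01 unfolding P psubset_eq by simp_all
      hence "Z 0 = {}" by (simp add: subset_singleton_iff)
      thus False using irr(2) by (simp add: irreducible_closed_def)
    qed
    thus "enat n \<le> 1" by (simp add: one_enat_def)
  qed
  define X where "X = Theta_curve N \<tau>"
  define P where "P = proj_pt (thv 0)"
  obtain u where u: "u - 0 \<notin> lattice \<tau>" using ex_notin_lattice_translates[of "{0}"] by auto
  have "P \<in> X" "proj_pt (thv u) \<in> X" by (auto simp: X_def P_def Theta_curve_eq)
  moreover have "proj_pt (thv u) \<noteq> P" using proj_pt_thv_inj[of u 0] u by (auto simp: P_def)
  ultimately have "{P} \<subset> X" by blast
  moreover have "irreducible_closed N {P}" unfolding P_def by (rule irreducible_point[OF thv_in_proj_space])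
  moreover have "irreducible_closed N X" unfolding X_def by (rule irreducible_Theta_curve)
  ultimately have "\<exists>Z. (\<forall>i\<le>1. irreducible_closed N (Z i) \<and> Z i \<subseteq> X) \<and> (\<forall>i<(1::nat). Z i \<subset> Z (Suc i))"
    by (intro exI[of _ "\<lambda>i::nat. if i = 0 then {P} else X"]) auto
  hence "enat 1 \<in> {enat n | n. \<exists>Z. (\<forall>i\<le>n. irreducible_closed N (Z i) \<and> Z i \<subseteq> X) \<and> (\<forall>i<n. Z i \<subset> Z (Suc i))}"
    by (intro CollectI exI[of _ 1] conjI refl)
  thus "1 \<le> krull_dim N (Theta_curve N \<tau>)"
    unfolding krull_dim_def X_def one_enat_def by (rule Sup_upper)
qed

end

section \<open>Translations by torsion points and the inversion\<close>

lemma image_mult_mat_vec_proj_pt: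
  assumes "A \<in> carrier_mat N N" "v \<in> carrier_vec N"
  shows "(\<lambda>v. A *\<^sub>v v) ` proj_pt v = proj_pt (A *\<^sub>v v)"
  using assms mult_mat_vec[OF assms] unfolding proj_pt_def by (auto simp: image_iff) metis

text \<open>By \<open>expressed_by\<close> the inverse of the automorphism acts on points by the
  transpose of \<open>M\<close>, so the automorphism itself acts by the inverse \<open>B\<close> of
  that transpose.\<close>

lemma proj_automorphism_of_inverse:
  assumes M: "M \<in> carrier_mat N N" and B: "B \<in> carrier_mat N N"
    and inv: "B * transpose_mat M = 1\<^sub>m N" "transpose_mat M * B = 1\<^sub>m N"
  shows "\<exists>\<phi>. proj_automorphism N \<phi> \<and> expressed_by N \<phi> M"
proof -
  define \<phi> :: "complex Matrix.vec set \<Rightarrow> complex Matrix.vec set" where "\<phi> = (\<lambda>P. (\<lambda>v. B *\<^sub>v v) ` P)"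
  have C: "transpose_mat M \<in> carrier_mat N N" using M by simp
  have "invertible_mat B"
    unfolding invertible_mat_def inverts_mat_def using B C inv by auto
  hence "proj_automorphism N \<phi>"
    unfolding proj_automorphism_def \<phi>_def using B by blast
  moreover have "expressed_by N \<phi> M"
    unfolding expressed_by_def
  proof (intro conjI ballI)
    have "M * transpose_mat B = 1\<^sub>m N" "transpose_mat B * M = 1\<^sub>m N"
      using arg_cong[OF inv(1), of transpose_mat] arg_cong[OF inv(2), of transpose_mat]
      by (simp_all add: transpose_mult[OF B C] transpose_mult[OF C B])
    thus "invertible_mat M"
      unfolding invertible_mat_def inverts_mat_def using B M by auto
    fix P assume "P \<in> proj_space N"
    then obtain v where v: "v \<in> carrier_vec N" "P = proj_pt v" by (rule proj_spaceE)
    have "B *\<^sub>v (transpose_mat M *\<^sub>v v) = v"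
      using v(1) assoc_mult_mat_vec[OF B C v(1)] by (simp add: inv)
    thus "\<phi> ((\<lambda>v. transpose_mat M *\<^sub>v v) ` P) = P"
      using C v B by (simp add: \<phi>_def image_mult_mat_vec_proj_pt[where N = N])
  qed (rule M)
  ultimately show ?thesis by blast
qed

section \<open>Permutation matrices\<close>

definition perm_mat :: "nat \<Rightarrow> (nat \<Rightarrow> nat) \<Rightarrow> complex mat" where
  "perm_mat N p = mat N N (\<lambda>(i, j). if i = p j then 1 else 0)"

lemma perm_mat_carrier [simp]: "perm_mat N p \<in> carrier_mat N N"
  by (simp add: perm_mat_def)

lemma transpose_perm_mat_mult_vec:
  assumes "v \<in> carrier_vec N" "\<And>i. i < N \<Longrightarrow> p i < N"
  shows "transpose_mat (perm_mat N p) *\<^sub>v v = Matrix.vec N (\<lambda>i. vec_index v (p i))"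
  using assms
  by (intro eq_vecI)
     (auto simp: perm_mat_def scalar_prod_def if_distrib[of "\<lambda>x. x * _"] cong: if_cong)

lemma perm_mat_transpose_inverse:
  assumes "inj_on p {..<N}" "\<And>i. i < N \<Longrightarrow> p i < N"
  shows "perm_mat N p * transpose_mat (perm_mat N p) = 1\<^sub>m N"
    "transpose_mat (perm_mat N p) * perm_mat N p = 1\<^sub>m N"
proof -
  have surj: "p ` {..<N} = {..<N}"
    using assms by (intro endo_inj_surj) auto
  show "transpose_mat (perm_mat N p) * perm_mat N p = 1\<^sub>m N"
    using assms
    by (intro eq_matI)
       (auto simp: perm_mat_def scalar_prod_def if_distrib[of "\<lambda>x. x * _"] inj_on_eq_iff cong: if_cong)
  show "perm_mat N p * transpose_mat (perm_mat N p) = 1\<^sub>m N"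
  proof (rule eq_matI)
    fix i j assume "i < dim_row (1\<^sub>m N)" "j < dim_col (1\<^sub>m N)"
    hence ij: "i < N" "j < N" by auto
    obtain k where k: "k < N" "i = p k" using surj ij(1) by (metis imageE lessThan_iff)
    have "(\<Sum>m = 0..<N. (if i = p m then 1 else 0) * (if j = p m then 1 else (0::complex))) =
        (\<Sum>m = 0..<N. if m = k then (if i = j then 1 else 0) else 0)"
      using assms(1) k by (intro sum.cong) (auto simp: inj_on_def)
    also have "\<dots> = (if i = j then 1 else 0)" using k by simp
    finally show "(perm_mat N p * transpose_mat (perm_mat N p)) $$ (i, j) = 1\<^sub>m N $$ (i, j)"
      using ij by (simp add: perm_mat_def scalar_prod_def)
  qed (auto simp: perm_mat_def)
qed

lemma M_S_eq: "M_S N = perm_mat N (\<lambda>j. (j + 1) mod N)"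
  unfolding M_S_def perm_mat_def by (rule cong_mat) auto

lemma M_neg_eq: "M_neg N = perm_mat N (\<lambda>j. nat ((- int j) mod int N))"
proof -
  have "(int i mod int N = (- int j) mod int N) = (i = nat ((- int j) mod int N))" if "i < N" for i j
    using that by (auto simp: nat_eq_iff2)
  thus ?thesis unfolding M_neg_def perm_mat_def by (intro cong_mat) auto
qed

context theta_curve begin

lemma zeta_power: "zeta N ^ k = ee (of_nat k / of_nat N)"
  by (simp add: zeta_def ee_power)

lemma theta_vec_carrier [simp]: "theta_vec N \<tau> z \<in> carrier_vec N"
  by (simp add: theta_vec_def)

lemma theta_vec_shift_tau:
  "proj_pt (theta_vec N \<tau> (z - \<tau> / of_nat N)) =
     proj_pt (Matrix.vec N (\<lambda>k. theta N ((int k + 1) mod int N) z \<tau>))"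
proof -
  have "theta_vec N \<tau> (z - \<tau> / of_nat N) =
      ee (z + 1/2 - \<tau> / (2 * of_nat N)) \<cdot>\<^sub>v Matrix.vec N (\<lambda>k. theta N ((int k + 1) mod int N) z \<tau>)"
    by (intro eq_vecI) (auto simp: theta_vec_def theta_shift_tau theta_mod)
  thus ?thesis by (simp add: proj_pt_smult)
qed

lemma theta_vec_shift_1:
  "proj_pt (theta_vec N \<tau> (z - 1 / of_nat N)) =
     proj_pt (Matrix.vec N (\<lambda>k. zeta N ^ k * theta N (int k) z \<tau>))"
proof -
  have "theta_vec N \<tau> (z - 1 / of_nat N) =
      ee (1/2) \<cdot>\<^sub>v Matrix.vec N (\<lambda>k. zeta N ^ k * theta N (int k) z \<tau>)"
    by (intro eq_vecI) (auto simp: theta_vec_def theta_shift_1 zeta_power ee_add)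
  thus ?thesis by (simp add: proj_pt_smult)
qed

lemma theta_vec_uminus:
  "proj_pt (theta_vec N \<tau> (- z)) =
     proj_pt (Matrix.vec N (\<lambda>k. theta N ((- int k) mod int N) z \<tau>))"
proof -
  have "theta_vec N \<tau> (- z) =
      ee (of_nat N / 2) \<cdot>\<^sub>v Matrix.vec N (\<lambda>k. theta N ((- int k) mod int N) z \<tau>)"
    by (intro eq_vecI) (auto simp: theta_vec_def theta_uminus theta_mod)
  thus ?thesis by (simp add: proj_pt_smult)
qed

text \<open>The matrix describes the inverse of \<open>\<phi>\<close>, so the formulas for
  \<open>z - S\<close>, \<open>z - T\<close> and \<open>- z\<close> are applied at the image point
  \<open>w\<close>: the transpose of \<open>M\<close> carries \<open>w\<close> back to
  \<open>z\<close>, and \<open>\<phi>\<close> undoes this.\<close>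

lemma expressed_by_acts:
  assumes "expressed_by N \<phi> M"
    "proj_pt (transpose_mat M *\<^sub>v theta_vec N \<tau> w) = proj_pt (theta_vec N \<tau> z)"
  shows "\<phi> (proj_pt (thv z)) = proj_pt (thv w)"
proof -
  have M: "transpose_mat M \<in> carrier_mat N N" using assms(1) by (simp add: expressed_by_def)
  have "(\<lambda>v. transpose_mat M *\<^sub>v v) ` proj_pt (theta_vec N \<tau> w) = proj_pt (theta_vec N \<tau> z)"
    using image_mult_mat_vec_proj_pt[OF M theta_vec_carrier] assms(2) by simp
  thus ?thesis
    using assms(1) thv_in_proj_space[of w] unfolding expressed_by_def proj_pt_theta_vec by metis
qed

lemma inv_into_Theta: "inv_into (torus \<tau>) (Theta N \<tau>) (proj_pt (thv z)) = torus_pt \<tau> z"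
  unfolding Theta_torus_pt [symmetric]
  by (rule inv_into_f_f[OF inj_on_Theta]) (simp add: torus_eq)

lemma curve_add_thv:
  "curve_add N \<tau> (proj_pt (thv z)) (Theta N \<tau> (torus_pt \<tau> w)) = proj_pt (thv (z + w))"
proof -
  have "torus_add (torus_pt \<tau> z) (torus_pt \<tau> w) = torus_pt \<tau> (z + w)"
  proof (intro equalityI subsetI)
    fix x assume "x \<in> torus_add (torus_pt \<tau> z) (torus_pt \<tau> w)"
    then obtain p q where "x = p + q" "p - z \<in> lattice \<tau>" "q - w \<in> lattice \<tau>"
      by (auto simp: torus_add_def mem_torus_pt)
    thus "x \<in> torus_pt \<tau> (z + w)"
      using lattice_add[of "p - z" "q - w"] by (simp add: mem_torus_pt algebra_simps)
  next
    fix x assume "x \<in> torus_pt \<tau> (z + w)"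
    hence "x - w \<in> torus_pt \<tau> z" "w \<in> torus_pt \<tau> w" "x = (x - w) + w"
      by (simp_all add: mem_torus_pt algebra_simps)
    thus "x \<in> torus_add (torus_pt \<tau> z) (torus_pt \<tau> w)" unfolding torus_add_def by blast
  qed
  thus ?thesis
    by (simp add: curve_add_def Theta_torus_pt inv_into_Theta)
qed

lemma curve_neg_thv: "curve_neg N \<tau> (proj_pt (thv z)) = proj_pt (thv (- z))"
proof -
  have "torus_neg (torus_pt \<tau> z) = torus_pt \<tau> (- z)"
  proof (intro equalityI subsetI)
    fix x assume "x \<in> torus_neg (torus_pt \<tau> z)"
    then obtain p where "x = - p" "p - z \<in> lattice \<tau>"
      by (auto simp: torus_neg_def mem_torus_pt)
    thus "x \<in> torus_pt \<tau> (- z)" using lattice_uminus[of "p - z"] by (simp add: mem_torus_pt)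
  next
    fix x assume "x \<in> torus_pt \<tau> (- z)"
    hence "- x \<in> torus_pt \<tau> z"
      using lattice_uminus[of "x + z"] by (simp add: mem_torus_pt)
    thus "x \<in> torus_neg (torus_pt \<tau> z)" unfolding torus_neg_def by (rule rev_image_eqI) simp
  qed
  thus ?thesis by (simp add: curve_neg_def Theta_torus_pt inv_into_Theta)
qed

lemma M_S_acts: "transpose_mat (M_S N) *\<^sub>v theta_vec N \<tau> w =
    Matrix.vec N (\<lambda>k. theta N ((int k + 1) mod int N) w \<tau>)"
  unfolding M_S_eq
  by (subst transpose_perm_mat_mult_vec)
     (auto simp: theta_vec_def zmod_int add.commute intro!: eq_vecI)

lemma M_neg_acts: "transpose_mat (M_neg N) *\<^sub>v theta_vec N \<tau> w =
    Matrix.vec N (\<lambda>k. theta N ((- int k) mod int N) w \<tau>)"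
proof -
  have "nat (- int i mod int N) < N" for i
    by (simp add: nat_less_iff)
  thus ?thesis
    unfolding M_neg_eq
    by (subst transpose_perm_mat_mult_vec) (auto simp: theta_vec_def intro!: eq_vecI)
qed

lemma M_T_acts: "transpose_mat (M_T N) *\<^sub>v theta_vec N \<tau> w =
    Matrix.vec N (\<lambda>k. zeta N ^ k * theta N (int k) w \<tau>)"
  by (intro eq_vecI)
     (auto simp: M_T_def theta_vec_def scalar_prod_def if_distrib[of "\<lambda>x. x * _"] cong: if_cong)

lemma translation_S:
  "\<exists>\<phi>. proj_automorphism N \<phi> \<and> expressed_by N \<phi> (M_S N) \<and>
     (\<forall>x\<in>Theta_curve N \<tau>. \<phi> x = curve_add N \<tau> x (Theta N \<tau> (torus_pt \<tau> (\<tau> / of_nat N))))"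
proof -
  have inj: "inj_on (\<lambda>j. (j + 1) mod N) {..<N}"
  proof (rule inj_onI)
    fix i j assume "i \<in> {..<N}" "j \<in> {..<N}" "(i + 1) mod N = (j + 1) mod N"
    thus "i = j" by (auto simp: mod_Suc split: if_splits)
  qed
  \<comment> \<open>A permutation matrix is inverse to its transpose, so \<open>M_S N\<close> itself
    serves as the matrix of \<open>\<phi>\<close>.\<close>
  obtain \<phi> where phi: "proj_automorphism N \<phi>" "expressed_by N \<phi> (M_S N)"
    using proj_automorphism_of_inverse[of "M_S N" N "M_S N"] perm_mat_transpose_inverse[OF inj]
    by (auto simp: M_S_eq)
  have "\<phi> (proj_pt (thv z)) = proj_pt (thv (z + \<tau> / of_nat N))" for z
    by (rule expressed_by_acts[OF phi(2)])
       (use theta_vec_shift_tau[of "z + \<tau> / of_nat N"] in \<open>simp add: M_S_acts\<close>)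
  thus ?thesis using phi by (auto simp: Theta_curve_eq curve_add_thv)
qed

lemma translation_T:
  "\<exists>\<phi>. proj_automorphism N \<phi> \<and> expressed_by N \<phi> (M_T N) \<and>
     (\<forall>x\<in>Theta_curve N \<tau>. \<phi> x = curve_add N \<tau> x (Theta N \<tau> (torus_pt \<tau> (1 / of_nat N))))"
proof -
  define B where "B = mat N N (\<lambda>(i, j). if i = j then inverse (zeta N ^ i) else 0)"
  have nz: "zeta N \<noteq> 0" by (simp add: zeta_def)
  have "B * transpose_mat (M_T N) = 1\<^sub>m N" "transpose_mat (M_T N) * B = 1\<^sub>m N"
    by (auto intro!: eq_matI simp: B_def M_T_def scalar_prod_def nz if_distrib[of "\<lambda>x. x * _"] cong: if_cong)
  then obtain \<phi> where phi: "proj_automorphism N \<phi>" "expressed_by N \<phi> (M_T N)"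
    using proj_automorphism_of_inverse[of "M_T N" N B] by (auto simp: B_def M_T_def)
  have "\<phi> (proj_pt (thv z)) = proj_pt (thv (z + 1 / of_nat N))" for z
    by (rule expressed_by_acts[OF phi(2)])
       (use theta_vec_shift_1[of "z + 1 / of_nat N"] in \<open>simp add: M_T_acts\<close>)
  thus ?thesis using phi by (auto simp: Theta_curve_eq curve_add_thv)
qed

lemma inversion:
  "\<exists>\<phi>. proj_automorphism N \<phi> \<and> expressed_by N \<phi> (M_neg N) \<and>
     (\<forall>x\<in>Theta_curve N \<tau>. \<phi> x = curve_neg N \<tau> x)"
proof -
  have lt: "nat (- int i mod int N) < N" for i by (simp add: nat_less_iff)
  have inj: "inj_on (\<lambda>j. nat ((- int j) mod int N)) {..<N}"
  proof (rule inj_onI)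
    fix i j assume ij: "i \<in> {..<N}" "j \<in> {..<N}" "nat ((- int i) mod int N) = nat ((- int j) mod int N)"
    hence "(- int i) mod int N = (- int j) mod int N" by (simp add: eq_nat_nat_iff)
    hence "int i mod int N = int j mod int N"
      using mod_minus_cong[of "- int i" "int N" "- int j"] by simp
    thus "i = j" using ij by simp
  qed
  obtain \<phi> where phi: "proj_automorphism N \<phi>" "expressed_by N \<phi> (M_neg N)"
    using proj_automorphism_of_inverse[of "M_neg N" N "M_neg N"] perm_mat_transpose_inverse[OF inj lt]
    by (auto simp: M_neg_eq)
  have "\<phi> (proj_pt (thv z)) = proj_pt (thv (- z))" for z
    by (rule expressed_by_acts[OF phi(2)])
       (use theta_vec_uminus[of "- z"] in \<open>simp add: M_neg_acts\<close>)
  thus ?thesis using phi by (auto simp: Theta_curve_eq curve_neg_thv)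
qed

end

theorem theorem5p10:
  fixes N :: nat and \<tau> :: complex
  assumes "N \<ge> 4" and "Im \<tau> > 0"
  shows
    "((\<forall>z. theta_vec N \<tau> z \<noteq> 0\<^sub>v N) \<and>
      (\<lambda>z. proj_pt (theta_vec N \<tau> z)) respects lattice_rel \<tau> \<and>
      torus_immersion \<tau> N (Theta N \<tau>))
     \<and>
     (projective_curve N (Theta_curve N \<tau>) \<and>
      has_proj_degree N (Theta_curve N \<tau>) N \<and>
      (\<exists>Q \<subseteq> forms N 2. finite Q \<and> card Q = N * (N - 3) div 2 \<and> mpoly.independent Q \<and>
         scheme_intersection N (Theta_curve N \<tau>) Q))
     \<and>
     ((\<exists>\<phi>. proj_automorphism N \<phi> \<and> expressed_by N \<phi> (M_S N) \<and>
         (\<forall>x\<in>Theta_curve N \<tau>.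
            \<phi> x = curve_add N \<tau> x (Theta N \<tau> (torus_pt \<tau> (\<tau> / of_nat N))))) \<and>
      (\<exists>\<phi>. proj_automorphism N \<phi> \<and> expressed_by N \<phi> (M_T N) \<and>
         (\<forall>x\<in>Theta_curve N \<tau>.
            \<phi> x = curve_add N \<tau> x (Theta N \<tau> (torus_pt \<tau> (1 / of_nat N))))) \<and>
      (\<exists>\<phi>. proj_automorphism N \<phi> \<and> expressed_by N \<phi> (M_neg N) \<and>
         (\<forall>x\<in>Theta_curve N \<tau>. \<phi> x = curve_neg N \<tau> x)) \<and>
      (\<forall>z.
         proj_pt (Matrix.vec N (\<lambda>k. theta N (int k) (z - \<tau> / of_nat N) \<tau>)) =
           proj_pt (Matrix.vec N (\<lambda>k. theta N ((int k + 1) mod int N) z \<tau>)) \<and>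
         proj_pt (Matrix.vec N (\<lambda>k. theta N (int k) (z - 1 / of_nat N) \<tau>)) =
           proj_pt (Matrix.vec N (\<lambda>k. zeta N ^ k * theta N (int k) z \<tau>)) \<and>
         proj_pt (Matrix.vec N (\<lambda>k. theta N (int k) (- z) \<tau>)) =
           proj_pt (Matrix.vec N (\<lambda>k. theta N ((- int k) mod int N) z \<tau>))))"
proof -
  interpret theta_curve \<tau> N
    by unfold_locales (use assms in auto)
  obtain Q where Q: "Q \<subseteq> curve_forms 2" "curve_forms 2 \<subseteq> mpoly.span Q" "mpoly.independent Q"
      "finite Q" "card Q = N * (N - 3) div 2"
    by (rule ex_quadric_basis)
  have "Q \<subseteq> forms N 2" using Q(1) by (auto simp: curve_forms_def)
  hence quadrics: "\<exists>Q \<subseteq> forms N 2. finite Q \<and> card Q = N * (N - 3) div 2 \<and> mpoly.independent Q \<and>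
      scheme_intersection N (Theta_curve N \<tau>) Q"
    using Q scheme_intersection_Theta_curve[OF Q(1,2)] by blast
  have curve: "projective_curve N (Theta_curve N \<tau>)"
    unfolding projective_curve_def using irreducible_Theta_curve krull_dim_Theta_curve ..
  show ?thesis
    using theta_vec_nonzero theta_vec_respects torus_immersion_Theta curve
      has_proj_degree_Theta_curve quadrics translation_S translation_T inversion
      theta_vec_shift_tau theta_vec_shift_1 theta_vec_uminus
    unfolding theta_vec_def by (intro conjI allI)
qed

end
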